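(* Let $L\ge 1$ and let $A[1\ldots L]$ be an array of real numbers, initially all equal to $0$. Consider an arbitrary sequence of $s$ operations, each being one of the following range operations (with $1\le i\le j\le L$, $c,g,\alpha$ real): $\mathsf{Lookup}(i)$: return $A[i]$; $\mathsf{AddConst}(i,j,c)$: for every $k\in[i\ldots j]$ set $A[k]\leftarrow A[k]+c$; $\mathsf{AddGradient}(i,j,g)$: for every $k\in[i\ldots j]$ set $A[k]\leftarrow A[k]+k\cdot g$; $\mathsf{LeftLinearWave}(i,j,\alpha)$: for every $k\in[i\ldots j]$ set $A[k]\leftarrow \min_{t\in[i\ldots k]}\big(A[t]+(k-t)\alpha\big)$ (all new values computed from the values before the operation); $\mathsf{RightLinearWave}(i,j,\alpha)$: for every $k\in[i\ldots j]$ set $A[k]\leftarrow \min_{t\in[k\ldots j]}\big(A[t]+(t-k)\alpha\big)$ (all new values computed from the values before the operation). Then there is a data structure that performs such a sequence of $s$ operations in amortized $O(\mathrm{polylog}(s))$ time per operation.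
   Context: Time is measured in a model where arithmetic operations and comparisons on the stored values take constant time. *)

theory Defs
  imports Complex_Main "HOL-Library.Landau_Symbols"
begin

section \<open>The array and the range operations\<close>

datatype operation =
    Lookup nat
  | AddConst nat nat real
  | AddGradient nat nat real
  | LeftLinearWave nat nat real
  | RightLinearWave nat nat real

fun valid_op :: "nat \<Rightarrow> operation \<Rightarrow> bool" where
  "valid_op L (Lookup i) \<longleftrightarrow> 1 \<le> i \<and> i \<le> L"
| "valid_op L (AddConst i j c) \<longleftrightarrow> 1 \<le> i \<and> i \<le> j \<and> j \<le> L"
| "valid_op L (AddGradient i j g) \<longleftrightarrow> 1 \<le> i \<and> i \<le> j \<and> j \<le> L"
| "valid_op L (LeftLinearWave i j \<alpha>) \<longleftrightarrow> 1 \<le> i \<and> i \<le> j \<and> j \<le> L"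
| "valid_op L (RightLinearWave i j \<alpha>) \<longleftrightarrow> 1 \<le> i \<and> i \<le> j \<and> j \<le> L"

text \<open>
  An array with entries 1 to L is a function on all of \<^typ>\<open>nat\<close>; valid operations
  neither read nor write an entry outside this range.
\<close>

fun apply_op :: "operation \<Rightarrow> (nat \<Rightarrow> real) \<Rightarrow> nat \<Rightarrow> real" where
  "apply_op (Lookup i) A = A"
| "apply_op (AddConst i j c) A =
    (\<lambda>k. if k \<in> {i..j} then A k + c else A k)"
| "apply_op (AddGradient i j g) A =
    (\<lambda>k. if k \<in> {i..j} then A k + real k * g else A k)"
| "apply_op (LeftLinearWave i j \<alpha>) A =
    (\<lambda>k. if k \<in> {i..j} then (MIN t\<in>{i..k}. A t + (real k - real t) * \<alpha>) else A k)"
| "apply_op (RightLinearWave i j \<alpha>) A =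
    (\<lambda>k. if k \<in> {i..j} then (MIN t\<in>{k..j}. A t + (real t - real k) * \<alpha>) else A k)"

fun returned :: "operation \<Rightarrow> (nat \<Rightarrow> real) \<Rightarrow> real list" where
  "returned (Lookup i) A = [A i]"
| "returned _ A = []"

fun answers :: "(nat \<Rightarrow> real) \<Rightarrow> operation list \<Rightarrow> real list" where
  "answers A [] = []"
| "answers A (op # ops) = returned op A @ answers (apply_op op A) ops"


section \<open>The model of computation\<close>

text \<open>
  A program is a finite list of mutually recursive first-order functions over values built
  from real numbers and pointers to pairs. Variables are de Bruijn indices. Every construct
  costs one unit of time on top of its evaluated subterms: this covers real arithmetic,
  comparison, allocating and following a pointer, and calling a function.

  The number of live variables is bounded by the program text, so a real RAM executes
  such a program with constant overhead; conversely, the memory of a real RAM can be kept in a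
  balanced search tree, which slows it down by a factor logarithmic in its running time.
  There is deliberately no rounding operation and no test of a real for being an integer, as
  unit-cost rounding of reals would make the model unreasonably strong. Array positions are
  passed to the program as reals.
\<close>

datatype val = RealV real | NilV | PairV val val

datatype arith = Add | Sub | Mul | Div

text \<open>Division is total with x / 0 = 0; a program can test for 0 by comparisons.\<close>

fun arith_op :: "arith \<Rightarrow> real \<Rightarrow> real \<Rightarrow> real" where
  "arith_op Add x y = x + y"
| "arith_op Sub x y = x - y"
| "arith_op Mul x y = x * y"
| "arith_op Div x y = x / y"

datatype exp =
    Var nat
  | Const int
  | Arith arith exp exp
  | NilE
  | PairE exp exp
  | LetE exp exp
  | IfLess exp exp exp exp
  | CaseE exp exp exp
  | Call nat "exp list"

type_synonym program = "exp list"

inductive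
  eval :: "program \<Rightarrow> val list \<Rightarrow> exp \<Rightarrow> val \<Rightarrow> nat \<Rightarrow> bool" and
  evals :: "program \<Rightarrow> val list \<Rightarrow> exp list \<Rightarrow> val list \<Rightarrow> nat \<Rightarrow> bool"
  for P :: program
where
  Var: "n < length E \<Longrightarrow> eval P E (Var n) (E ! n) 1"
| Const: "eval P E (Const z) (RealV (of_int z)) 1"
| Arith: "\<lbrakk>eval P E e\<^sub>1 (RealV x) t\<^sub>1; eval P E e\<^sub>2 (RealV y) t\<^sub>2\<rbrakk>
    \<Longrightarrow> eval P E (Arith f e\<^sub>1 e\<^sub>2) (RealV (arith_op f x y)) (t\<^sub>1 + t\<^sub>2 + 1)"
| NilE: "eval P E NilE NilV 1"
| PairE: "\<lbrakk>eval P E e\<^sub>1 u t\<^sub>1; eval P E e\<^sub>2 v t\<^sub>2\<rbrakk>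
    \<Longrightarrow> eval P E (PairE e\<^sub>1 e\<^sub>2) (PairV u v) (t\<^sub>1 + t\<^sub>2 + 1)"
| LetE: "\<lbrakk>eval P E e\<^sub>1 u t\<^sub>1; eval P (u # E) e\<^sub>2 v t\<^sub>2\<rbrakk>
    \<Longrightarrow> eval P E (LetE e\<^sub>1 e\<^sub>2) v (t\<^sub>1 + t\<^sub>2 + 1)"
| IfTrue: "\<lbrakk>eval P E e\<^sub>1 (RealV x) t\<^sub>1; eval P E e\<^sub>2 (RealV y) t\<^sub>2; x < y; eval P E e\<^sub>3 v t\<^sub>3\<rbrakk>
    \<Longrightarrow> eval P E (IfLess e\<^sub>1 e\<^sub>2 e\<^sub>3 e\<^sub>4) v (t\<^sub>1 + t\<^sub>2 + t\<^sub>3 + 1)"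
| IfFalse: "\<lbrakk>eval P E e\<^sub>1 (RealV x) t\<^sub>1; eval P E e\<^sub>2 (RealV y) t\<^sub>2; \<not> x < y; eval P E e\<^sub>4 v t\<^sub>4\<rbrakk>
    \<Longrightarrow> eval P E (IfLess e\<^sub>1 e\<^sub>2 e\<^sub>3 e\<^sub>4) v (t\<^sub>1 + t\<^sub>2 + t\<^sub>4 + 1)"
| CaseNil: "\<lbrakk>eval P E e\<^sub>1 NilV t\<^sub>1; eval P E e\<^sub>2 v t\<^sub>2\<rbrakk>
    \<Longrightarrow> eval P E (CaseE e\<^sub>1 e\<^sub>2 e\<^sub>3) v (t\<^sub>1 + t\<^sub>2 + 1)"
| CasePair: "\<lbrakk>eval P E e\<^sub>1 (PairV a b) t\<^sub>1; eval P (a # b # E) e\<^sub>3 v t\<^sub>3\<rbrakk>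
    \<Longrightarrow> eval P E (CaseE e\<^sub>1 e\<^sub>2 e\<^sub>3) v (t\<^sub>1 + t\<^sub>3 + 1)"
| Call: "\<lbrakk>evals P E es vs t\<^sub>1; f < length P; eval P vs (P ! f) v t\<^sub>2\<rbrakk>
    \<Longrightarrow> eval P E (Call f es) v (t\<^sub>1 + t\<^sub>2 + 1)"
| Nil: "evals P E [] [] 0"
| Cons: "\<lbrakk>eval P E e v t\<^sub>1; evals P E es vs t\<^sub>2\<rbrakk>
    \<Longrightarrow> evals P E (e # es) (v # vs) (t\<^sub>1 + t\<^sub>2)"

inductive_cases eval_elims:
  "eval P E (Var n) v t"
  "eval P E (Const z) v t"
  "eval P E (Arith f e\<^sub>1 e\<^sub>2) v t"
  "eval P E NilE v t"
  "eval P E (PairE e\<^sub>1 e\<^sub>2) v t"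
  "eval P E (LetE e\<^sub>1 e\<^sub>2) v t"
  "eval P E (IfLess e\<^sub>1 e\<^sub>2 e\<^sub>3 e\<^sub>4) v t"
  "eval P E (CaseE e\<^sub>1 e\<^sub>2 e\<^sub>3) v t"
  "eval P E (Call f es) v t"
  "evals P E [] vs t"
  "evals P E (e # es) vs t"

text \<open>Values and running times are unique, so "the" running time is well defined.\<close>

lemma eval_deterministic:
  "eval P E e v t \<Longrightarrow> eval P E e v' t' \<Longrightarrow> v' = v \<and> t' = t"
  "evals P E es vs t \<Longrightarrow> evals P E es vs' t' \<Longrightarrow> vs' = vs \<and> t' = t"
proof (induction arbitrary: v' t' and vs' t' rule: eval_evals.inducts)
qed (erule eval_elims; (metis One_nat_def Suc_eq_plus1 val.inject val.distinct))+


section \<open>Data structures for the range operations\<close>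

text \<open>
  Function 0 of the program receives L and creates the data structure; functions 1 to 5
  implement the operations. Each of the latter receives the current state of the data
  structure followed by the parameters of the operation, and returns the new state, which
  \<^term>\<open>Lookup\<close> pairs with its answer. The operations arrive one at a time: the program
  knows neither the later operations nor their number.
\<close>

fun entry :: "operation \<Rightarrow> nat" where
  "entry (Lookup i) = 1"
| "entry (AddConst i j c) = 2"
| "entry (AddGradient i j g) = 3"
| "entry (LeftLinearWave i j \<alpha>) = 4"
| "entry (RightLinearWave i j \<alpha>) = 5"

fun parameters :: "operation \<Rightarrow> val list" where
  "parameters (Lookup i) = [RealV (real i)]"
| "parameters (AddConst i j c) = [RealV (real i), RealV (real j), RealV c]"
| "parameters (AddGradient i j g) = [RealV (real i), RealV (real j), RealV g]"
| "parameters (LeftLinearWave i j \<alpha>) = [RealV (real i), RealV (real j), RealV \<alpha>]"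
| "parameters (RightLinearWave i j \<alpha>) = [RealV (real i), RealV (real j), RealV \<alpha>]"

fun result :: "operation \<Rightarrow> val \<Rightarrow> real list \<Rightarrow> val \<Rightarrow> bool" where
  "result (Lookup i) v out S' \<longleftrightarrow> (\<exists>x. v = PairV (RealV x) S' \<and> out = [x])"
| "result _ v out S' \<longleftrightarrow> v = S' \<and> out = []"

inductive run_ops :: "program \<Rightarrow> val \<Rightarrow> operation list \<Rightarrow> real list \<Rightarrow> nat \<Rightarrow> bool"
  for P :: program
where
  Done: "run_ops P S [] [] 0"
| Step: "\<lbrakk>entry op < length P; eval P (S # parameters op) (P ! entry op) v t\<^sub>1;
          result op v out S'; run_ops P S' ops outs t\<^sub>2\<rbrakk>
    \<Longrightarrow> run_ops P S (op # ops) (out @ outs) (t\<^sub>1 + t\<^sub>2)"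

text \<open>
  Starting from length L, the program processes the sequence in total time t, creation of the
  data structure included, and returns the list of answers.
\<close>

definition executes :: "program \<Rightarrow> nat \<Rightarrow> operation list \<Rightarrow> real list \<Rightarrow> nat \<Rightarrow> bool" where
  "executes P L ops outs t \<longleftrightarrow>
    (\<exists>S t\<^sub>0 t\<^sub>1. 0 < length P \<and> eval P [RealV (real L)] (P ! 0) S t\<^sub>0 \<and>
       run_ops P S ops outs t\<^sub>1 \<and> t = t\<^sub>0 + t\<^sub>1)"

end

theory Submission
  imports Defs "HOL-Real_Asymp.Real_Asymp"
begin

text \<open>
  The array is extended to a continuous piecewise linear function on \<open>[0, L + 1]\<close>, cut at integers
  into \<^emph>\<open>chains\<close> on which it is concave. If no chord of a chain is steeper than \<open>\<alpha>\<close>, the left wave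
  caps every chain separately by the line of slope \<open>\<alpha>\<close> through its left end: this is one lazy tag at
  the root of a balanced tree. Otherwise the first chain with a steeper chord is swallowed by its
  right neighbour, or straightened if it has none; either way the wave is unchanged and a concave
  chain results. Every operation creates a bounded number of chains and every merge destroys one,
  so the cost of merging is amortised. A concave chain is an inner balanced tree of linear pieces,
  in which the end of a cap is found by binary search. Right waves are left waves of the reflected
  function, and reflection is a lazy tag too. Kinks at positions that are not integers are concave,
  hence the minimum over a real interval with integer ends is the minimum over its integers.
\<close>

section \<open>The program\<close>

text \<open>A wave may create a new breakpoint in every chain at once, too many to be inserted one
  by one; this is why caps stay symbolic. They can, because a cap whose slope respects the chord
  fixes both ends of its chain. Two such caps start at the same point and compose to the smaller
  slope, an affine summand only shifts their slopes, and a reflection exchanges left and right caps,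
  so the pending work of a node is always a bounded record. A cap is materialised only when its
  chain is cut or swallows a neighbour, and then adds at most one piece. A swallowed chain loses its
  own pieces, since the wave sees it only as a line; lists of pieces are therefore never
  concatenated. So the number of pieces of a single chain grows by a constant per cut or merge, and
  only its logarithm enters the time. The square of the logarithm in the bound comes from a join,
  itself logarithmic, at every level of a search path.\<close>

text \<open>
  A node stores its height, the end points \<open>(xl, yl)\<close> and \<open>(xr, yr)\<close> of its graph, the largest and
  smallest chord slope \<open>mc\<close>, \<open>nc\<close> of its chains, and the tags that are pending for its children: caps of
  slope \<open>sa\<close> from the left and \<open>sb\<close> from the right end of each chain, the summand
  \<open>pg * x + pc\<close>, and a reflection if \<open>fl < 0\<close>.
\<close>

datatype tree = Tree (ht: real) (xl: real) (yl: real) (xr: real) (yr: real) (mc: real) (nc: real)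
    (sa: real) (sb: real) (pg: real) (pc: real) (fl: real) (kids: kids)
  and kids = Leaf | Inner tree | Branch tree tree

primrec enc :: "tree \<Rightarrow> val" and enck :: "kids \<Rightarrow> val" where
  "enc (Tree a b c d e f g h i j k l ks) = PairV (RealV a) (PairV (RealV b) (PairV (RealV c)
    (PairV (RealV d) (PairV (RealV e) (PairV (RealV f) (PairV (RealV g) (PairV (RealV h)
    (PairV (RealV i) (PairV (RealV j) (PairV (RealV k) (PairV (RealV l) (enck ks))))))))))))"
| "enck Leaf = NilV"
| "enck (Inner b) = PairV (enc b) NilV"
| "enck (Branch l r) = PairV (enc l) (enc r)"

fun enco :: "tree option \<Rightarrow> val" where
  "enco None = NilV"
| "enco (Some t) = enc t"

abbreviation (input) plusE (infixl "\<oplus>" 65) where "a \<oplus> b \<equiv> Arith Add a b"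
abbreviation (input) minusE (infixl "\<ominus>" 65) where "a \<ominus> b \<equiv> Arith Sub a b"
abbreviation (input) timesE (infixl "\<otimes>" 70) where "a \<otimes> b \<equiv> Arith Mul a b"
abbreviation (input) divE (infixl "\<oslash>" 70) where "a \<oslash> b \<equiv> Arith Div a b"

definition fstE :: "exp \<Rightarrow> exp" where "fstE e = CaseE e NilE (Var 0)"
definition sndE :: "exp \<Rightarrow> exp" where "sndE e = CaseE e NilE (Var 1)"

definition field :: "nat \<Rightarrow> exp \<Rightarrow> exp" where "field k e = fstE ((sndE ^^ k) e)"
definition kidsE :: "exp \<Rightarrow> exp" where "kidsE e = (sndE ^^ 12) e"

abbreviation (input) "V \<equiv> Var"
abbreviation (input) "htE \<equiv> field 0"
abbreviation (input) "xlE \<equiv> field 1"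
abbreviation (input) "ylE \<equiv> field 2"
abbreviation (input) "xrE \<equiv> field 3"
abbreviation (input) "yrE \<equiv> field 4"
abbreviation (input) "mcE \<equiv> field 5"
abbreviation (input) "ncE \<equiv> field 6"
abbreviation (input) "saE \<equiv> field 7"
abbreviation (input) "sbE \<equiv> field 8"
abbreviation (input) "pgE \<equiv> field 9"
abbreviation (input) "pcE \<equiv> field 10"
abbreviation (input) "flE \<equiv> field 11"

abbreviation (input) "LIN a b c d \<equiv> Call 6 [a, b, c, d]"
abbreviation (input) "ADD a b c \<equiv> Call 7 [a, b, c]"
abbreviation (input) "CAP a b c \<equiv> Call 8 [a, b, c]"
abbreviation (input) "MIR a \<equiv> Call 9 [a]"
abbreviation (input) "MIN2 a b \<equiv> Call 10 [a, b]"
abbreviation (input) "MAX2 a b \<equiv> Call 11 [a, b]"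
abbreviation (input) "NODE a b \<equiv> Call 12 [a, b]"
abbreviation (input) "GETK a b \<equiv> Call 13 [a, b]"
abbreviation (input) "KIDL a \<equiv> Call 14 [a]"
abbreviation (input) "KIDR a \<equiv> Call 15 [a]"
abbreviation (input) "BASE a \<equiv> Call 16 [a]"
abbreviation (input) "CHAIN a \<equiv> Call 17 [a]"
abbreviation (input) "BAL a b \<equiv> Call 18 [a, b]"
abbreviation (input) "JOINR a b \<equiv> Call 19 [a, b]"
abbreviation (input) "JOIN a b \<equiv> Call 20 [a, b]"
abbreviation (input) "CAPL a b c d \<equiv> Call 21 [a, b, c, d]"
abbreviation (input) "MAT a \<equiv> Call 22 [a]"
abbreviation (input) "SPLIT a b \<equiv> Call 23 [a, b]"
abbreviation (input) "BAD a b \<equiv> Call 24 [a, b]"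
abbreviation (input) "MERGE a b c \<equiv> Call 25 [a, b, c]"
abbreviation (input) "WAVE a b \<equiv> Call 26 [a, b]"
abbreviation (input) "CAPO a b \<equiv> Call 27 [a, b]"
abbreviation (input) "OPEN a b c \<equiv> Call 28 [a, b, c]"
abbreviation (input) "CLOSE a b c \<equiv> Call 29 [a, b, c]"

fun recE :: "exp list \<Rightarrow> exp \<Rightarrow> exp" where
  "recE [] k = k"
| "recE (e # es) k = PairE e (recE es k)"

definition "linB = LetE ((V 3 \<ominus> V 1) \<oslash> (V 2 \<ominus> V 0))
  (recE [Const 0, V 1, V 2, V 3, V 4, V 0, V 0, V 0, Const 0 \<ominus> V 0, Const 0, Const 0, Const 1] NilE)"
definition "addB = recE [htE (V 0), xlE (V 0), ylE (V 0) \<oplus> V 1 \<otimes> xlE (V 0) \<oplus> V 2,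
  xrE (V 0), yrE (V 0) \<oplus> V 1 \<otimes> xrE (V 0) \<oplus> V 2, mcE (V 0) \<oplus> V 1, ncE (V 0) \<oplus> V 1,
  saE (V 0) \<oplus> V 1, sbE (V 0) \<ominus> V 1, pgE (V 0) \<oplus> V 1, pcE (V 0) \<oplus> V 2, flE (V 0)] (kidsE (V 0))"
definition "capB = recE [htE (V 0), xlE (V 0), ylE (V 0), xrE (V 0), yrE (V 0), mcE (V 0), ncE (V 0),
  MIN2 (saE (V 0)) (V 1), MIN2 (sbE (V 0)) (V 2), pgE (V 0), pcE (V 0), flE (V 0)] (kidsE (V 0))"
definition "mirB = recE [htE (V 0), Const 0 \<ominus> xrE (V 0), yrE (V 0), Const 0 \<ominus> xlE (V 0), ylE (V 0),
  Const 0 \<ominus> ncE (V 0), Const 0 \<ominus> mcE (V 0), sbE (V 0), saE (V 0), Const 0 \<ominus> pgE (V 0),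
  pcE (V 0), Const 0 \<ominus> flE (V 0)] (kidsE (V 0))"
definition "minB = IfLess (V 0) (V 1) (V 0) (V 1)"
definition "maxB = IfLess (V 0) (V 1) (V 1) (V 0)"
definition "nodeB = recE [Const 1 \<oplus> MAX2 (htE (V 0)) (htE (V 1)), xlE (V 0), ylE (V 0), xrE (V 1), yrE (V 1),
  MAX2 (mcE (V 0)) (mcE (V 1)), MIN2 (ncE (V 0)) (ncE (V 1)), MAX2 (saE (V 0)) (saE (V 1)),
  MAX2 (sbE (V 0)) (sbE (V 1)), Const 0, Const 0, Const 1] (PairE (V 0) (V 1))"
definition "getkB = LetE (MIR (V 1)) (CAP (ADD (IfLess (flE (V 1)) (Const 0) (V 0) (V 2))
  (pgE (V 1)) (pcE (V 1))) (saE (V 1)) (sbE (V 1)))"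
definition "kidlB = CaseE (kidsE (V 0)) NilE (GETK (V 2) (IfLess (flE (V 2)) (Const 0) (V 1) (V 0)))"
definition "kidrB = CaseE (kidsE (V 0)) NilE (GETK (V 2) (IfLess (flE (V 2)) (Const 0) (V 0) (V 1)))"
definition "baseB = CaseE (kidsE (V 0)) NilE (LetE (MIR (V 0))
  (ADD (IfLess (flE (V 3)) (Const 0) (V 0) (V 1)) (pgE (V 3)) (pcE (V 3))))"
definition "chainB = LetE ((yrE (V 0) \<ominus> ylE (V 0)) \<oslash> (xrE (V 0) \<ominus> xlE (V 0)))
  (recE [Const 0, xlE (V 1), ylE (V 1), xrE (V 1), yrE (V 1), V 0, V 0, MAX2 (saE (V 1)) (V 0),
    MAX2 (sbE (V 1)) (Const 0 \<ominus> V 0), Const 0, Const 0, Const 1] (PairE (V 1) NilE))"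
definition "balB = IfLess (Const 1 \<oplus> htE (V 0)) (htE (V 1))
  (LetE (KIDL (V 1)) (LetE (KIDR (V 2)) (IfLess (htE (V 0)) (htE (V 1))
    (NODE (NODE (V 2) (KIDL (V 1))) (NODE (KIDR (V 1)) (V 0)))
    (NODE (NODE (V 2) (V 1)) (V 0)))))
  (NODE (V 0) (V 1))"
definition "joinrB = IfLess (Const 1 \<oplus> htE (V 1)) (htE (V 0))
  (BAL (KIDL (V 0)) (JOINR (KIDR (V 0)) (V 1))) (NODE (V 0) (V 1))"
definition "joinB = CaseE (V 0) (V 1) (CaseE (V 3) (V 2)
  (IfLess (htE (V 4)) (htE (V 5)) (MIR (JOINR (MIR (V 5)) (MIR (V 4)))) (JOINR (V 4) (V 5))))"
definition "caplB = CaseE (kidsE (V 0))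
  (LetE (ylE (V 0) \<ominus> (V 2 \<oplus> V 3 \<otimes> (xlE (V 0) \<ominus> V 1)))
   (LetE (yrE (V 1) \<ominus> (V 3 \<oplus> V 4 \<otimes> (xrE (V 1) \<ominus> V 2)))
    (LetE (xlE (V 2) \<oplus> V 1 \<otimes> (xrE (V 2) \<ominus> xlE (V 2)) \<oslash> (V 1 \<ominus> V 0))
     (LetE (V 5 \<oplus> V 6 \<otimes> (V 0 \<ominus> V 4))
      (NODE (LIN (V 5) (V 6) (V 1) (V 0)) (LIN (V 1) (V 0) (xrE (V 4)) (yrE (V 4))))))))
  (LetE (KIDL (V 2)) (IfLess (yrE (V 0)) (V 5 \<oplus> V 6 \<otimes> (xrE (V 0) \<ominus> V 4))
    (JOIN (CAPL (V 0) (V 4) (V 5) (V 6)) (KIDR (V 3)))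
    (CAPL (KIDR (V 3)) (V 4) (V 5) (V 6))))"
definition "matB = CaseE (kidsE (V 0)) (V 0)
  (MIR (CAPL (MIR (CAPL (BASE (V 2)) (xlE (V 2)) (ylE (V 2)) (saE (V 2))))
    (Const 0 \<ominus> xrE (V 2)) (yrE (V 2)) (sbE (V 2))))"
definition "splitB = CaseE (kidsE (V 0))
  (LetE (ylE (V 0) \<oplus> (yrE (V 0) \<ominus> ylE (V 0)) \<oslash> (xrE (V 0) \<ominus> xlE (V 0)) \<otimes> (V 1 \<ominus> xlE (V 0)))
    (PairE (LIN (xlE (V 1)) (ylE (V 1)) (V 2) (V 0)) (LIN (V 2) (V 0) (xrE (V 1)) (yrE (V 1)))))
  (CaseE (V 1)
    (LetE (SPLIT (MAT (V 2)) (V 3)) (PairE (CHAIN (fstE (V 0))) (CHAIN (sndE (V 0)))))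
    (LetE (KIDL (V 4)) (LetE (KIDR (V 5)) (IfLess (xrE (V 1)) (V 7)
      (LetE (SPLIT (V 0) (V 7)) (PairE (JOIN (V 2) (fstE (V 0))) (sndE (V 0))))
      (LetE (SPLIT (V 1) (V 7)) (PairE (fstE (V 0)) (JOIN (sndE (V 0)) (V 1))))))))"
definition "badB = CaseE (kidsE (V 0)) (PairE NilE (PairE (V 0) NilE))
  (CaseE (V 1) (PairE NilE (PairE (V 2) NilE))
    (LetE (KIDL (V 4)) (LetE (KIDR (V 5)) (IfLess (V 7) (mcE (V 1))
      (LetE (BAD (V 1) (V 7)) (PairE (fstE (V 0)) (PairE (fstE (sndE (V 0))) (JOIN (sndE (sndE (V 0))) (V 1)))))
      (LetE (BAD (V 0) (V 7)) (PairE (JOIN (V 2) (fstE (V 0))) (sndE (V 0))))))))"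
definition "mergeB = LetE (ylE (V 0) \<oplus> V 2 \<otimes> (xrE (V 1) \<ominus> xlE (V 0)))
  (IfLess (V 0) (yrE (V 2)) (LIN (xlE (V 1)) (ylE (V 1)) (xrE (V 2)) (yrE (V 2)))
    (CHAIN (CAPL (MAT (V 2)) (xlE (V 1)) (ylE (V 1)) (V 3))))"
text \<open>The second \<open>BAD\<close> uses the threshold \<open>ncE - 1\<close>, which lies
  below every chord slope of the remainder, so it always stops at the first chain: one search serves
  both to find the steep chain and to detach its right neighbour.\<close>

definition "waveB = IfLess (V 1) (mcE (V 0))
  (LetE (BAD (V 0) (V 1)) (CaseE (sndE (sndE (V 0)))
    (LetE (fstE (sndE (V 0))) (JOIN (CAPO (fstE (V 1)) (V 3))
      (LIN (xlE (V 0)) (ylE (V 0)) (xrE (V 0)) (ylE (V 0) \<oplus> V 3 \<otimes> (xrE (V 0) \<ominus> xlE (V 0))))))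
    (LetE (sndE (sndE (V 2))) (LetE (BAD (V 0) (ncE (V 0) \<ominus> Const 1))
      (WAVE (JOIN (fstE (V 4)) (JOIN (MERGE (fstE (sndE (V 4))) (fstE (sndE (V 0))) (V 6)) (sndE (sndE (V 0))))) (V 6))))))
  (CAP (V 0) (V 1) (sbE (V 0)))"
definition "capoB = CaseE (V 0) NilE (CAP (V 2) (V 3) (sbE (V 2)))"
text \<open>Cuts at i - 1, i, j and j + 1 and drops the two unit gaps. No array position lies inside
  a gap, so \<open>closeB\<close> can bridge it by a line segment and restore continuity whatever
  happened on [i, j]. The sentinel positions 0 and L + 1 keep the outer parts from being
  empty.\<close>

definition "openB = LetE (SPLIT (V 0) (V 1 \<ominus> Const 1)) (LetE (SPLIT (sndE (V 0)) (V 2))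
  (LetE (SPLIT (sndE (V 0)) (V 4)) (LetE (SPLIT (sndE (V 0)) (V 5 \<oplus> Const 1))
    (PairE (fstE (V 3)) (PairE (fstE (V 1)) (sndE (V 0)))))))"
definition "closeB = JOIN (V 0) (JOIN (LIN (xrE (V 0)) (yrE (V 0)) (xlE (V 1)) (ylE (V 1)))
  (JOIN (V 1) (JOIN (LIN (xrE (V 1)) (yrE (V 1)) (xlE (V 2)) (ylE (V 2))) (V 2))))"

definition "initB = LIN (Const 0) (Const 0) (V 0 \<oplus> Const 1) (Const 0)"
text \<open>The halves of the split are only read; since the old state is returned, a lookup creates
  no chains.\<close>

definition "lookupB = PairE (yrE (fstE (SPLIT (V 0) (V 1)))) (V 0)"
definition "rangeB f = LetE (OPEN (V 0) (V 1) (V 2))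
  (CLOSE (fstE (V 0)) (f (fstE (sndE (V 0)))) (sndE (sndE (V 0))))"

definition prog :: program where
  "prog = [initB, lookupB, rangeB (\<lambda>m. ADD m (Const 0) (V 4)), rangeB (\<lambda>m. ADD m (V 4) (Const 0)),
    rangeB (\<lambda>m. WAVE m (V 4)), rangeB (\<lambda>m. MIR (WAVE (MIR m) (V 4))),
    linB, addB, capB, mirB, minB, maxB, nodeB, getkB, kidlB, kidrB, baseB, chainB, balB, joinrB,
    joinB, caplB, matB, splitB, badB, mergeB, waveB, capoB, openB, closeB]"

lemma prog_nth:
  "prog ! 0 = initB" "prog ! Suc 0 = lookupB" "prog ! 2 = rangeB (\<lambda>m. ADD m (Const 0) (V 4))"
  "prog ! 3 = rangeB (\<lambda>m. ADD m (V 4) (Const 0))" "prog ! 4 = rangeB (\<lambda>m. WAVE m (V 4))"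
  "prog ! 5 = rangeB (\<lambda>m. MIR (WAVE (MIR m) (V 4)))"
  "prog ! 6 = linB" "prog ! 7 = addB" "prog ! 8 = capB" "prog ! 9 = mirB" "prog ! 10 = minB"
  "prog ! 11 = maxB" "prog ! 12 = nodeB" "prog ! 13 = getkB" "prog ! 14 = kidlB" "prog ! 15 = kidrB"
  "prog ! 16 = baseB" "prog ! 17 = chainB" "prog ! 18 = balB" "prog ! 19 = joinrB" "prog ! 20 = joinB"
  "prog ! 21 = caplB" "prog ! 22 = matB" "prog ! 23 = splitB" "prog ! 24 = badB" "prog ! 25 = mergeB"
  "prog ! 26 = waveB" "prog ! 27 = capoB" "prog ! 28 = openB" "prog ! 29 = closeB"
  by (simp_all add: prog_def)

lemma length_prog [simp]: "length prog = 30"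
  by (simp add: prog_def)

section \<open>Weakest preconditions with running times\<close>

fun vreal :: "val \<Rightarrow> (real \<Rightarrow> bool) \<Rightarrow> bool" where
  "vreal (RealV x) p = p x"
| "vreal _ p = False"

fun vcase :: "val \<Rightarrow> bool \<Rightarrow> (val \<Rightarrow> val \<Rightarrow> bool) \<Rightarrow> bool" where
  "vcase NilV q p = q"
| "vcase (PairV x y) q p = p x y"
| "vcase (RealV x) q p = False"

text \<open>An existential over runs, so termination is included. As evaluation is deterministic,
  the rules for the constructs are equivalences, and the simplifier can execute a program
  symbolically while adding up its running time.\<close>

definition wp :: "val list \<Rightarrow> exp \<Rightarrow> (val \<Rightarrow> nat \<Rightarrow> bool) \<Rightarrow> bool" where
  "wp E e Q \<longleftrightarrow> (\<exists>v t. eval prog E e v t \<and> Q v t)"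

definition wps :: "val list \<Rightarrow> exp list \<Rightarrow> (val list \<Rightarrow> nat \<Rightarrow> bool) \<Rightarrow> bool" where
  "wps E es Q \<longleftrightarrow> (\<exists>vs t. evals prog E es vs t \<and> Q vs t)"

text \<open>Continuations are not simplified before the value they receive is known.\<close>

lemma weak_congs [cong]:
  "E = E' \<Longrightarrow> wp E e Q = wp E' e Q"
  "E = E' \<Longrightarrow> wps E es R = wps E' es R"
  "u = u' \<Longrightarrow> vreal u p = vreal u' p"
  "u = u' \<Longrightarrow> vcase u q r = vcase u' q r"
  by simp_all

lemma wp_ext: "(\<And>v t. Q v t = R v t) \<Longrightarrow> wp E e Q = wp E e R"
  by (simp add: wp_def)

lemma vcase_ext: "q = q' \<Longrightarrow> (\<And>x y. r x y = r' x y) \<Longrightarrow> vcase u q r = vcase u q' r'"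
  by (cases u) simp_all

declare One_nat_def [simp del]

lemma nth_Cons_1 [simp]: "(x # xs) ! 1 = xs ! 0"
  by (simp add: One_nat_def)

text \<open>Turns a run that is already known, such as a recursive call obtained from an induction
  hypothesis, into a rewrite rule.\<close>

lemma wp_det: "eval prog E e v t \<Longrightarrow> wp E e Q = Q v t"
  unfolding wp_def using eval_deterministic(1) by blast

lemma wp_Var [simp]: "wp E (Var n) Q \<longleftrightarrow> n < length E \<and> Q (E ! n) 1"
proof (cases "n < length E")
  case False
  then show ?thesis
    unfolding wp_def by (auto elim: eval_elims)
qed (simp add: wp_det[OF eval_evals.Var])

lemma wp_Const [simp]: "wp E (Const z) Q \<longleftrightarrow> Q (RealV (of_int z)) 1"
  by (simp add: wp_det[OF eval_evals.Const])

lemma wp_NilE [simp]: "wp E NilE Q \<longleftrightarrow> Q NilV 1"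
  by (simp add: wp_det[OF eval_evals.NilE])

lemma wp_Arith [simp]: "wp E (Arith f a b) Q \<longleftrightarrow>
  wp E a (\<lambda>u s. wp E b (\<lambda>v t. vreal u (\<lambda>x. vreal v (\<lambda>y. Q (RealV (arith_op f x y)) (s + t + 1)))))"
  (is "?l = ?r")
proof
  assume ?l
  then obtain w k where "eval prog E (Arith f a b) w k" "Q w k" unfolding wp_def by blast
  then show ?r
    by (elim eval_elims(3)) (simp_all add: wp_det One_nat_def)
next
  assume ?r
  then obtain u s v t where *: "eval prog E a u s" "eval prog E b v t"
    "vreal u (\<lambda>x. vreal v (\<lambda>y. Q (RealV (arith_op f x y)) (s + t + 1)))"
    unfolding wp_def by blast
  then obtain x y where "u = RealV x" "v = RealV y" by (cases u; cases v) auto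
  with * show ?l
    unfolding wp_def using eval_evals.Arith[of prog E a x s b y t f] by auto
qed

lemma wp_PairE [simp]: "wp E (PairE a b) Q \<longleftrightarrow>
  wp E a (\<lambda>u s. wp E b (\<lambda>v t. Q (PairV u v) (s + t + 1)))"
  (is "?l = ?r")
proof
  assume ?l
  then obtain w k where "eval prog E (PairE a b) w k" "Q w k" unfolding wp_def by blast
  then show ?r
    by (elim eval_elims(5)) (simp_all add: wp_det One_nat_def)
next
  assume ?r
  then obtain u s v t where *: "eval prog E a u s" "eval prog E b v t" "Q (PairV u v) (s + t + 1)"
    unfolding wp_def by blast
  with eval_evals.PairE[OF *(1,2)] show ?l
    unfolding wp_def by auto
qed

lemma wp_LetE [simp]: "wp E (LetE a b) Q \<longleftrightarrow>
  wp E a (\<lambda>u s. wp (u # E) b (\<lambda>v t. Q v (s + t + 1)))"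
  (is "?l = ?r")
proof
  assume ?l
  then obtain w k where "eval prog E (LetE a b) w k" "Q w k" unfolding wp_def by blast
  then show ?r
    by (elim eval_elims(6)) (simp_all add: wp_det One_nat_def)
next
  assume ?r
  then obtain u s v t where *: "eval prog E a u s" "eval prog (u # E) b v t" "Q v (s + t + 1)"
    unfolding wp_def by blast
  with eval_evals.LetE[OF *(1,2)] show ?l
    unfolding wp_def by auto
qed

lemma wp_IfLess [simp]: "wp E (IfLess a b c d) Q \<longleftrightarrow>
  wp E a (\<lambda>u r. wp E b (\<lambda>v s. vreal u (\<lambda>x. vreal v (\<lambda>y.
    if x < y then wp E c (\<lambda>w t. Q w (r + s + t + 1)) else wp E d (\<lambda>w t. Q w (r + s + t + 1))))))"
  (is "?l = ?r")
proof
  assume ?l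
  then obtain w k where "eval prog E (IfLess a b c d) w k" "Q w k" unfolding wp_def by blast
  then show ?r
    by (elim eval_elims(7)) (simp_all add: wp_det One_nat_def)
next
  assume ?r
  then obtain u s v r where *: "eval prog E a u r" "eval prog E b v s"
    "vreal u (\<lambda>x. vreal v (\<lambda>y.
    if x < y then wp E c (\<lambda>w t. Q w (r + s + t + 1)) else wp E d (\<lambda>w t. Q w (r + s + t + 1))))"
    unfolding wp_def by blast
  then obtain x y where xy: "u = RealV x" "v = RealV y" by (cases u; cases v) auto
  show ?l
  proof (cases "x < y")
    case True
    with * xy obtain w t where "eval prog E c w t" "Q w (r + s + t + 1)"
      unfolding wp_def by auto
    with eval_evals.IfTrue[of prog E a x r b y s c w t d] * xy True show ?thesis
      unfolding wp_def by auto
  next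
    case False
    with * xy obtain w t where "eval prog E d w t" "Q w (r + s + t + 1)"
      unfolding wp_def by auto
    with eval_evals.IfFalse[of prog E a x r b y s d w t c] * xy False show ?thesis
      unfolding wp_def by auto
  qed
qed

lemma wp_CaseE [simp]: "wp E (CaseE a b c) Q \<longleftrightarrow>
  wp E a (\<lambda>u s. vcase u (wp E b (\<lambda>v t. Q v (s + t + 1)))
    (\<lambda>x y. wp (x # y # E) c (\<lambda>v t. Q v (s + t + 1))))"
  (is "?l = ?r")
proof
  assume ?l
  then obtain w k where "eval prog E (CaseE a b c) w k" "Q w k" unfolding wp_def by blast
  then show ?r
    by (elim eval_elims(8)) (simp_all add: wp_det One_nat_def)
next
  assume ?r
  then obtain u s where *: "eval prog E a u s" "vcase u (wp E b (\<lambda>v t. Q v (s + t + 1)))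
    (\<lambda>x y. wp (x # y # E) c (\<lambda>v t. Q v (s + t + 1)))"
    unfolding wp_def by blast
  show ?l
  proof (cases u)
    case NilV
    with * obtain w t where "eval prog E b w t" "Q w (s + t + 1)"
      unfolding wp_def by auto
    with eval_evals.CaseNil[of prog E a s b w t c] * NilV show ?thesis
      unfolding wp_def by auto
  next
    case (PairV x y)
    with * obtain w t where "eval prog (x # y # E) c w t" "Q w (s + t + 1)"
      unfolding wp_def by auto
    with eval_evals.CasePair[of prog E a x y s c w t b] * PairV show ?thesis
      unfolding wp_def by auto
  qed (use * in simp)
qed

lemma wps_Nil [simp]: "wps E [] Q \<longleftrightarrow> Q [] 0"
  by (auto simp: wps_def intro: eval_evals.intros elim: eval_elims)

lemma wps_Cons [simp]: "wps E (e # es) Q \<longleftrightarrow>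
  wp E e (\<lambda>v s. wps E es (\<lambda>vs t. Q (v # vs) (s + t)))"
  (is "?l = ?r")
proof
  show "?l \<Longrightarrow> ?r"
    unfolding wps_def wp_def by (elim exE conjE eval_elims) force
  assume ?r
  then obtain v s vs t where *: "eval prog E e v s" "evals prog E es vs t" "Q (v # vs) (s + t)"
    unfolding wps_def wp_def by blast
  with eval_evals.Cons[OF *(1,2)] show ?l
    unfolding wps_def by blast
qed

lemma wp_Call [simp]: "wp E (Call f es) Q \<longleftrightarrow>
  wps E es (\<lambda>vs s. f < length prog \<and> wp vs (prog ! f) (\<lambda>v t. Q v (s + t + 1)))"
  (is "?l = ?r")
proof
  assume ?l
  then obtain w k where "eval prog E (Call f es) w k" "Q w k" unfolding wp_def by blast
  then obtain vs t1 t2 where "evals prog E es vs t1" "f < length prog" "eval prog vs (prog ! f) w t2"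
    "Q w (t1 + t2 + 1)"
    by (elim eval_elims(9)) (simp add: One_nat_def)
  then show ?r
    unfolding wps_def wp_def by blast
next
  assume ?r
  then obtain v s vs t where *: "evals prog E es vs s" "f < length prog" "eval prog vs (prog ! f) v t"
    "Q v (s + t + 1)"
    unfolding wps_def wp_def by blast
  with eval_evals.Call[OF *(1,2,3)] show ?l
    unfolding wp_def by auto
qed

lemma vcase_enc [simp]: "vcase (enc T) q r =
  r (RealV (ht T)) (PairV (RealV (xl T)) (PairV (RealV (yl T))
    (PairV (RealV (xr T)) (PairV (RealV (yr T)) (PairV (RealV (mc T)) (PairV (RealV (nc T)) (PairV (RealV (sa T))
    (PairV (RealV (sb T)) (PairV (RealV (pg T)) (PairV (RealV (pc T)) (PairV (RealV (fl T)) (enck (kids T)))))))))))))"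
  by (cases T) simp

lemma wp_fstE [simp]: "wp E (fstE e) Q \<longleftrightarrow>
  wp E e (\<lambda>u s. vcase u (Q NilV (s + 2)) (\<lambda>x y. Q x (s + 2)))"
  unfolding fstE_def by (auto simp: add.assoc intro!: wp_ext vcase_ext)

lemma wp_sndE [simp]: "wp E (sndE e) Q \<longleftrightarrow>
  wp E e (\<lambda>u s. vcase u (Q NilV (s + 2)) (\<lambda>x y. Q y (s + 2)))"
  unfolding sndE_def by (auto simp: add.assoc intro!: wp_ext vcase_ext)

lemma wp_recE [simp]:
  "wp E (recE [] k) Q \<longleftrightarrow> wp E k Q"
  "wp E (recE (e # es) k) Q \<longleftrightarrow> wp E e (\<lambda>u s. wp E (recE es k) (\<lambda>v t. Q (PairV u v) (s + t + 1)))"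
  unfolding recE.simps by (rule refl, rule wp_PairE)

text \<open>Unfolding a projection into nested cases would blow up symbolic execution; here a whole
  path through the record is one predicate, evaluated in one step by \<open>vfield_enc\<close>. The
  clause for \<open>NilV\<close> mirrors the default \<open>NilE\<close> in \<open>fstE\<close> and
  \<open>sndE\<close>.\<close>

fun vfield :: "nat \<Rightarrow> val \<Rightarrow> (val \<Rightarrow> bool) \<Rightarrow> bool" where
  "vfield k (RealV x) p = False"
| "vfield k NilV p = p NilV"
| "vfield 0 (PairV x y) p = p x"
| "vfield (Suc k) (PairV x y) p = vfield k y p"

fun vtail :: "nat \<Rightarrow> val \<Rightarrow> (val \<Rightarrow> bool) \<Rightarrow> bool" where
  "vtail 0 u p = p u"
| "vtail (Suc k) (RealV x) p = False"
| "vtail (Suc k) NilV p = p NilV"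
| "vtail (Suc k) (PairV x y) p = vtail k y p"

lemma vfield_cong [cong]:
  "k = k' \<Longrightarrow> u = u' \<Longrightarrow> vfield k u p = vfield k' u' p"
  "k = k' \<Longrightarrow> u = u' \<Longrightarrow> vtail k u p = vtail k' u' p"
  by simp_all

lemma wp_sndE_pow: "wp E ((sndE ^^ k) e) Q \<longleftrightarrow> wp E e (\<lambda>u s. vtail k u (\<lambda>x. Q x (s + 2 * k)))"
proof (induction k arbitrary: Q)
  case 0
  then show ?case unfolding funpow.simps id_apply by (auto intro!: wp_ext)
next
  case (Suc k)
  have *: "vtail k u (\<lambda>x. vcase x q (\<lambda>x y. R y)) = vtail (Suc k) u R" if "q = R NilV" for u q R
    using that by (induction k arbitrary: u; case_tac u; simp)
  show ?case
    by (simp only: wp_sndE Suc funpow.simps o_apply mult_Suc_right add_ac)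
      (rule wp_ext, subst *, rule refl, rule refl)
qed

lemma wp_field [simp]: "wp E (field k e) Q \<longleftrightarrow> wp E e (\<lambda>u s. vfield k u (\<lambda>x. Q x (s + 2 * k + 2)))"
proof -
  have "vtail k u (\<lambda>x. vcase x (Q NilV t) (\<lambda>x y. Q x t)) = vfield k u (\<lambda>x. Q x t)" for u t
    by (induction k arbitrary: u) (case_tac u; simp)+
  then show ?thesis
    unfolding field_def by (simp add: wp_sndE_pow) (auto intro!: wp_ext)
qed

lemma wp_kidsE [simp]: "wp E (kidsE e) Q \<longleftrightarrow> wp E e (\<lambda>u s. vtail 12 u (\<lambda>x. Q x (s + 2 * 12)))"
  by (simp only: kidsE_def wp_sndE_pow)

lemma vfield_numeral:
  "vfield (numeral k) (PairV x y) p = vfield (pred_numeral k) y p"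
  "vfield 1 (PairV x y) p = vfield 0 y p"
  "vtail (numeral k) (PairV x y) p = vtail (pred_numeral k) y p"
  "vtail 1 (PairV x y) p = vtail 0 y p"
  by (simp_all only: numeral_eq_Suc One_nat_def vfield.simps vtail.simps)

lemma vfield_enc [simp]:
  "vfield 0 (enc T) p = p (RealV (ht T))"
  "vfield 1 (enc T) p = p (RealV (xl T))"
  "vfield 2 (enc T) p = p (RealV (yl T))"
  "vfield 3 (enc T) p = p (RealV (xr T))"
  "vfield 4 (enc T) p = p (RealV (yr T))"
  "vfield 5 (enc T) p = p (RealV (mc T))"
  "vfield 6 (enc T) p = p (RealV (nc T))"
  "vfield 7 (enc T) p = p (RealV (sa T))"
  "vfield 8 (enc T) p = p (RealV (sb T))"
  "vfield 9 (enc T) p = p (RealV (pg T))"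
  "vfield 10 (enc T) p = p (RealV (pc T))"
  "vfield 11 (enc T) p = p (RealV (fl T))"
  "vtail 12 (enc T) p = p (enck (kids T))"
  by (cases T; simp add: vfield_numeral)+

section \<open>Constant-time tree operations\<close>

text \<open>For a single point the slope is 0 because of x / 0 = 0. The tags \<open>sa\<close> and
  \<open>sb\<close> are the slope seen from either end, the tightest caps without effect.\<close>

definition linT :: "real \<Rightarrow> real \<Rightarrow> real \<Rightarrow> real \<Rightarrow> tree" where
  "linT u y v z = (let s = (z - y) / (v - u) in Tree 0 u y v z s s s (- s) 0 0 1 Leaf)"

definition addT :: "real \<Rightarrow> real \<Rightarrow> tree \<Rightarrow> tree" where
  "addT g c T = Tree (ht T) (xl T) (yl T + g * xl T + c) (xr T) (yr T + g * xr T + c)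
    (mc T + g) (nc T + g) (sa T + g) (sb T - g) (pg T + g) (pc T + c) (fl T) (kids T)"

definition capT :: "real \<Rightarrow> real \<Rightarrow> tree \<Rightarrow> tree" where
  "capT a b T = Tree (ht T) (xl T) (yl T) (xr T) (yr T) (mc T) (nc T) (min (sa T) a) (min (sb T) b)
    (pg T) (pc T) (fl T) (kids T)"

definition mirT :: "tree \<Rightarrow> tree" where
  "mirT T = Tree (ht T) (- xr T) (yr T) (- xl T) (yl T) (- nc T) (- mc T) (sb T) (sa T)
    (- pg T) (pc T) (- fl T) (kids T)"

text \<open>The tags of a new node must be neutral. Caps that a child already satisfies are neutral
  for it, and a larger slope is a weaker cap, hence the maxima.\<close>

definition nodeT :: "tree \<Rightarrow> tree \<Rightarrow> tree" where
  "nodeT l r = Tree (1 + max (ht l) (ht r)) (xl l) (yl l) (xr r) (yr r) (max (mc l) (mc r))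
    (min (nc l) (nc r)) (max (sa l) (sa r)) (max (sb l) (sb r)) 0 0 1 (Branch l r)"

definition getkT :: "tree \<Rightarrow> tree \<Rightarrow> tree" where
  "getkT T k = capT (sa T) (sb T) (addT (pg T) (pc T) (if fl T < 0 then mirT k else k))"

text \<open>Differs from \<open>getkT\<close> by leaving out the caps: they start at the ends of the
  whole chain, so they cannot be handed down to its pieces.\<close>

definition baseT :: "tree \<Rightarrow> tree \<Rightarrow> tree" where
  "baseT T k = addT (pg T) (pc T) (if fl T < 0 then mirT k else k)"

text \<open>Caps satisfied by all pieces also hold for their concatenation
  (\<open>glue_cpd\<close>); the maxima with the chord slope secure the remaining requirement of
  \<open>cpd\<close>.\<close>

definition chainT :: "tree \<Rightarrow> tree" where
  "chainT B = (let s = (yr B - yl B) / (xr B - xl B) in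
    Tree 0 (xl B) (yl B) (xr B) (yr B) s s (max (sa B) s) (max (sb B) (- s)) 0 0 1 (Inner B))"

lemma wp_min [simp]: "wp [RealV x, RealV y] (prog ! 10) Q \<longleftrightarrow> Q (RealV (min x y)) 4"
  unfolding prog_nth(11) minB_def by (cases "x < y") (simp_all add: min_def)

lemma wp_max [simp]: "wp [RealV x, RealV y] (prog ! 11) Q \<longleftrightarrow> Q (RealV (max x y)) 4"
  unfolding prog_nth(12) maxB_def by (cases "x < y") (simp_all add: max_def)

lemma wp_lin [simp]:
  "wp [RealV x, RealV y, RealV z, RealV w] (prog ! 6) Q \<longleftrightarrow> Q (enc (linT x y z w)) 35"
  unfolding prog_nth(7) linB_def by (simp add: linT_def Let_def)

lemma wp_add [simp]: "wp [enc T, RealV g, RealV c] (prog ! 7) Q \<longleftrightarrow> Q (enc (addT g c T)) 241"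
  unfolding prog_nth(8) addB_def by (simp add: addT_def Let_def)

lemma wp_cap [simp]: "wp [enc T, RealV a, RealV b] (prog ! 8) Q \<longleftrightarrow> Q (enc (capT a b T)) 217"
  unfolding prog_nth(9) capB_def by (simp add: capT_def Let_def)

lemma wp_mir [simp]: "wp [enc T] (prog ! 9) Q \<longleftrightarrow> Q (enc (mirT T)) 217"
  unfolding prog_nth(10) mirB_def by (simp add: mirT_def Let_def)

lemma wp_node [simp]: "wp [enc l, enc r] (prog ! 12) Q \<longleftrightarrow> Q (enc (nodeT l r)) 211"
  unfolding prog_nth(13) nodeB_def by (simp add: nodeT_def Let_def)

lemma wp_getk [simp]: "wp [enc T, enc k] (prog ! 13) Q \<longleftrightarrow> Q (enc (getkT T k)) 788"
  unfolding prog_nth(14) getkB_def by (cases "fl T < 0") (simp_all add: getkT_def)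

lemma wp_kidl [simp]: "kids T = Branch l r \<Longrightarrow>
    wp [enc T] (prog ! 14) Q \<longleftrightarrow> Q (enc (getkT T (if fl T < 0 then r else l))) 844"
  unfolding prog_nth(15) kidlB_def by (cases "fl T < 0") simp_all

lemma wp_kidr [simp]: "kids T = Branch l r \<Longrightarrow>
    wp [enc T] (prog ! 15) Q \<longleftrightarrow> Q (enc (getkT T (if fl T < 0 then l else r))) 844"
  unfolding prog_nth(16) kidrB_def by (cases "fl T < 0") simp_all

lemma wp_base [simp]: "kids T = Inner B \<Longrightarrow>
    wp [enc T] (prog ! 16) Q \<longleftrightarrow> Q (enc (baseT T B)) 560"
  unfolding prog_nth(17) baseB_def by (cases "fl T < 0") (simp_all add: baseT_def)

lemma wp_chain [simp]: "wp [enc B] (prog ! 17) Q \<longleftrightarrow> Q (enc (chainT B)) 139"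
  unfolding prog_nth(18) chainB_def by (simp add: chainT_def Let_def)

section \<open>Concave chains\<close>

text \<open>Supporting lines are demanded at the end points too, where ordinary concavity would
  allow jumps. Every point thus has an explicit slope to compare with that of a wave.\<close>

definition conc :: "real \<Rightarrow> real \<Rightarrow> (real \<Rightarrow> real) \<Rightarrow> bool" where
  "conc u v f \<longleftrightarrow> (\<forall>y\<in>{u..v}. \<exists>k. \<forall>x\<in>{u..v}. f x \<le> f y + k * (x - y))"

lemma concE:
  assumes "conc u v f" "u \<le> y" "y \<le> v"
  obtains k where "\<And>x. u \<le> x \<Longrightarrow> x \<le> v \<Longrightarrow> f x \<le> f y + k * (x - y)"
  using assms unfolding conc_def by (meson atLeastAtMost_iff)

lemma concI:
  assumes "\<And>y. u \<le> y \<Longrightarrow> y \<le> v \<Longrightarrow> \<exists>k. \<forall>x. u \<le> x \<longrightarrow> x \<le> v \<longrightarrow> f x \<le> f y + k * (x - y)"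
  shows "conc u v f"
  using assms unfolding conc_def by (meson atLeastAtMost_iff)

lemma conc_cong:
  assumes "conc u v f" "\<And>x. u \<le> x \<Longrightarrow> x \<le> v \<Longrightarrow> g x = f x"
  shows "conc u v g"
  using assms unfolding conc_def by simp

lemma conc_mono:
  assumes "conc u v f" "u \<le> u'" "v' \<le> v"
  shows "conc u' v' f"
  using assms unfolding conc_def by (meson atLeastAtMost_iff order_trans)

lemma conc_above:
  assumes "conc u v f" "u \<le> x" "x \<le> y" "y \<le> z" "z \<le> v"
    and x: "p + a * x \<le> f x" and z: "p + a * z \<le> f z"
  shows "p + a * y \<le> f y"
proof -
  obtain k where k: "\<And>x. u \<le> x \<Longrightarrow> x \<le> v \<Longrightarrow> f x \<le> f y + k * (x - y)"
    using assms by (elim concE[of u v f y]) auto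
  have 1: "p + a * x \<le> f y + k * (x - y)" using k[of x] x assms by simp
  have 2: "p + a * z \<le> f y + k * (z - y)" using k[of z] z assms by simp
  show ?thesis
  proof (cases "k \<le> a")
    case True
    then have "(k - a) * (z - y) \<le> 0" using assms by (simp add: mult_nonpos_nonneg)
    with 2 show ?thesis by (simp add: algebra_simps)
  next
    case False
    then have "(k - a) * (x - y) \<le> 0" using assms by (simp add: mult_nonneg_nonpos)
    with 1 show ?thesis by (simp add: algebra_simps)
  qed
qed

text \<open>Passing from above a line to below it forces the supporting slope at \<open>y\<close> to
  be at most \<open>a\<close>. This is why a chain crosses a cap line only once, so that binary
  search finds the crossing.\<close>

lemma conc_below:
  assumes "conc u v f" "u \<le> x" "x < y" "y \<le> z" "z \<le> v"
    and x: "p + a * x \<le> f x" and y: "f y \<le> p + a * y"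
  shows "f z \<le> p + a * z"
proof -
  obtain k where k: "\<And>x. u \<le> x \<Longrightarrow> x \<le> v \<Longrightarrow> f x \<le> f y + k * (x - y)"
    using assms by (elim concE[of u v f y]) auto
  have 1: "p + a * x \<le> f y + k * (x - y)" using k[of x] x assms by simp
  have 2: "f z \<le> f y + k * (z - y)" using k[of z] assms by simp
  from 1 y have "0 \<le> (k - a) * (x - y)" by (simp add: algebra_simps)
  with assms(3) have "k \<le> a" by (simp add: zero_le_mult_iff)
  then have "(k - a) * (z - y) \<le> 0" using assms by (simp add: mult_nonpos_nonneg)
  with 2 y show ?thesis by (simp add: algebra_simps)
qed

lemma conc_affine: "conc u v (\<lambda>x. p + a * x)"
  by (rule concI, rule exI[of _ a]) (simp add: algebra_simps)

lemma conc_add: "conc u v f \<Longrightarrow> conc u v (\<lambda>x. f x + g * x + c)"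
proof (rule concI)
  fix y assume f: "conc u v f" and y: "u \<le> y" "y \<le> v"
  obtain k where "\<And>x. u \<le> x \<Longrightarrow> x \<le> v \<Longrightarrow> f x \<le> f y + k * (x - y)"
    using f y by (elim concE) auto
  then show "\<exists>k. \<forall>x. u \<le> x \<longrightarrow> x \<le> v \<longrightarrow> f x + g * x + c \<le> f y + g * y + c + k * (x - y)"
    by (intro exI[of _ "k + g"]) (auto simp: algebra_simps)
qed

lemma conc_neg: "conc u v f \<Longrightarrow> conc (- v) (- u) (\<lambda>x. f (- x))"
proof (rule concI)
  fix y assume f: "conc u v f" and y: "- v \<le> y" "y \<le> - u"
  obtain k where k: "\<And>x. u \<le> x \<Longrightarrow> x \<le> v \<Longrightarrow> f x \<le> f (- y) + k * (x - - y)"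
    using f y by (elim concE[of u v f "- y"]) auto
  show "\<exists>k. \<forall>x. - v \<le> x \<longrightarrow> x \<le> - u \<longrightarrow> f (- x) \<le> f (- y) + k * (x - y)"
  proof (intro exI[of _ "- k"] allI impI)
    fix x assume "- v \<le> x" "x \<le> - u"
    then show "f (- x) \<le> f (- y) + - k * (x - y)" using k[of "- x"] by (simp add: algebra_simps)
  qed
qed

lemma conc_min: "conc u v f \<Longrightarrow> conc u v g \<Longrightarrow> conc u v (\<lambda>x. min (f x) (g x))"
proof (rule concI)
  fix y assume f: "conc u v f" and g: "conc u v g" and y: "u \<le> y" "y \<le> v"
  obtain k where k: "\<And>x. u \<le> x \<Longrightarrow> x \<le> v \<Longrightarrow> f x \<le> f y + k * (x - y)"
    using f y by (elim concE) auto
  obtain l where l: "\<And>x. u \<le> x \<Longrightarrow> x \<le> v \<Longrightarrow> g x \<le> g y + l * (x - y)"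
    using g y by (elim concE) auto
  show "\<exists>k. \<forall>x. u \<le> x \<longrightarrow> x \<le> v \<longrightarrow> min (f x) (g x) \<le> min (f y) (g y) + k * (x - y)"
  proof (cases "f y \<le> g y")
    case True
    with k show ?thesis by (intro exI[of _ k]) (force simp: min_def)
  next
    case False
    with l show ?thesis by (intro exI[of _ l]) (force simp: min_def)
  qed
qed

text \<open>Where \<open>f\<close> is below the line, its supporting slope is at most
  \<open>a\<close>, because the line starts at or below \<open>f\<close> at \<open>s\<close>; the
  supporting line therefore stays above the extension on the left. This is the reason why a
  swallowed chain and its right neighbour form one concave chain.\<close>

lemma conc_extend:
  assumes f: "conc s v f" and "u \<le> s" and s: "p + a * s \<le> f s"
  shows "conc u v (\<lambda>x. if x < s then p + a * x else min (f x) (p + a * x))"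
proof (rule concI)
  let ?h = "\<lambda>x. if x < s then p + a * x else min (f x) (p + a * x)"
  fix y assume y: "u \<le> y" "y \<le> v"
  show "\<exists>k. \<forall>x. u \<le> x \<longrightarrow> x \<le> v \<longrightarrow> ?h x \<le> ?h y + k * (x - y)"
  proof (cases "?h y = p + a * y")
    case True
    then show ?thesis by (intro exI[of _ a]) (auto simp: algebra_simps min_le_iff_disj)
  next
    case False
    then have y': "s \<le> y" "f y < p + a * y" "?h y = f y" by (auto simp: min_def split: if_splits)
    with s have "s < y" by (cases "s = y") auto
    obtain k where k: "\<And>x. s \<le> x \<Longrightarrow> x \<le> v \<Longrightarrow> f x \<le> f y + k * (x - y)"
      using f y y' by (elim concE[of s v f y]) auto
    have sk: "p + a * s \<le> f y + k * (s - y)" using k[of s] s y y' by simp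
    with y' have "(a - k) * (s - y) \<le> 0" by (simp add: algebra_simps)
    with \<open>s < y\<close> have ka: "k \<le> a" by (simp add: mult_le_0_iff)
    have "?h x \<le> f y + k * (x - y)" if "x \<le> v" for x
    proof (cases "x < s")
      case True
      with ka have "0 \<le> (k - a) * (x - s)" by (simp add: mult_nonpos_nonpos)
      with sk True show ?thesis by (simp add: algebra_simps)
    qed (use k[of x] that in \<open>simp add: min_le_iff_disj\<close>)
    with y' show ?thesis by (intro exI[of _ k]) simp
  qed
qed

text \<open>
  A chain is a concave piece on \<open>[cu, cv]\<close>, made 0 outside so that chains can be compared by
  equality. \<open>sl\<close> is the slope of its chord; it is arbitrary if the interval is a single point.
\<close>

datatype chain = Chain (cu: real) (cv: real) (cf: "real \<Rightarrow> real") (sl: real)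

definition restc :: "real \<Rightarrow> real \<Rightarrow> (real \<Rightarrow> real) \<Rightarrow> real \<Rightarrow> chain" where
  "restc u v f s = Chain u v (\<lambda>x. if u \<le> x \<and> x \<le> v then f x else 0) s"

definition linc :: "real \<Rightarrow> real \<Rightarrow> real \<Rightarrow> real \<Rightarrow> chain" where
  "linc u y v s = restc u v (\<lambda>x. y + s * (x - u)) s"

definition addc :: "real \<Rightarrow> real \<Rightarrow> chain \<Rightarrow> chain" where
  "addc g k c = restc (cu c) (cv c) (\<lambda>x. cf c x + g * x + k) (sl c + g)"

definition capc :: "real \<Rightarrow> real \<Rightarrow> chain \<Rightarrow> chain" where
  "capc a b c = restc (cu c) (cv c)
    (\<lambda>x. min (cf c x) (min (cf c (cu c) + a * (x - cu c)) (cf c (cv c) + b * (cv c - x)))) (sl c)"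

definition mirc :: "chain \<Rightarrow> chain" where
  "mirc c = Chain (- cv c) (- cu c) (\<lambda>x. cf c (- x)) (- sl c)"

definition okc :: "chain \<Rightarrow> bool" where
  "okc c \<longleftrightarrow> cu c \<le> cv c \<and> conc (cu c) (cv c) (cf c) \<and> (\<forall>x. x < cu c \<or> cv c < x \<longrightarrow> cf c x = 0) \<and>
    cf c (cv c) = cf c (cu c) + sl c * (cv c - cu c)"

text \<open>Caps that leave the chain unchanged (\<open>capc_cpd\<close>). They serve as neutral
  tags, since no real number is an infinite slope.\<close>

definition cpd :: "real \<Rightarrow> real \<Rightarrow> chain \<Rightarrow> bool" where
  "cpd a b c \<longleftrightarrow> sl c \<le> a \<and> - b \<le> sl c \<and> (\<forall>x. cu c \<le> x \<longrightarrow> x \<le> cv c \<longrightarrow>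
    cf c x \<le> cf c (cu c) + a * (x - cu c) \<and> cf c x \<le> cf c (cv c) + b * (cv c - x))"

lemma sel_simps [simp]:
  "cu (restc u v f s) = u" "cv (restc u v f s) = v" "sl (restc u v f s) = s"
  "cu (linc u y v s) = u" "cv (linc u y v s) = v" "sl (linc u y v s) = s"
  "cu (addc g k c) = cu c" "cv (addc g k c) = cv c" "sl (addc g k c) = sl c + g"
  "cu (capc a b c) = cu c" "cv (capc a b c) = cv c" "sl (capc a b c) = sl c"
  "cu (mirc c) = - cv c" "cv (mirc c) = - cu c" "sl (mirc c) = - sl c"
  by (simp_all add: restc_def linc_def addc_def capc_def mirc_def)

lemma cf_restc: "cf (restc u v f s) x = (if u \<le> x \<and> x \<le> v then f x else 0)"
  by (simp add: restc_def)

lemma cf_linc: "cf (linc u y v s) x = (if u \<le> x \<and> x \<le> v then y + s * (x - u) else 0)"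
  by (simp add: linc_def cf_restc)

lemma cf_addc: "cf (addc g k c) x = (if cu c \<le> x \<and> x \<le> cv c then cf c x + g * x + k else 0)"
  by (simp add: addc_def cf_restc)

lemma cf_mirc [simp]: "cf (mirc c) x = cf c (- x)"
  by (simp add: mirc_def)

lemma okc_le [simp]: "okc c \<Longrightarrow> cu c \<le> cv c"
  by (simp add: okc_def)

lemma okc_conc: "okc c \<Longrightarrow> conc (cu c) (cv c) (cf c)"
  by (simp add: okc_def)

lemma okc_end: "okc c \<Longrightarrow> cf c (cv c) = cf c (cu c) + sl c * (cv c - cu c)"
  by (simp add: okc_def)

lemma chain_eqI:
  assumes "cu c = cu d" "cv c = cv d" "sl c = sl d" "\<And>x. cf c x = cf d x"
  shows "c = d"
  using assms by (cases c; cases d) (auto intro: ext)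

text \<open>The bounds on the chord slope mean that neither cap cuts off the opposite end. Hence
  capping neighbouring chains separately keeps the graph continuous.\<close>

lemma cf_capc:
  assumes "okc c" "sl c \<le> a" "- b \<le> sl c"
  shows "cf (capc a b c) (cu c) = cf c (cu c)" "cf (capc a b c) (cv c) = cf c (cv c)"
proof -
  have "sl c * (cv c - cu c) \<le> a * (cv c - cu c)" "- b * (cv c - cu c) \<le> sl c * (cv c - cu c)"
    using assms by (intro mult_right_mono; simp)+
  then show "cf (capc a b c) (cu c) = cf c (cu c)" "cf (capc a b c) (cv c) = cf c (cv c)"
    using assms okc_end[OF assms(1)] by (auto simp: capc_def cf_restc min_def)
qed

lemma okc_restc:
  assumes "u \<le> v" "conc u v f" "f v = f u + s * (v - u)"
  shows "okc (restc u v f s)"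
  using assms by (auto simp: okc_def cf_restc intro: conc_cong)

lemma okc_linc: "u \<le> v \<Longrightarrow> okc (linc u y v s)"
  unfolding linc_def by (rule okc_restc) (auto intro!: conc_cong[OF conc_affine[of u v "y - s * u" s]] simp: algebra_simps)

lemma okc_addc: "okc c \<Longrightarrow> okc (addc g k c)"
  unfolding addc_def by (rule okc_restc, simp, rule conc_add, erule okc_conc) (simp add: okc_end algebra_simps)

lemma okc_capc:
  assumes "okc c" "sl c \<le> a" "- b \<le> sl c"
  shows "okc (capc a b c)"
proof -
  have "conc (cu c) (cv c) (\<lambda>x. min (cf c x) (min (cf c (cu c) + a * (x - cu c)) (cf c (cv c) + b * (cv c - x))))"
    using okc_conc[OF assms(1)] conc_affine[of "cu c" "cv c" "cf c (cu c) - a * cu c" a]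
      conc_affine[of "cu c" "cv c" "cf c (cv c) + b * cv c" "- b"]
    by (intro conc_min) (auto simp: algebra_simps elim!: conc_cong)
  moreover have "cf (capc a b c) (cv c) = cf (capc a b c) (cu c) + sl c * (cv c - cu c)"
    using cf_capc[OF assms] okc_end[OF assms(1)] by simp
  ultimately show ?thesis
    using assms(1) by (auto simp: okc_def capc_def cf_restc elim!: conc_cong)
qed

lemma okc_mirc: "okc c \<Longrightarrow> okc (mirc c)"
  unfolding okc_def by (auto simp: algebra_simps dest: conc_neg) (auto simp: mirc_def dest: conc_neg)

lemma mirc_mirc [simp]: "mirc (mirc c) = c"
  by (simp add: mirc_def)

lemma mirc_addc: "mirc (addc g k c) = addc (- g) k (mirc c)"
  by (rule chain_eqI) (auto simp: cf_addc)

lemma mirc_capc: "mirc (capc a b c) = capc b a (mirc c)"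
  by (rule chain_eqI) (auto simp: capc_def cf_restc algebra_simps min.commute)

lemma addc_addc: "addc g k (addc g' k' c) = addc (g' + g) (k' + k) c"
  by (rule chain_eqI) (auto simp: cf_addc algebra_simps)

lemma addc_0: "okc c \<Longrightarrow> addc 0 0 c = c"
  by (rule chain_eqI) (auto simp: cf_addc okc_def)

lemma addc_capc:
  assumes "cu c \<le> cv c"
  shows "addc g k (capc a b c) = capc (a + g) (b - g) (addc g k c)"
proof (rule chain_eqI)
  fix x
  have *: "min p (min q r) + z + w = min (p + z + w) (min (q + z + w) (r + z + w))" for p q r z w :: real
    by (simp add: min_def)
  show "cf (addc g k (capc a b c)) x = cf (capc (a + g) (b - g) (addc g k c)) x"
  proof (cases "cu c \<le> x \<and> x \<le> cv c")
    case True
    then show ?thesis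
      using assms
      by (simp add: cf_addc capc_def cf_restc *, intro arg_cong2[where f = min] refl)
        (simp_all add: algebra_simps)
  qed (auto simp: cf_addc capc_def cf_restc)
qed simp_all

text \<open>The first caps leave both ends in place, so the second ones start at the same points; of
  two lines through one point, the one with the smaller slope wins.\<close>

lemma capc_capc:
  assumes "okc c" "sl c \<le> a" "- b \<le> sl c"
  shows "capc a' b' (capc a b c) = capc (min a a') (min b b') c"
proof (rule chain_eqI)
  fix x
  show "cf (capc a' b' (capc a b c)) x = cf (capc (min a a') (min b b') c) x"
  proof (cases "cu c \<le> x \<and> x \<le> cv c")
    case True
    have *: "z + min p q * r = min (z + p * r) (z + q * r)" if "0 \<le> r" for p q r z :: real
      using that by (simp add: min_mult_distrib_right min_add_distrib_right)
    have **: "min (min p (min q r)) (min s t) = min p (min (min q s) (min r t))" for p q r s t :: real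
      by (simp only: min.assoc min.commute min.left_commute)
    have 1: "cf (capc a' b' (capc a b c)) x = min (cf (capc a b c) x)
      (min (cf c (cu c) + a' * (x - cu c)) (cf c (cv c) + b' * (cv c - x)))"
      using True cf_capc[OF assms] by (simp add: capc_def[of a' b'] cf_restc)
    have 2: "cf (capc p q c) x = min (cf c x)
      (min (cf c (cu c) + p * (x - cu c)) (cf c (cv c) + q * (cv c - x)))" for p q
      using True by (simp add: capc_def cf_restc)
    have "0 \<le> x - cu c" "0 \<le> cv c - x"
      using True by simp_all
    note * = *[OF this(1)] *[OF this(2)]
    show ?thesis
      unfolding 1 2 * by (rule **)
  qed (auto simp: capc_def cf_restc)
qed simp_all

lemma capc_cpd: "okc c \<Longrightarrow> cpd a b c \<Longrightarrow> capc a b c = c"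
  by (rule chain_eqI) (auto simp: capc_def cf_restc cpd_def okc_def min_def not_le)

lemma cpd_capc:
  assumes "okc c" "sl c \<le> a" "- b \<le> sl c"
  shows "cpd a b (capc a b c)"
  using assms unfolding cpd_def by (auto simp: cf_capc[OF assms]) (simp_all add: capc_def cf_restc min_le_iff_disj)

lemma cpd_mono:
  assumes "cpd a b c" "a \<le> a'" "b \<le> b'"
  shows "cpd a' b' c"
proof -
  have "a * (x - cu c) \<le> a' * (x - cu c)" "b * (cv c - x) \<le> b' * (cv c - x)"
    if "cu c \<le> x" "x \<le> cv c" for x
    using assms that by (auto intro!: mult_right_mono)
  with assms show ?thesis
    unfolding cpd_def by (meson add_left_mono order_trans le_minus_iff neg_le_iff_le)
qed

text \<open>As \<open>a\<close> and \<open>b\<close> have no effect on \<open>c\<close>, capping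
  with \<open>a'\<close> and \<open>b'\<close> is the same as capping with the minima.\<close>

lemma cpd_capc_min:
  assumes "okc c" "cpd a b c" "sl c \<le> a'" "- b' \<le> sl c"
  shows "cpd (min a a') (min b b') (capc a' b' c)"
proof -
  have "capc a' b' c = capc (min a a') (min b b') c"
    using capc_capc[OF assms(1), of a b a' b'] capc_cpd[OF assms(1,2)] assms by (auto simp: cpd_def)
  with assms cpd_capc show ?thesis by (auto simp: cpd_def)
qed

lemma cpd_addc: "cpd a b c \<Longrightarrow> cu c \<le> cv c \<Longrightarrow> cpd (a + g) (b - g) (addc g k c)"
  by (auto simp: cpd_def cf_addc algebra_simps)

lemma cpd_mirc:
  assumes "cpd a b c"
  shows "cpd b a (mirc c)"
proof -
  have "cf c (- x) \<le> cf c (cu c) + a * (- x - cu c) \<and> cf c (- x) \<le> cf c (cv c) + b * (cv c - - x)"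
    if "- cv c \<le> x" "x \<le> - cu c" for x
    using assms that unfolding cpd_def by (auto dest: spec[of _ "- x"])
  with assms show ?thesis
    unfolding cpd_def by (auto simp: algebra_simps)
qed

lemma cpd_linc: "u \<le> v \<Longrightarrow> s \<le> a \<Longrightarrow> - b \<le> s \<Longrightarrow> cpd a b (linc u y v s)"
proof -
  assume "u \<le> v" "s \<le> a" "- b \<le> s"
  moreover have "s * (x - u) \<le> a * (x - u)" "- b * (v - x) \<le> s * (v - x)" if "u \<le> x" "x \<le> v" for x
    using that \<open>s \<le> a\<close> \<open>- b \<le> s\<close> by (auto intro!: mult_right_mono simp del: mult_minus_left)
  ultimately show ?thesis
    by (auto simp: cpd_def cf_linc algebra_simps)
qed

section \<open>Lists of adjacent chains and the continuous functions they describe\<close>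

definition adj :: "chain \<Rightarrow> chain \<Rightarrow> bool" where
  "adj c d \<longleftrightarrow> cv c = cu d \<and> cf c (cv c) = cf d (cu d)"

definition okl :: "chain list \<Rightarrow> bool" where
  "okl cs \<longleftrightarrow> cs \<noteq> [] \<and> successively adj cs \<and> (\<forall>c\<in>set cs. okc c)"

fun cval :: "chain list \<Rightarrow> real \<Rightarrow> real" where
  "cval [] x = 0"
| "cval (c # cs) x = (if x \<le> cv c then cf c x else cval cs x)"

abbreviation cul :: "chain list \<Rightarrow> real" where "cul cs \<equiv> cu (hd cs)"
abbreviation cvl :: "chain list \<Rightarrow> real" where "cvl cs \<equiv> cv (last cs)"

lemma okl_simps [simp]:
  "\<not> okl []"
  "okl [c] \<longleftrightarrow> okc c"
  "okl (c # d # cs) \<longleftrightarrow> okc c \<and> adj c d \<and> okl (d # cs)"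
  by (auto simp: okl_def)

lemma okl_okc: "okl cs \<Longrightarrow> c \<in> set cs \<Longrightarrow> okc c"
  by (simp add: okl_def)

lemma okl_append:
  assumes "cs \<noteq> []" "ds \<noteq> []"
  shows "okl (cs @ ds) \<longleftrightarrow> okl cs \<and> okl ds \<and> adj (last cs) (hd ds)"
  using assms by (auto simp: okl_def successively_append_iff)

lemma okl_bounds:
  assumes "okl cs" "c \<in> set cs"
  shows "cul cs \<le> cu c \<and> cu c \<le> cv c \<and> cv c \<le> cvl cs"
  using assms
proof (induction cs arbitrary: c)
  case (Cons d ds)
  show ?case
  proof (cases ds)
    case (Cons e es)
    with Cons.prems Cons.IH[of c] Cons.IH[of e] show ?thesis
      by (auto simp: adj_def dest: okc_le)
  qed (use Cons.prems in auto)
qed simp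

lemma okl_range: "okl cs \<Longrightarrow> cul cs \<le> cvl cs"
  using okl_bounds[of cs "hd cs"] by (metis hd_in_set okl_simps(1) order_trans)

text \<open>\<open>cval\<close> picks the leftmost of the chains meeting at \<open>x\<close>; by
  \<open>adj\<close> this choice does not matter.\<close>

lemma cval_in:
  assumes "okl cs" "c \<in> set cs" "cu c \<le> x" "x \<le> cv c"
  shows "cval cs x = cf c x"
  using assms
proof (induction cs arbitrary: c)
  case (Cons d ds)
  show ?case
  proof (cases "c \<in> set ds \<and> x \<le> cv d")
    case True
    then obtain e es where ds: "ds = e # es" by (cases ds) auto
    with Cons.prems True okl_bounds[of ds c] okl_bounds[of ds e]
    have *: "x = cv d" "cv d = cu e" "cf d (cv d) = cf e (cu e)" "cu e \<le> cv e" by (auto simp: adj_def)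
    have "cval ds x = cf c x" "cval ds x = cf e x"
      using Cons.IH[of c] Cons.IH[of e] Cons.prems ds * True by auto
    with * show ?thesis by simp
  next
    case False
    with Cons.prems Cons.IH[of c] show ?thesis by (cases ds) auto
  qed
qed simp

lemma cval_ex:
  assumes "okl cs" "cul cs \<le> x" "x \<le> cvl cs"
  obtains c where "c \<in> set cs" "cu c \<le> x" "x \<le> cv c"
  using assms
proof (induction cs arbitrary: thesis)
  case (Cons d ds)
  show ?case
  proof (cases "x \<le> cv d")
    case True
    with Cons.prems show ?thesis by auto
  next
    case False
    with Cons.prems obtain e es where ds: "ds = e # es" by (cases ds) auto
    show ?thesis
      by (rule Cons.IH) (use Cons.prems False ds in \<open>auto simp: adj_def\<close>)
  qed
qed simp

lemma cval_out:
  assumes "okl cs" "x < cul cs \<or> cvl cs < x"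
  shows "cval cs x = 0"
  using assms
proof (induction cs)
  case (Cons d ds)
  have le: "cul (d # ds) \<le> cvl (d # ds)" "cu d \<le> cv d" "cv d \<le> cvl (d # ds)"
    using okl_range[of "d # ds"] okl_bounds[of "d # ds" d] Cons.prems by auto
  show ?case
  proof (cases "x \<le> cv d")
    case True
    with Cons.prems le have "x < cu d" by auto
    with True Cons.prems show ?thesis using okl_okc[of "d # ds" d] by (auto simp: okc_def)
  next
    case False
    with le have "cvl (d # ds) < x" using Cons.prems by auto
    with False Cons show ?thesis by (cases ds) (auto simp: adj_def)
  qed
qed simp

lemma cval_hd: "okl cs \<Longrightarrow> cval cs (cul cs) = cf (hd cs) (cul cs)"
  by (rule cval_in) (auto simp: okl_def)

lemma cval_last: "okl cs \<Longrightarrow> cval cs (cvl cs) = cf (last cs) (cvl cs)"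
  by (rule cval_in) (auto simp: okl_def)

lemma cval_single: "okc c \<Longrightarrow> cval [c] = cf c"
  by (auto simp: okc_def)

lemma cval_eqI:
  assumes "okl cs" "x < cul cs \<or> cvl cs < x \<Longrightarrow> p = 0"
    "\<And>c. c \<in> set cs \<Longrightarrow> cu c \<le> x \<Longrightarrow> x \<le> cv c \<Longrightarrow> p = cf c x"
  shows "cval cs x = p"
proof (cases "x < cul cs \<or> cvl cs < x")
  case False
  with assms(1) obtain c where "c \<in> set cs" "cu c \<le> x" "x \<le> cv c" by (auto elim: cval_ex[of cs x])
  with assms show ?thesis by (simp add: cval_in)
qed (use assms cval_out in auto)

lemma cval_append1:
  assumes "okl (cs @ ds)" "cs \<noteq> []" "x \<le> cvl cs"
  shows "cval (cs @ ds) x = cval cs x"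
proof (cases "ds = []")
  case False
  with assms have ok: "okl cs" "okl ds" by (auto simp: okl_append)
  show ?thesis
    by (rule cval_eqI[symmetric], rule ok)
      (use assms in \<open>auto simp: cval_in intro: cval_out[OF assms(1)]\<close>)
qed simp

lemma cval_append2:
  assumes "okl (cs @ ds)" "ds \<noteq> []" "cul ds \<le> x"
  shows "cval (cs @ ds) x = cval ds x"
proof (cases "cs = []")
  case False
  with assms have ok: "okl cs" "okl ds" by (auto simp: okl_append)
  show ?thesis
    by (rule cval_eqI[symmetric], rule ok)
      (use assms in \<open>auto simp: cval_in intro: cval_out[OF assms(1)]\<close>)
qed simp

lemma okl_addc: "okl cs \<Longrightarrow> okl (map (addc g k) cs)"
  by (auto simp: okl_def successively_map adj_def cf_addc okc_addc elim!: successively_mono)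

lemma okl_capc:
  assumes "okl cs" "\<And>c. c \<in> set cs \<Longrightarrow> sl c \<le> a \<and> - b \<le> sl c"
  shows "okl (map (capc a b) cs)"
proof -
  have "adj (capc a b c) (capc a b d)" if "c \<in> set cs" "d \<in> set cs" "adj c d" for c d
    using cf_capc[of c a b] cf_capc[of d a b] that assms by (auto simp: adj_def okl_def)
  with assms show ?thesis
    by (auto simp: okl_def successively_map okc_capc elim!: successively_mono)
qed

lemma okl_mirc: "okl cs \<Longrightarrow> okl (map mirc (rev cs))"
  by (auto simp: okl_def successively_map okc_mirc adj_def elim!: successively_mono)

lemma ends_map [simp]:
  assumes "cs \<noteq> []"
  shows "cul (map (addc g k) cs) = cul cs" "cvl (map (addc g k) cs) = cvl cs"
    "cul (map (capc a b) cs) = cul cs" "cvl (map (capc a b) cs) = cvl cs"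
    "cul (map mirc (rev cs)) = - cvl cs" "cvl (map mirc (rev cs)) = - cul cs"
  using assms by (simp_all add: hd_map last_map hd_rev last_rev)

lemma cval_addc:
  assumes "okl cs"
  shows "cval (map (addc g k) cs) x = (if cul cs \<le> x \<and> x \<le> cvl cs then cval cs x + g * x + k else 0)"
proof -
  have "cs \<noteq> []" using assms by (auto simp: okl_def)
  show ?thesis
    by (rule cval_eqI, rule okl_addc, rule assms)
      (use assms \<open>cs \<noteq> []\<close> in \<open>auto simp: cf_addc cval_in dest: okl_bounds\<close>)
qed

lemma cval_mirc:
  assumes "okl cs"
  shows "cval (map mirc (rev cs)) x = cval cs (- x)"
proof -
  have "cs \<noteq> []" using assms by (auto simp: okl_def)
  show ?thesis
    by (rule cval_eqI, rule okl_mirc, rule assms)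
      (use assms \<open>cs \<noteq> []\<close> in \<open>auto simp: cval_in intro: cval_out\<close>)
qed

definition glue :: "chain list \<Rightarrow> chain" where
  "glue cs = Chain (cul cs) (cvl cs) (cval cs) ((cval cs (cvl cs) - cval cs (cul cs)) / (cvl cs - cul cs))"

lemma glue_sel [simp]: "cu (glue cs) = cul cs" "cv (glue cs) = cvl cs" "cf (glue cs) = cval cs"
  by (simp_all add: glue_def)

lemma sl_glue: "okl cs \<Longrightarrow> cval cs (cvl cs) = cval cs (cul cs) + sl (glue cs) * (cvl cs - cul cs)"
  by (auto simp: glue_def)

lemma okc_glue: "okl cs \<Longrightarrow> conc (cul cs) (cvl cs) (cval cs) \<Longrightarrow> okc (glue cs)"
  using sl_glue by (auto simp: okc_def okl_range cval_out)

text \<open>Ignores \<open>sl\<close>: on a single point \<open>glue\<close> computes the slope 0 by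
  x / 0 = 0, whatever slope the chain carries.\<close>

definition sim :: "chain \<Rightarrow> chain \<Rightarrow> bool" where
  "sim c d \<longleftrightarrow> cu c = cu d \<and> cv c = cv d \<and> cf c = cf d"

text \<open>Each piece rises by at most its length times \<open>a\<close>, and falls by at most its
  length times \<open>b\<close>, so the bounds add up across the common end points.\<close>

lemma glue_cpd:
  assumes "okl cs" "\<forall>c\<in>set cs. cpd a b c" "cul cs \<le> x" "x \<le> cvl cs"
  shows "cval cs x \<le> cval cs (cul cs) + a * (x - cul cs) \<and> cval cs x \<le> cval cs (cvl cs) + b * (cvl cs - x)"
  using assms
proof (induction cs arbitrary: x)
  case (Cons c cs)
  show ?case
  proof (cases cs)
    case Nil
    with Cons.prems show ?thesis by (auto simp: cpd_def)
  next
    case (Cons d ds)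
    have c: "okc c" "adj c d" "okl cs" "cpd a b c" and le: "cu c \<le> cv c" "cv c \<le> cvl cs"
      using Cons.prems Cons okl_range[of cs] by (auto simp: adj_def dest: okc_le)
    have last: "cval (c # cs) (cvl (c # cs)) = cval cs (cvl cs)"
      using cval_append2[of "[c]" cs "cvl cs"] Cons.prems Cons okl_range[of cs] by auto
    have hd: "cval cs (cul cs) = cf c (cv c)" "cul cs = cv c"
      using c cval_hd[of cs] Cons by (auto simp: adj_def)
    have IH: "cval cs x \<le> cval cs (cul cs) + a * (x - cul cs) \<and> cval cs x \<le> cval cs (cvl cs) + b * (cvl cs - x)"
      if "cul cs \<le> x" "x \<le> cvl cs" for x
      using Cons.IH[of x] that Cons.prems Cons by simp
    have c1: "cf c x \<le> cf c (cu c) + a * (x - cu c)" "cf c x \<le> cf c (cv c) + b * (cv c - x)"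
      if "cu c \<le> x" "x \<le> cv c" for x
      using c(4) that by (auto simp: cpd_def)
    have first: "cval (c # cs) (cul (c # cs)) = cf c (cu c)"
      using le by simp
    show ?thesis
    proof (cases "x \<le> cv c")
      case True
      then show ?thesis
        unfolding last first using IH[of "cul cs"] hd c1[of x] Cons.prems le Cons
        by (simp add: algebra_simps)
    next
      case False
      then show ?thesis
        unfolding last first using IH[of x] hd c1[of "cv c"] Cons.prems le Cons
        by (simp add: algebra_simps)
    qed
  qed
qed simp

section \<open>Trees representing lists of chains\<close>

text \<open>That \<open>mc\<close> and \<open>nc\<close> are attained lets a comparison at the root
  decide whether a steep chain exists below. The condition \<open>fl T \<noteq> 0\<close> makes the
  negation in \<open>mirT\<close> toggle the sign test.\<close>

definition hdr :: "tree \<Rightarrow> chain list \<Rightarrow> bool" where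
  "hdr T cs \<longleftrightarrow> okl cs \<and> (\<forall>c\<in>set cs. cpd (sa T) (sb T) c \<and> nc T \<le> sl c \<and> sl c \<le> mc T) \<and>
    (\<exists>c\<in>set cs. sl c = mc T) \<and> (\<exists>c\<in>set cs. sl c = nc T) \<and> fl T \<noteq> 0 \<and>
    xl T = cul cs \<and> yl T = cval cs (cul cs) \<and> xr T = cvl cs \<and> yr T = cval cs (cvl cs)"

lemma tree_sel [simp]:
  "ht (addT g c T) = ht T" "xl (addT g c T) = xl T" "yl (addT g c T) = yl T + g * xl T + c"
  "xr (addT g c T) = xr T" "yr (addT g c T) = yr T + g * xr T + c" "mc (addT g c T) = mc T + g"
  "nc (addT g c T) = nc T + g" "sa (addT g c T) = sa T + g" "sb (addT g c T) = sb T - g"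
  "pg (addT g c T) = pg T + g" "pc (addT g c T) = pc T + c" "fl (addT g c T) = fl T"
  "kids (addT g c T) = kids T"
  "ht (capT a b T) = ht T" "xl (capT a b T) = xl T" "yl (capT a b T) = yl T"
  "xr (capT a b T) = xr T" "yr (capT a b T) = yr T" "mc (capT a b T) = mc T"
  "nc (capT a b T) = nc T" "sa (capT a b T) = min (sa T) a" "sb (capT a b T) = min (sb T) b"
  "pg (capT a b T) = pg T" "pc (capT a b T) = pc T" "fl (capT a b T) = fl T"
  "kids (capT a b T) = kids T"
  "ht (mirT T) = ht T" "xl (mirT T) = - xr T" "yl (mirT T) = yr T"
  "xr (mirT T) = - xl T" "yr (mirT T) = yl T" "mc (mirT T) = - nc T"
  "nc (mirT T) = - mc T" "sa (mirT T) = sb T" "sb (mirT T) = sa T"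
  "pg (mirT T) = - pg T" "pc (mirT T) = pc T" "fl (mirT T) = - fl T"
  "kids (mirT T) = kids T"
  by (simp_all add: addT_def capT_def mirT_def)

lemma hdrD:
  assumes "hdr T cs"
  shows "okl cs" "cs \<noteq> []" "c \<in> set cs \<Longrightarrow> cpd (sa T) (sb T) c" "c \<in> set cs \<Longrightarrow> okc c"
    "c \<in> set cs \<Longrightarrow> nc T \<le> sl c" "c \<in> set cs \<Longrightarrow> sl c \<le> mc T"
    "xl T = cul cs" "yl T = cval cs (cul cs)" "xr T = cvl cs" "yr T = cval cs (cvl cs)"
    "mc T \<le> sa T" "- sb T \<le> nc T"
  using assms by (auto simp: hdr_def okl_def cpd_def)

lemma hdr_addT: "hdr T cs \<Longrightarrow> hdr (addT g k T) (map (addc g k) cs)"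
  unfolding hdr_def
  by (auto simp: okl_addc cval_addc okl_range okl_def[of cs] intro!: cpd_addc)

lemma hdr_capT:
  assumes "hdr T cs" "mc T \<le> a" "- b \<le> nc T"
  shows "hdr (capT a b T) (map (capc a b) cs)"
proof -
  note T = hdrD[OF assms(1)]
  have sl: "sl c \<le> a \<and> - b \<le> sl c" if "c \<in> set cs" for c
    using T(5,6)[OF that] assms by auto
  have ok: "okl (map (capc a b) cs)"
    using sl by (rule okl_capc[OF T(1)])
  have "cf (hd (map (capc a b) cs)) (cul cs) = cf (hd cs) (cul cs)"
    "cf (last (map (capc a b) cs)) (cvl cs) = cf (last cs) (cvl cs)"
    using T(2,4) sl by (simp_all add: hd_map last_map cf_capc)
  then have "cval (map (capc a b) cs) (cul cs) = cval cs (cul cs)"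
    "cval (map (capc a b) cs) (cvl cs) = cval cs (cvl cs)"
    using cval_hd[OF ok] cval_last[OF ok] cval_hd[OF T(1)] cval_last[OF T(1)] T(2) by simp_all
  with assms(1) ok T(2) sl show ?thesis
    unfolding hdr_def by (auto intro!: cpd_capc_min simp: okl_def)
qed

lemma hdr_mirT: "hdr T cs \<Longrightarrow> hdr (mirT T) (map mirc (rev cs))"
  unfolding hdr_def by (auto simp: okl_mirc cval_mirc intro!: cpd_mirc) (auto simp: okl_def)

lemma hdr_nodeT:
  assumes "hdr l ls" "hdr r rs" "okl (ls @ rs)"
  shows "hdr (nodeT l r) (ls @ rs)"
proof -
  note l = hdrD[OF assms(1)] note r = hdrD[OF assms(2)]
  have "cval (ls @ rs) (cul ls) = cval ls (cul ls)" "cval (ls @ rs) (cvl rs) = cval rs (cvl rs)"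
    using assms(3) l(1,2) r(1,2) by (simp_all add: cval_append1 cval_append2 okl_range)
  then have ends: "xl (nodeT l r) = cul (ls @ rs)" "yl (nodeT l r) = cval (ls @ rs) (cul (ls @ rs))"
    "xr (nodeT l r) = cvl (ls @ rs)" "yr (nodeT l r) = cval (ls @ rs) (cvl (ls @ rs))"
    using l(2,7-10) r(2,7-10) by (simp_all add: nodeT_def)
  have all: "cpd (max (sa l) (sa r)) (max (sb l) (sb r)) c \<and> min (nc l) (nc r) \<le> sl c \<and> sl c \<le> max (mc l) (mc r)"
    if "c \<in> set ls \<or> c \<in> set rs" for c
    using that
  proof
    assume "c \<in> set ls"
    with l(3,5,6)[of c] show ?thesis by (auto intro: cpd_mono min.coboundedI1 max.coboundedI1)
  next
    assume "c \<in> set rs"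
    with r(3,5,6)[of c] show ?thesis by (auto intro: cpd_mono min.coboundedI2 max.coboundedI2)
  qed
  have ex: "\<exists>c\<in>set (ls @ rs). sl c = max (mc l) (mc r)" "\<exists>c\<in>set (ls @ rs). sl c = min (nc l) (nc r)"
    using assms(1,2) unfolding hdr_def max_def min_def by auto
  show ?thesis
    unfolding hdr_def ends using assms(3) all ex by (simp add: nodeT_def)
qed

lemma hdr_chainT:
  assumes "hdr B bs" "conc (cul bs) (cvl bs) (cval bs)"
  shows "hdr (chainT B) [glue bs]"
proof -
  note B = hdrD[OF assms(1)]
  let ?s = "sl (glue bs)"
  have s: "?s = (yr B - yl B) / (xr B - xl B)"
    using B by (simp add: glue_def)
  have ok: "okc (glue bs)"
    using B(1) assms(2) by (rule okc_glue)
  have "cpd (max (sa B) ?s) (max (sb B) (- ?s)) (glue bs)"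
  proof -
    have "cval bs x \<le> cval bs (cul bs) + max (sa B) ?s * (x - cul bs) \<and>
      cval bs x \<le> cval bs (cvl bs) + max (sb B) (- ?s) * (cvl bs - x)"
      if "cul bs \<le> x" "x \<le> cvl bs" for x
    proof -
      have "sa B * (x - cul bs) \<le> max (sa B) ?s * (x - cul bs)"
        "sb B * (cvl bs - x) \<le> max (sb B) (- ?s) * (cvl bs - x)"
        using that by (auto intro!: mult_right_mono)
      with glue_cpd[OF B(1), of "sa B" "sb B" x] B(3) that show ?thesis by auto
    qed
    then show ?thesis by (auto simp: cpd_def)
  qed
  with ok s B okl_range[OF B(1)] show ?thesis
    by (simp add: hdr_def chainT_def Let_def)
qed

lemma hdr_linT:
  assumes "u \<le> v" "u = v \<Longrightarrow> y = z"
  shows "hdr (linT u y v z) [linc u y v ((z - y) / (v - u))]"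
  using assms by (auto simp: hdr_def linT_def Let_def okc_linc cf_linc intro!: cpd_linc)

section \<open>The representation relation and its behaviour under tags\<close>

definition orient :: "real \<Rightarrow> chain list \<Rightarrow> chain list" where
  "orient s cs = (if s < 0 then map mirc (rev cs) else cs)"

text \<open>
  \<open>rep n h T cs\<close>: the tree \<open>T\<close> of height \<open>h\<close> stores the chains \<open>cs\<close>, each of which is linear
  or kept in an inner tree with at most \<open>n\<close> linear pieces. The tags of a node are pending for
  its children: first reflection, then addition of an affine function, then the caps.
\<close>

inductive rep :: "nat \<Rightarrow> nat \<Rightarrow> tree \<Rightarrow> chain list \<Rightarrow> bool" where
  Leaf: "\<lbrakk>kids T = Leaf; ht T = 0; cs = [linc (xl T) (yl T) (xr T) (mc T)]; hdr T cs\<rbrakk> \<Longrightarrow> rep n 0 T cs"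
| Inner: "\<lbrakk>rep 0 h B bs; length bs \<le> n; conc (cul bs) (cvl bs) (cval bs); kids T = Inner B; ht T = 0;
    c = addc (pg T) (pc T) (hd (orient (fl T) [glue bs])); - sb T \<le> sl c; sl c \<le> sa T;
    cs = [capc (sa T) (sb T) c]; hdr T cs\<rbrakk> \<Longrightarrow> rep n 0 T cs"
| Branch: "\<lbrakk>rep n hl l ls; rep n hr r rs; hl \<le> Suc hr; hr \<le> Suc hl; okl (ls @ rs);
    kids T = Branch l r; h = Suc (max hl hr); ht T = real h;
    ds = map (addc (pg T) (pc T)) (orient (fl T) (ls @ rs));
    \<forall>c\<in>set ds. - sb T \<le> sl c \<and> sl c \<le> sa T;
    cs = map (capc (sa T) (sb T)) ds; hdr T cs\<rbrakk> \<Longrightarrow> rep n h T cs"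

lemma rep_hdr: "rep n h T cs \<Longrightarrow> hdr T cs"
  by (cases rule: rep.cases) auto

lemma rep_ht: "rep n h T cs \<Longrightarrow> ht T = real h"
  by (cases rule: rep.cases) auto

lemma rep_mono: "rep n h T cs \<Longrightarrow> n \<le> m \<Longrightarrow> rep m h T cs"
proof (induction arbitrary: m rule: rep.induct)
  case (Inner h B bs n T c cs)
  then show ?case by (intro rep.Inner[of h B bs m T c cs]) auto
next
  case (Branch n hl l ls hr r rs T h ds cs)
  then show ?case by (intro rep.Branch[of m hl l ls hr r rs T h ds cs]) auto
qed (auto intro: rep.Leaf)

lemma okl_orient: "okl cs \<Longrightarrow> okl (orient s cs)"
  by (simp add: orient_def okl_mirc)

text \<open>Only the root is touched. The caps are performed after the summand, so a further summand
  has to pass through them, which shifts their slopes (\<open>addc_capc\<close>).\<close>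

lemma rep_addT:
  assumes rep: "rep n h T cs"
  shows "rep n h (addT g k T) (map (addc g k) cs)"
  using rep
proof (cases rule: rep.cases)
  note hdr = hdr_addT[OF rep_hdr[OF rep], of g k]
  {
    case Leaf
    have "addc g k (linc (xl T) (yl T) (xr T) (mc T)) = linc (xl T) (yl T + g * xl T + k) (xr T) (mc T + g)"
      by (rule chain_eqI) (auto simp: cf_addc cf_linc algebra_simps)
    with Leaf hdr show ?thesis by (auto intro!: rep.Leaf)
  next
    case (Inner h' B bs c)
    have "okc c"
      using Inner(4,7) rep_hdr[OF Inner(2)] okc_glue[of bs]
      by (auto simp: orient_def okc_mirc hdr_def intro!: okc_addc)
    then have "addc g k (capc (sa T) (sb T) c) = capc (sa T + g) (sb T - g) (addc g k c)"
      by (simp add: addc_capc)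
    with Inner(2-) hdr show ?thesis
      unfolding Inner(1)
      by (intro rep.Inner[of h' B bs n _ "addc g k c"]) (simp_all add: addc_addc)
  next
    case (Branch hl l ls hr r rs ds)
    have ok: "okl ds"
      using Branch by (auto intro!: okl_addc okl_orient)
    then have "map (addc g k) cs = map (capc (sa T + g) (sb T - g)) (map (addc g k) ds)"
      using Branch(11) by (auto simp: addc_capc okl_def)
    moreover have "map (addc g k) ds = map (addc (pg T + g) (pc T + k)) (orient (fl T) (ls @ rs))"
      using Branch(9) by (simp add: addc_addc)
    moreover have "\<forall>c\<in>set (map (addc g k) ds). - (sb T - g) \<le> sl c \<and> sl c \<le> sa T + g"
      using Branch(10) by auto
    ultimately show ?thesis
      by (intro rep.Branch[OF Branch(1-5), where ds = "map (addc g k) ds"])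
        (use Branch(6-8) hdr in simp_all)
  }
qed

text \<open>The constant-time step of a wave. \<open>mc\<close> and \<open>nc\<close> check all
  chords at once, so the new cap fixes all end points and merges with the pending one by
  \<open>capc_capc\<close>; on a linear piece it does nothing.\<close>

lemma rep_capT:
  assumes rep: "rep n h T cs" and "mc T \<le> a" "- b \<le> nc T"
  shows "rep n h (capT a b T) (map (capc a b) cs)"
  using rep
proof (cases rule: rep.cases)
  note hdr = hdr_capT[OF rep_hdr[OF rep] assms(2,3)]
  have sl: "- b \<le> sl c \<and> sl c \<le> a" if "c \<in> set cs" for c
    using hdrD(5,6)[OF rep_hdr[OF rep] that] assms by auto
  {
    case Leaf
    let ?c = "linc (xl T) (yl T) (xr T) (mc T)"
    have "xl T \<le> xr T" using Leaf hdrD(4)[of T cs ?c] rep_hdr[OF rep] by (auto dest: okc_le)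
    moreover have "capc a b ?c = ?c"
      using sl[of ?c] Leaf \<open>xl T \<le> xr T\<close> by (intro capc_cpd okc_linc cpd_linc) auto
    ultimately show ?thesis
      using Leaf hdr by (auto intro!: rep.Leaf)
  next
    case (Inner h' B bs c)
    have "okc c"
      using Inner(4,7) rep_hdr[OF Inner(2)] okc_glue[of bs]
      by (auto simp: orient_def okc_mirc hdr_def intro!: okc_addc)
    then have "capc a b (capc (sa T) (sb T) c) = capc (min (sa T) a) (min (sb T) b) c"
      using Inner by (simp add: capc_capc)
    with Inner(2-) hdr sl show ?thesis
      unfolding Inner(1)
      by (intro rep.Inner[of h' B bs n _ c]) (simp_all add: min_def)
  next
    case (Branch hl l ls hr r rs ds)
    have ok: "okl ds"
      using Branch by (auto intro!: okl_addc okl_orient)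
    then have "map (capc a b) cs = map (capc (min (sa T) a) (min (sb T) b)) ds"
      using Branch(10,11) by (auto simp: capc_capc okl_def)
    moreover have "\<forall>c\<in>set ds. - min (sb T) b \<le> sl c \<and> sl c \<le> min (sa T) a"
    proof
      fix c assume "c \<in> set ds"
      then show "- min (sb T) b \<le> sl c \<and> sl c \<le> min (sa T) a"
        using Branch(10,11) sl[of "capc (sa T) (sb T) c"] by (auto simp: min_def)
    qed
    ultimately show ?thesis
      by (intro rep.Branch[OF Branch(1-5), where ds = ds]) (use Branch(6-9) hdr in simp_all)
  }
qed

text \<open>The reflection arrives last but is the first tag to be performed. Moving it past the
  summand and the caps negates \<open>pg\<close> and exchanges \<open>sa\<close> and
  \<open>sb\<close>.\<close>

lemma rep_mirT:
  assumes rep: "rep n h T cs"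
  shows "rep n h (mirT T) (map mirc (rev cs))"
  using rep
proof (cases rule: rep.cases)
  note hdr = hdr_mirT[OF rep_hdr[OF rep]] and fl = rep_hdr[OF rep, unfolded hdr_def]
  {
    case Leaf
    let ?c = "linc (xl T) (yl T) (xr T) (mc T)"
    have "xl T \<le> xr T" using hdrD(4)[OF rep_hdr[OF rep], of ?c] Leaf by (auto dest: okc_le)
    then have "yr T = yl T + mc T * (xr T - xl T)" "nc T = mc T"
      using rep_hdr[OF rep] Leaf by (auto simp: hdr_def cf_linc)
    then have "mirc ?c = linc (- xr T) (yr T) (- xl T) (- nc T)"
      by (intro chain_eqI) (auto simp: cf_linc algebra_simps)
    with Leaf hdr show ?thesis by (auto intro!: rep.Leaf)
  next
    case (Inner h' B bs c)
    have "mirc c = addc (- pg T) (pc T) (hd (orient (- fl T) [glue bs]))"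
      using Inner(7) fl by (auto simp: mirc_addc orient_def)
    moreover have "- sa T \<le> sl (mirc c)" "sl (mirc c) \<le> sb T"
      using Inner(8,9) by simp_all
    moreover have "map mirc (rev cs) = [capc (sb T) (sa T) (mirc c)]"
      using Inner(10) by (simp add: mirc_capc)
    ultimately show ?thesis
      using hdr unfolding Inner(1)
      by (intro rep.Inner[OF Inner(2-4), where c = "mirc c"]) (simp_all add: Inner(5,6))
  next
    case (Branch hl l ls hr r rs ds)
    have "map mirc (rev ds) = map (addc (- pg T) (pc T)) (orient (- fl T) (ls @ rs))"
      using Branch(9) fl by (auto simp: mirc_addc orient_def rev_map)
    moreover have "map mirc (rev cs) = map (capc (sb T) (sa T)) (map mirc (rev ds))"
      using Branch(11) by (simp add: mirc_capc rev_map)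
    moreover have "\<forall>c\<in>set (map mirc (rev ds)). - sa T \<le> sl c \<and> sl c \<le> sb T"
      using Branch(10) by auto
    ultimately show ?thesis
      by (intro rep.Branch[OF Branch(1-5), where ds = "map mirc (rev ds)"])
        (use Branch(6-8) hdr in simp_all)
  }
qed

lemma rep_linT:
  assumes "u \<le> v" "u = v \<Longrightarrow> y = z"
  shows "rep n 0 (linT u y v z) [linc u y v ((z - y) / (v - u))]"
  using hdr_linT[OF assms] by (intro rep.Leaf) (simp_all add: linT_def Let_def)

lemma rep_nodeT:
  assumes l: "rep n hl l ls" and r: "rep n hr r rs" and h: "hl \<le> Suc hr" "hr \<le> Suc hl"
    and ok: "okl (ls @ rs)"
  shows "rep n (Suc (max hl hr)) (nodeT l r) (ls @ rs)"
proof -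
  note hdr = hdr_nodeT[OF rep_hdr[OF l] rep_hdr[OF r] ok]
  have add: "map (addc 0 0) (ls @ rs) = ls @ rs"
    using ok by (auto simp: okl_def addc_0 intro!: map_idI)
  have cap: "map (capc (sa (nodeT l r)) (sb (nodeT l r))) (ls @ rs) = ls @ rs"
    using hdrD(3,4)[OF hdr] by (intro map_idI capc_cpd) auto
  have f: "pg (nodeT l r) = 0" "pc (nodeT l r) = 0" "\<not> fl (nodeT l r) < 0"
    by (simp_all add: nodeT_def)
  have sl: "\<forall>c\<in>set (ls @ rs). - sb (nodeT l r) \<le> sl c \<and> sl c \<le> sa (nodeT l r)"
    using hdrD(3)[OF hdr] unfolding cpd_def by blast
  show ?thesis
  proof (rule rep.Branch[OF l r h ok])
    show "ht (nodeT l r) = real (Suc (max hl hr))"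
      using rep_ht[OF l] rep_ht[OF r] by (simp add: nodeT_def)
    show "ls @ rs = map (addc (pg (nodeT l r)) (pc (nodeT l r))) (orient (fl (nodeT l r)) (ls @ rs))"
      unfolding f orient_def using f(3) add by simp
  qed (use cap hdr sl in \<open>simp_all add: nodeT_def\<close>)
qed

lemma rep_chainT:
  assumes B: "rep 0 h B bs" and "length bs \<le> n" "conc (cul bs) (cvl bs) (cval bs)"
  shows "rep n 0 (chainT B) [glue bs]"
proof -
  note hdr = hdr_chainT[OF rep_hdr[OF B] assms(3)]
  have "addc 0 0 (glue bs) = glue bs"
    using hdrD(4)[OF hdr] by (simp add: addc_0)
  moreover have "capc (sa (chainT B)) (sb (chainT B)) (glue bs) = glue bs"
    using hdrD(3,4)[OF hdr] by (simp add: capc_cpd)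
  moreover have "pg (chainT B) = 0" "pc (chainT B) = 0" "\<not> fl (chainT B) < 0" "kids (chainT B) = Inner B"
    "ht (chainT B) = 0"
    by (auto simp: chainT_def Let_def)
  ultimately show ?thesis
    using assms hdr hdrD(3)[OF hdr]
    by (intro rep.Inner[of h B bs n _ "glue bs"]) (auto simp: orient_def cpd_def)
qed

lemma rep_oriented:
  "rep n h T cs \<Longrightarrow> rep n h (if s < 0 then mirT T else T) (orient s cs)"
  by (simp add: orient_def rep_mirT)

lemma rep_getk:
  assumes "rep n h k ks" "\<forall>c\<in>set ks. okc c"
    and "\<forall>c\<in>set (map (addc (pg T) (pc T)) (orient (fl T) ks)). - sb T \<le> sl c \<and> sl c \<le> sa T"
  shows "rep n h (getkT T k) (map (capc (sa T) (sb T)) (map (addc (pg T) (pc T)) (orient (fl T) ks)))"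
proof -
  let ?ks = "map (addc (pg T) (pc T)) (orient (fl T) ks)"
  let ?k = "addT (pg T) (pc T) (if fl T < 0 then mirT k else k)"
  have k: "rep n h ?k ?ks"
    using assms(1) by (intro rep_addT rep_oriented)
  moreover have "mc ?k \<le> sa T" "- sb T \<le> nc ?k"
    using rep_hdr[OF k] assms(3) unfolding hdr_def by metis+
  ultimately show ?thesis
    unfolding getkT_def by (rule rep_capT)
qed

lemma rep_BranchE:
  assumes "rep n h T cs" "kids T = Branch k k'"
  obtains hl hr ls rs where
    "rep n hl (getkT T (if fl T < 0 then k' else k)) ls"
    "rep n hr (getkT T (if fl T < 0 then k else k')) rs"
    "cs = ls @ rs" "h = Suc (max hl hr)" "hl \<le> Suc hr" "hr \<le> Suc hl" "okl cs" "ls \<noteq> []" "rs \<noteq> []"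
  using assms(1)
proof (cases rule: rep.cases)
  case (Branch hl l ls hr r rs ds)
  have lr: "l = k" "r = k'" using Branch assms(2) by auto
  have ok: "okl (ls @ rs)" "ls \<noteq> []" "rs \<noteq> []" "okl cs"
    using Branch rep_hdr[OF Branch(1)] rep_hdr[OF Branch(2)] rep_hdr[OF assms(1)] by (auto simp: hdr_def)
  let ?f = "\<lambda>cs. map (capc (sa T) (sb T)) (map (addc (pg T) (pc T)) (orient (fl T) cs))"
  have "rep n hl (getkT T k) (?f ls)" "rep n hr (getkT T k') (?f rs)"
    using Branch lr ok(1) by (auto intro!: rep_getk simp: okl_def simp del: map_map) (auto simp: orient_def split: if_splits)
  moreover have "cs = (if fl T < 0 then ?f rs @ ?f ls else ?f ls @ ?f rs)"
    using Branch by (simp add: orient_def)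
  ultimately show ?thesis
    using that[of hr "?f rs" hl "?f ls"] that[of hl "?f ls" hr "?f rs"] Branch(3,4,7) ok
    by (cases "fl T < 0") (simp_all add: orient_def max.commute del: map_map)
qed (use assms(2) in auto)

text \<open>After reflection and summand the inner tree holds the chain \<open>c\<close> before its
  caps, which are still pending; the slopes may differ on a single point, hence
  \<open>sim\<close>.\<close>

lemma rep_InnerE:
  assumes "rep n h T cs" "kids T = Inner B"
  obtains c d h' bs where "cs = [capc (sa T) (sb T) c]" "rep 0 h' (baseT T B) bs" "length bs \<le> n"
    "sim (glue bs) c" "okc c" "- sb T \<le> sl c" "sl c \<le> sa T" "h = 0"
  using assms(1)
proof (cases rule: rep.cases)
  case (Inner h' B' bs c)
  have B: "B' = B" using Inner assms(2) by auto
  let ?bs = "map (addc (pg T) (pc T)) (orient (fl T) bs)"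
  have ok: "okl bs" "okc (glue bs)" using Inner rep_hdr[OF Inner(2)] okc_glue by (auto simp: hdr_def)
  have "okc c" using Inner ok by (auto simp: orient_def okc_mirc intro!: okc_addc)
  moreover have "rep 0 h' (baseT T B) ?bs"
    unfolding baseT_def using rep_addT[OF rep_oriented[OF Inner(2), of "fl T"], of "pg T" "pc T"] unfolding B .
  moreover have "sim (glue ?bs) c"
  proof -
    have "bs \<noteq> []" using ok by (auto simp: okl_def)
    then show ?thesis
      using Inner ok by (auto simp: sim_def orient_def cval_addc okl_mirc cval_mirc cf_addc fun_eq_iff simp del: map_map)
  qed
  moreover have "length ?bs \<le> n" using Inner by (simp add: orient_def)
  ultimately show ?thesis using that[of c h' ?bs] Inner by auto
qed (use assms(2) in auto)

lemma rep_LeafE: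
  assumes "rep n h T cs" "kids T = Leaf"
  obtains "cs = [linc (xl T) (yl T) (xr T) (mc T)]" "h = 0" "xl T \<le> xr T"
    "yr T = yl T + mc T * (xr T - xl T)"
  using assms(1)
proof (cases rule: rep.cases)
  case Leaf
  have "xl T \<le> xr T" using Leaf by (auto simp: hdr_def dest: okc_le)
  with Leaf show ?thesis by (intro that) (auto simp: hdr_def cf_linc)
qed (use assms(2) in auto)

section \<open>Heights, rebalancing and joining\<close>

lemma rep_length: "rep n h T cs \<Longrightarrow> 2 ^ (h div 2) \<le> length cs"
proof (induction rule: rep.induct)
  case (Branch n hl l ls hr r rs T h ds cs)
  have len: "length cs = length ls + length rs"
    using Branch by (simp add: orient_def)
  have pos: "1 \<le> length ls" "1 \<le> length rs"
    using Branch.IH by (auto intro: order_trans[rotated])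
  show ?case
  proof (cases "h \<le> 1")
    case True
    then have "h div 2 = 0" by simp
    with len pos show ?thesis by simp
  next
    case False
    \<comment> \<open>Both children have height at least \<open>h - 2\<close>, so two levels double
      the number of chains.\<close>
    then have *: "h div 2 - 1 \<le> hl div 2" "h div 2 - 1 \<le> hr div 2" "h div 2 = Suc (h div 2 - 1)"
      using Branch(3,4,7) by auto
    then have "2 ^ (h div 2 - 1) \<le> length ls" "2 ^ (h div 2 - 1) \<le> length rs"
      using Branch.IH by (meson order_trans power_increasing one_le_numeral)+
    with len have "2 * 2 ^ (h div 2 - 1) \<le> length cs" by simp
    with *(3) show ?thesis by (metis power_Suc)
  qed
qed simp_all

lemma wpE:
  assumes "wp vs e Q"
  obtains v t where "eval prog vs e v t" "Q v t"
  using assms unfolding wp_def by blast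

lemma eval_kidl: "kids T = Branch l r \<Longrightarrow> eval prog [enc T] (prog ! 14) (enc (getkT T (if fl T < 0 then r else l))) 844"
  using wp_kidl[of T l r "\<lambda>v t. v = enc (getkT T (if fl T < 0 then r else l)) \<and> t = 844"] by (auto simp: wp_def)

lemma eval_kidr: "kids T = Branch l r \<Longrightarrow> eval prog [enc T] (prog ! 15) (enc (getkT T (if fl T < 0 then l else r))) 844"
  using wp_kidr[of T l r "\<lambda>v t. v = enc (getkT T (if fl T < 0 then l else r)) \<and> t = 844"] by (auto simp: wp_def)

lemma rep_splitE:
  assumes "rep n h T cs" "0 < h"
  obtains L R hl hr ls rs k k' where "kids T = Branch k k'"
    "eval prog [enc T] (prog ! 14) (enc L) 844" "eval prog [enc T] (prog ! 15) (enc R) 844"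
    "rep n hl L ls" "rep n hr R rs" "cs = ls @ rs" "h = Suc (max hl hr)" "hl \<le> Suc hr" "hr \<le> Suc hl"
    "okl cs" "ls \<noteq> []" "rs \<noteq> []"
proof -
  obtain k k' where k: "kids T = Branch k k'"
    using assms by (cases rule: rep.cases) auto
  show ?thesis
    by (rule rep_BranchE[OF assms(1) k], rule that[OF k eval_kidl[OF k] eval_kidr[OF k]])
qed

text \<open>AVL rotations, with only the right side ever too tall, since \<open>wp_join\<close>
  reduces the mirror case to this one. The exact height in the absence of a rotation is what
  \<open>wp_joinr\<close> needs to see that a join never loses height.\<close>

lemma wp_bal:
  assumes l: "rep n hl l ls" and r: "rep n hr r rs" and ok: "okl (ls @ rs)"
    and h: "hr \<le> hl + 2" "hl \<le> Suc hr"
  shows "wp [enc l, enc r] (prog ! 18) (\<lambda>v t. \<exists>T h. v = enc T \<and> rep n h T (ls @ rs) \<and>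
    (h = max hl hr \<or> h = Suc (max hl hr)) \<and> (hr \<le> Suc hl \<longrightarrow> h = Suc (max hl hr)) \<and> t \<le> 5000)"
proof (cases "hr \<le> Suc hl")
  case True
  then show ?thesis
    unfolding prog_nth(19) balB_def using rep_ht[OF l] rep_ht[OF r] rep_nodeT[OF l r h(2) True ok]
    by (auto simp del: okl_simps)
next
  case False
  with h have hr: "hr = hl + 2" by simp
  have ls: "ls \<noteq> []" using rep_hdr[OF l] by (simp add: hdr_def okl_def)
  have "0 < hr" using hr by simp
  obtain L R a b as bs k k' where Rk: "kids r = Branch k k'" and R: "eval prog [enc r] (prog ! 14) (enc L) 844"
    "eval prog [enc r] (prog ! 15) (enc R) 844"
    "rep n a L as" "rep n b R bs" "rs = as @ bs" "hr = Suc (max a b)" "a \<le> Suc b" "b \<le> Suc a"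
    "okl rs" "as \<noteq> []" "bs \<noteq> []"
    by (rule rep_splitE[OF r \<open>0 < hr\<close>], rule that)
  have ok1: "okl (ls @ as)" using ok ls R by (auto simp: okl_append)
  note ht = rep_ht[OF l] rep_ht[OF r] rep_ht[OF R(3)] rep_ht[OF R(4)]
  show ?thesis
  \<comment> \<open>A double rotation if the inner grandchild is strictly taller, otherwise a single
    one.\<close>
  proof (cases "b < a")
    case True
    with R hr have ab: "a = Suc hl" "b = hl" by auto
    have "0 < a" using True by simp
    obtain L' R' c d cs ds k k' where Lk: "kids L = Branch k k'" and L: "eval prog [enc L] (prog ! 14) (enc L') 844"
      "eval prog [enc L] (prog ! 15) (enc R') 844"
      "rep n c L' cs" "rep n d R' ds" "as = cs @ ds" "a = Suc (max c d)" "c \<le> Suc d" "d \<le> Suc c"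
      "okl as" "cs \<noteq> []" "ds \<noteq> []"
      by (rule rep_splitE[OF R(3) \<open>0 < a\<close>], rule that)
    have ok': "okl (ls @ cs)" "okl (ds @ bs)" "okl ((ls @ cs) @ ds @ bs)"
      using ok ls R L by (auto simp: okl_append)
    have cd: "c \<le> hl" "d \<le> hl" "hl \<le> Suc c" "hl \<le> Suc d"
      using L(6-8) ab by arith+
    then have m: "max hl c = hl" "max d b = hl" using ab by auto
    have 1: "rep n (Suc hl) (nodeT l L') (ls @ cs)"
      using rep_nodeT[OF l L(3) _ _ ok'(1)] cd m by simp
    have 2: "rep n (Suc hl) (nodeT R' R) (ds @ bs)"
      using rep_nodeT[OF L(4) R(4) _ _ ok'(2)] cd m ab by simp
    have "rep n hr (nodeT (nodeT l L') (nodeT R' R)) (ls @ rs)"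
      using rep_nodeT[OF 1 2 _ _ ok'(3)] R(5) L(5) hr by simp
    moreover have "ht R < ht L" "1 + ht l < ht r"
      using ht hr ab by simp_all
    ultimately show ?thesis
      unfolding prog_nth(19) balB_def
      by (simp add: R(1,2)[THEN wp_det] L(1,2)[THEN wp_det], intro exI[of _ "nodeT (nodeT l L') (nodeT R' R)"] conjI refl exI[of _ hr])
        (use hr in auto)
  next
    case False
    with R hr have b: "b = Suc hl" "a = hl \<or> a = Suc hl" by auto
    then have m: "max hl a = a" "max (Suc a) b = Suc a"
      and b1: "hl \<le> Suc a" "a \<le> Suc hl" "Suc a \<le> Suc b" "b \<le> Suc (Suc a)" by auto
    have ok2: "okl ((ls @ as) @ bs)" using ok R(5) by simp
    have 1: "rep n (Suc a) (nodeT l L) (ls @ as)"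
      using rep_nodeT[OF l R(3) b1(1,2) ok1] unfolding m .
    have 2: "rep n (Suc (Suc a)) (nodeT (nodeT l L) R) (ls @ rs)"
      using rep_nodeT[OF 1 R(4) b1(3,4) ok2] unfolding m R(5) by simp
    have "\<not> ht R < ht L" "1 + ht l < ht r"
      using ht hr False by simp_all
    then show ?thesis
      unfolding prog_nth(19) balB_def
      by (simp add: R(1,2)[THEN wp_det], intro exI[of _ "nodeT (nodeT l L) R"] conjI refl exI[of _ "Suc (Suc a)"] 2)
        (use b hr in auto)
  qed
qed

text \<open>Descends the right spine of the left tree until the heights match; each level of the way
  back costs one rebalancing step.\<close>

lemma wp_joinr:
  assumes "rep n hl l ls" "rep n hr r rs" "okl (ls @ rs)" "hr \<le> Suc hl"
  shows "wp [enc l, enc r] (prog ! 19) (\<lambda>v t. \<exists>T h. v = enc T \<and> rep n h T (ls @ rs) \<and>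
    (h = max hl hr \<or> h = Suc (max hl hr)) \<and> t \<le> 8000 * (hl + 1))"
  using assms
proof (induction hl arbitrary: l ls rule: less_induct)
  case (less hl)
  note ht = rep_ht[OF less.prems(1)] rep_ht[OF less.prems(2)]
  show ?case
  proof (cases "hl \<le> Suc hr")
    case True
    then show ?thesis
      unfolding prog_nth(20) joinrB_def
      using ht rep_nodeT[OF less.prems(1,2) True less.prems(4,3)] by auto
  next
    case False
    then have "0 < hl" by simp
    obtain L R a b as bs k k' where Kk: "kids l = Branch k k'" and K: "eval prog [enc l] (prog ! 14) (enc L) 844"
      "eval prog [enc l] (prog ! 15) (enc R) 844"
      "rep n a L as" "rep n b R bs" "ls = as @ bs" "hl = Suc (max a b)" "a \<le> Suc b" "b \<le> Suc a"
      "okl ls" "as \<noteq> []" "bs \<noteq> []"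
      by (rule rep_splitE[OF less.prems(1) \<open>0 < hl\<close>], rule that)
    have rs: "rs \<noteq> []" using rep_hdr[OF less.prems(2)] by (simp add: hdr_def okl_def)
    have ok: "okl (bs @ rs)" "okl (as @ bs @ rs)"
      using less.prems(3) K rs by (auto simp: okl_append)
    have "hr \<le> b" using False K by auto
    have "wp [enc R, enc r] (prog ! 19) (\<lambda>v t. \<exists>T h. v = enc T \<and> rep n h T (bs @ rs) \<and>
      (h = max b hr \<or> h = Suc (max b hr)) \<and> t \<le> 8000 * (b + 1))"
      using K \<open>hr \<le> b\<close> less.prems ok by (intro less.IH) auto
    then obtain T h t where 1: "eval prog [enc R, enc r] (prog ! 19) (enc T) t"
      "rep n h T (bs @ rs)" "h = b \<or> h = Suc b" "t \<le> 8000 * (b + 1)"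
      using \<open>hr \<le> b\<close> by (elim wpE) (auto simp: max_absorb1)
    have "wp [enc L, enc T] (prog ! 18) (\<lambda>v t. \<exists>T h'. v = enc T \<and> rep n h' T (as @ bs @ rs) \<and>
      (h' = max a h \<or> h' = Suc (max a h)) \<and> (h \<le> Suc a \<longrightarrow> h' = Suc (max a h)) \<and> t \<le> 5000)"
      using K 1 by (intro wp_bal[OF K(3) 1(2) ok(2)]) auto
    then obtain T' h' t' where 2: "eval prog [enc L, enc T] (prog ! 18) (enc T') t'"
      "rep n h' T' (as @ bs @ rs)" "h' = max a h \<or> h' = Suc (max a h)"
      "h \<le> Suc a \<longrightarrow> h' = Suc (max a h)" "t' \<le> 5000"
      by (elim wpE) auto
    \<comment> \<open>A height of only \<open>hl - 1\<close> would require a rotation, that is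
      \<open>h \<ge> a + 2\<close>, hence \<open>a \<le> hl - 3\<close>, against the balance of
      \<open>a\<close> and \<open>b\<close>.\<close>
    have "h' = hl \<or> h' = Suc hl"
      using 1(3) 2(3,4) K(6-8) by (auto simp: max_def split: if_splits)
    moreover have "max hl hr = hl" using False by simp
    moreover have "t + t' + 3000 \<le> 8000 * (hl + 1)"
      using 1(4) 2(5) K(6) by (auto simp: max_def split: if_splits)
    ultimately show ?thesis
      unfolding prog_nth(20) joinrB_def using ht False 2(2) K(5)
      by (simp add: K(1,2)[THEN wp_det] 1(1)[THEN wp_det] 2(1)[THEN wp_det]) auto
  qed
qed

text \<open>A taller right tree is reduced to a taller left one by reflecting both trees and the
  result, in constant extra time.\<close>

lemma wp_join:
  assumes l: "rep n hl l ls" and r: "rep n hr r rs" and ok: "okl (ls @ rs)"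
  shows "wp [enc l, enc r] (prog ! 20) (\<lambda>v t. \<exists>T h. v = enc T \<and> rep n h T (ls @ rs) \<and>
    h \<le> Suc (max hl hr) \<and> t \<le> 8000 * (max hl hr + 2))"
proof (cases "hl < hr")
  case False
  have "wp [enc l, enc r] (prog ! 19) (\<lambda>v t. \<exists>T h. v = enc T \<and> rep n h T (ls @ rs) \<and>
    (h = max hl hr \<or> h = Suc (max hl hr)) \<and> t \<le> 8000 * (hl + 1))"
    using False by (intro wp_joinr[OF l r ok]) auto
  then obtain T h t where "eval prog [enc l, enc r] (prog ! 19) (enc T) t"
    "rep n h T (ls @ rs)" "h = max hl hr \<or> h = Suc (max hl hr)" "t \<le> 8000 * (hl + 1)"
    by (elim wpE) auto
  with False show ?thesis
    unfolding prog_nth(21) joinB_def using rep_ht[OF l] rep_ht[OF r]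
    by (simp add: max_def wp_det) (auto intro!: exI[of _ T])
next
  case True
  have ne: "ls \<noteq> []" "rs \<noteq> []"
    using rep_hdr[OF l] rep_hdr[OF r] by (auto simp: hdr_def okl_def)
  let ?m = "\<lambda>cs. map mirc (rev cs)"
  have "okl (?m rs @ ?m ls)"
    using okl_mirc[OF ok] by simp
  then have "wp [enc (mirT r), enc (mirT l)] (prog ! 19) (\<lambda>v t. \<exists>T h. v = enc T \<and> rep n h T (?m rs @ ?m ls) \<and>
    (h = max hr hl \<or> h = Suc (max hr hl)) \<and> t \<le> 8000 * (hr + 1))"
    using True by (intro wp_joinr rep_mirT l r) auto
  then obtain T h t where 1: "eval prog [enc (mirT r), enc (mirT l)] (prog ! 19) (enc T) t"
    "rep n h T (?m rs @ ?m ls)" "h = max hr hl \<or> h = Suc (max hr hl)" "t \<le> 8000 * (hr + 1)"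
    by (elim wpE) auto
  have "map mirc (rev (?m rs @ ?m ls)) = ls @ rs"
    by (simp add: rev_map comp_def)
  with rep_mirT[OF 1(2)] have "rep n h (mirT T) (ls @ rs)" by simp
  with True 1(3,4) show ?thesis
    unfolding prog_nth(21) joinB_def using rep_ht[OF l] rep_ht[OF r]
    by (simp add: max_def 1(1)[THEN wp_det]) (auto intro!: exI[of _ "mirT T"])
qed

lemma wp_join_Nil [simp]:
  "wp [NilV, u] (prog ! 20) Q \<longleftrightarrow> Q u 3"
  "wp [enc T, NilV] (prog ! 20) Q \<longleftrightarrow> Q (enc T) 5"
  unfolding prog_nth(21) joinB_def by simp_all

definition repo :: "nat \<Rightarrow> nat \<Rightarrow> tree option \<Rightarrow> chain list \<Rightarrow> bool" where
  "repo n H To cs \<longleftrightarrow> (case To of None \<Rightarrow> cs = [] | Some T \<Rightarrow> \<exists>h\<le>H. rep n h T cs)"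

lemma repo_simps [simp]:
  "repo n H None cs \<longleftrightarrow> cs = []"
  "repo n H (Some T) cs \<longleftrightarrow> (\<exists>h\<le>H. rep n h T cs)"
  by (simp_all add: repo_def)

lemma rep_not_Nil [simp]: "\<not> rep n h T []"
  using rep_hdr[of n h T "[]"] by (auto simp: hdr_def)

lemma wp_joino:
  assumes a: "repo n H a as" and b: "repo n H b bs" and ok: "as @ bs \<noteq> [] \<Longrightarrow> okl (as @ bs)"
  shows "wp [enco a, enco b] (prog ! 20) (\<lambda>v t. \<exists>T. v = enco T \<and> repo n (Suc H) T (as @ bs) \<and>
    t \<le> 8000 * (H + 2))"
proof (cases a)
  case None
  then show ?thesis using a b by (cases b) (auto intro!: exI[of _ b] le_SucI)
next
  case a: (Some x)
  show ?thesis
  proof (cases b)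
    case None
    then show ?thesis using assms a by (auto intro!: exI[of _ "Some x"] le_SucI)
  next
    case (Some y)
    with assms a obtain h k where hk: "h \<le> H" "k \<le> H" "rep n h x as" "rep n k y bs" by auto
    then have "as @ bs \<noteq> []" by auto
    from wp_join[OF hk(3,4) ok[OF this]] obtain T j t where 1:
      "eval prog [enc x, enc y] (prog ! 20) (enc T) t"
      "rep n j T (as @ bs)" "j \<le> Suc (max h k)" "t \<le> 8000 * (max h k + 2)"
      by (elim wpE) auto
    have "j \<le> Suc H" "t \<le> 8000 * (H + 2)" using 1(3,4) hk(1,2) by auto
    with 1(2) a Some show ?thesis
      by (auto intro!: exI[of _ "Some T"] exI[of _ j] simp: 1(1)[THEN wp_det])
  qed
qed

section \<open>Materialising caps and splitting\<close>

lemma adj_iff: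
  assumes "okl ls" "okl rs"
  shows "adj (last ls) (hd rs) \<longleftrightarrow> cvl ls = cul rs \<and> cval ls (cvl ls) = cval rs (cul rs)"
  using assms by (simp add: adj_def cval_hd cval_last)

lemma okl_appendI:
  assumes "okl ls" "okl rs" "cvl ls = cul rs" "cval ls (cvl ls) = cval rs (cul rs)"
  shows "okl (ls @ rs)"
  using assms adj_iff[OF assms(1,2)] okl_append[of ls rs] by (auto simp: okl_def)

lemma okl_appendD:
  assumes "okl (ls @ rs)" "ls \<noteq> []" "rs \<noteq> []"
  shows "okl ls" "okl rs" "cvl ls = cul rs" "cval ls (cvl ls) = cval rs (cul rs)"
  using assms okl_append[of ls rs] adj_iff[of ls rs] by auto

lemma affine_nonneg:
  fixes p q x :: real
  assumes "x1 \<le> x" "x \<le> x2" "0 \<le> p + q * x1" "0 \<le> p + q * x2"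
  shows "0 \<le> p + q * x"
proof (cases "0 \<le> q")
  case True
  then have "q * x1 \<le> q * x" using assms by (intro mult_left_mono) auto
  with assms show ?thesis by simp
next
  case False
  then have "q * x2 \<le> q * x" using assms by (intro mult_left_mono_neg) auto
  with assms show ?thesis by simp
qed

text \<open>\<open>u\<close> and \<open>w\<close> are the heights of a linear piece over the cap
  line at its two ends. If \<open>u = w\<close>, both vanish, and x / 0 = 0 gives
  \<open>xc = x1\<close>, which still lies on the line.\<close>

lemma crossing:
  fixes u s :: real
  assumes "x1 \<le> x2" "0 \<le> u" "w \<le> 0" "w = u + s * (x2 - x1)"
    and xc: "xc = x1 + u * (x2 - x1) / (u - w)"
  shows "x1 \<le> xc" "xc \<le> x2" "u + s * (xc - x1) = 0"
proof -
  have 0: "0 \<le> u * (x2 - x1) / (u - w)"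
    using assms(1-3) by (intro divide_nonneg_nonneg mult_nonneg_nonneg) auto
  then show "x1 \<le> xc" using xc by simp
  show "u + s * (xc - x1) = 0"
  proof (cases "u = w")
    case False
    have "s * (xc - x1) = (s * (x2 - x1)) * u / (u - w)"
      unfolding xc by simp
    also have "s * (x2 - x1) = w - u" using assms by simp
    also have "(w - u) * u / (u - w) = - u" using False by (simp add: field_simps)
    finally show ?thesis by simp
  qed (use assms in auto)
  show "xc \<le> x2"
  proof (cases "u = w")
    case False
    then have "w < u" using assms(2,3) by linarith
    then have "u / (u - w) \<le> 1" using assms(2,3) by (simp add: pos_divide_le_eq)
    then have "u / (u - w) * (x2 - x1) \<le> 1 * (x2 - x1)" using assms by (intro mult_right_mono) auto
    then show ?thesis using xc by simp
  qed (use assms in auto)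
qed

text \<open>The cap may start to the left of the first piece: \<open>xa\<close> is the chain's own
  end when a cap is materialised, and the left end of the swallowed chain in a merge.\<close>

definition capped :: "chain list \<Rightarrow> real \<Rightarrow> real \<Rightarrow> real \<Rightarrow> chain list \<Rightarrow> bool" where
  "capped bs xa ya a bs' \<longleftrightarrow> cul bs' = xa \<and> cvl bs' = cvl bs \<and>
    (\<forall>x. xa \<le> x \<longrightarrow> x \<le> cvl bs \<longrightarrow> cval bs' x =
      (if x < cul bs then ya + a * (x - xa) else min (cval bs x) (ya + a * (x - xa))))"

text \<open>The piece contains the crossing and is cut there. The first new piece is the cap line,
  reaching back to \<open>xa\<close>; either piece may be a single point.\<close>

lemma wp_capl_leaf:
  assumes T: "rep 0 0 T bs" "kids T = Leaf"
    and pre: "xa \<le> cul bs" "ya + a * (cul bs - xa) \<le> cval bs (cul bs)"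
      "cval bs (cvl bs) \<le> ya + a * (cvl bs - xa)"
  shows "wp [enc T, RealV xa, RealV ya, RealV a] (prog ! 21) (\<lambda>v t. \<exists>T' bs'. v = enc T' \<and>
    rep 0 1 T' bs' \<and> length bs' = 2 \<and> capped bs xa ya a bs' \<and> t \<le> 1000)"
proof -
  obtain bs: "bs = [linc (xl T) (yl T) (xr T) (mc T)]" and le: "xl T \<le> xr T"
    and yr: "yr T = yl T + mc T * (xr T - xl T)"
    using T by (elim rep_LeafE) auto
  define u where "u = yl T - (ya + a * (xl T - xa))"
  define w where "w = yr T - (ya + a * (xr T - xa))"
  define xc where "xc = xl T + u * (xr T - xl T) / (u - w)"
  define yc where "yc = ya + a * (xc - xa)"
  have xa: "xa \<le> xl T" using pre bs by simp
  have uw: "0 \<le> u" "w \<le> 0" "w = u + (mc T - a) * (xr T - xl T)"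
    using pre bs le yr by (simp_all add: u_def w_def cf_linc algebra_simps)
  note xc = crossing[OF le uw xc_def]
  have line: "yl T + mc T * (x - xl T) - (ya + a * (x - xa)) = (u - (mc T - a) * xl T) + (mc T - a) * x" for x
    by (simp add: u_def algebra_simps)
  have yc: "yc = yl T + mc T * (xc - xl T)"
    using xc(3) line[of xc] by (simp add: yc_def algebra_simps)
  let ?c = "linc xa ya xc ((yc - ya) / (xc - xa))" and ?d = "linc xc yc (xr T) ((yr T - yc) / (xr T - xc))"
  have c: "rep 0 0 (linT xa ya xc yc) [?c]"
    using xa xc by (intro rep_linT) (auto simp: yc_def)
  have d: "rep 0 0 (linT xc yc (xr T) (yr T)) [?d]"
    using xc yr yc by (intro rep_linT) auto
  have cx: "cf ?c x = ya + a * (x - xa)" if "xa \<le> x" "x \<le> xc" for x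
    using that by (cases "xc = xa") (auto simp: cf_linc yc_def)
  have dx: "cf ?d x = yl T + mc T * (x - xl T)" if "xc \<le> x" "x \<le> xr T" for x
  proof (cases "xc = xr T")
    case False
    have "yr T - yc = mc T * (xr T - xc)" using yr yc by (simp add: algebra_simps)
    with False have "(yr T - yc) / (xr T - xc) = mc T" by simp
    with that yc show ?thesis by (simp add: cf_linc algebra_simps)
  qed (use that yc in \<open>auto simp: cf_linc\<close>)
  have ok: "okl ([?c] @ [?d])"
    using rep_hdr[OF c] rep_hdr[OF d] xa xc cx[of xc] yc_def by (auto simp: hdr_def adj_def cf_linc)
  have rep: "rep 0 1 (nodeT (linT xa ya xc yc) (linT xc yc (xr T) (yr T))) [?c, ?d]"
    using rep_nodeT[OF c d _ _ ok] by (simp add: One_nat_def)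
  have "capped bs xa ya a [?c, ?d]"
  proof -
    have "cval [?c, ?d] x = (if x < xl T then ya + a * (x - xa) else
        min (yl T + mc T * (x - xl T)) (ya + a * (x - xa)))" if x: "xa \<le> x" "x \<le> xr T" for x
    proof (cases "x \<le> xc")
      case True
      have "0 \<le> (u - (mc T - a) * xl T) + (mc T - a) * x" if "xl T \<le> x"
        using that True uw(1) xc(3) by (intro affine_nonneg[of "xl T" x xc]) (auto simp: algebra_simps)
      then show ?thesis using True cx[of x] x line[of x] by auto
    next
      case False
      have "0 \<le> - (u - (mc T - a) * xl T) + - (mc T - a) * x"
        using x False uw(2,3) xc(3) by (intro affine_nonneg[of xc x "xr T"]) (auto simp: algebra_simps)
      then have "yl T + mc T * (x - xl T) \<le> ya + a * (x - xa)"
        using line[of x] by (simp add: algebra_simps)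
      then show ?thesis using False dx[of x] x xc(1) by (simp add: min_absorb1)
    qed
    then show ?thesis using bs by (auto simp: capped_def cf_linc)
  qed
  with rep show ?thesis
    unfolding prog_nth(22) caplB_def
    by (simp add: T(2) u_def[symmetric] w_def[symmetric] xc_def[symmetric] yc_def[symmetric])
      (intro exI[of _ "nodeT (linT xa ya xc yc) (linT xc yc (xr T) (yr T))"] conjI refl exI[of _ "[?c, ?d]"], simp_all)
qed

text \<open>The difference of consecutive squares, \<open>2 * h + 3\<close>, pays for a join of cost
  linear in \<open>h\<close> at each level of a recursion.\<close>

lemma square_step:
  fixes k h c :: nat
  assumes "k < h"
  shows "c * (k + 2)\<^sup>2 + c * (2 * h + 3) \<le> c * (h + 2)\<^sup>2"
proof -
  have "(k + 2)\<^sup>2 \<le> (h + 1)\<^sup>2"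
    using assms by (intro power_mono) auto
  then have "(k + 2)\<^sup>2 + (2 * h + 3) \<le> (h + 2)\<^sup>2"
    by (simp add: power2_eq_square algebra_simps)
  then have "c * ((k + 2)\<^sup>2 + (2 * h + 3)) \<le> c * (h + 2)\<^sup>2"
    by (rule mult_le_mono2)
  then show ?thesis by (simp add: distrib_left)
qed

text \<open>An inner tree would have to hold at most 0 pieces, so for \<open>n = 0\<close> every
  chain is linear. This is how the inner trees themselves are described.\<close>

lemma rep0_kids:
  assumes "rep 0 h T bs"
  shows "h = 0 \<longleftrightarrow> kids T = Leaf"
  using assms
proof (cases rule: rep.cases)
  case (Inner h' B bs' c)
  then show ?thesis by auto
qed auto

text \<open>Binary search for the crossing of a concave function that starts above the line and ends
  below it. If the left subtree ends below the line, so does everything to its right, and the right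
  subtree is kept; otherwise the left subtree lies above the line and is dropped. The recursion
  keeps the original start \<open>(xa, ya)\<close>, so a single piece covers all that was
  dropped.\<close>

lemma wp_capl:
  assumes "rep 0 h T bs" "conc (cul bs) (cvl bs) (cval bs)"
    and "xa \<le> cul bs" "ya + a * (cul bs - xa) \<le> cval bs (cul bs)"
      "cval bs (cvl bs) \<le> ya + a * (cvl bs - xa)"
  shows "wp [enc T, RealV xa, RealV ya, RealV a] (prog ! 21) (\<lambda>v t. \<exists>T' h' bs'. v = enc T' \<and>
    rep 0 h' T' bs' \<and> h' \<le> Suc h \<and> length bs' \<le> Suc (length bs) \<and> capped bs xa ya a bs' \<and>
    t \<le> 20000 * (h + 2)\<^sup>2)"
  using assms
proof (induction h arbitrary: T bs rule: less_induct)
  case (less h)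
  let ?l = "\<lambda>x. ya + a * (x - xa)"
  have l: "?l x = (ya - a * xa) + a * x" for x by (simp add: algebra_simps)
  show ?case
  proof (cases "h = 0")
    case True
    then have k: "kids T = Leaf" using rep0_kids[OF less.prems(1)] by simp
    have "bs \<noteq> []" using rep_hdr[OF less.prems(1)] by (auto simp: hdr_def)
    then have len: "2 \<le> Suc (length bs)" by (cases bs) auto
    have "wp [enc T, RealV xa, RealV ya, RealV a] (prog ! 21) (\<lambda>v t. \<exists>T' bs'. v = enc T' \<and>
      rep 0 1 T' bs' \<and> length bs' = 2 \<and> capped bs xa ya a bs' \<and> t \<le> 1000)"
      using less.prems True k by (intro wp_capl_leaf) auto
    then obtain T' bs' t where "eval prog [enc T, RealV xa, RealV ya, RealV a] (prog ! 21) (enc T') t"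
      "rep 0 1 T' bs'" "length bs' = 2" "capped bs xa ya a bs'" "t \<le> 1000"
      by (elim wpE) auto
    with True len show ?thesis
      by (simp add: wp_det) (intro exI[of _ T'] conjI refl exI[of _ 1] exI[of _ bs'], auto simp: power2_eq_square)
  next
    case False
    then have "0 < h" by simp
    obtain L R hl hr ls rs k k' where Kk: "kids T = Branch k k'" and K: "eval prog [enc T] (prog ! 14) (enc L) 844"
      "eval prog [enc T] (prog ! 15) (enc R) 844" "rep 0 hl L ls" "rep 0 hr R rs" "bs = ls @ rs"
      "h = Suc (max hl hr)" "hl \<le> Suc hr" "hr \<le> Suc hl" "okl bs" "ls \<noteq> []" "rs \<noteq> []"
      by (rule rep_splitE[OF less.prems(1) \<open>0 < h\<close>], rule that)
    note ok = okl_appendD[OF K(9)[unfolded K(5)] K(10,11)]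
    have rng: "cul ls \<le> cvl ls" "cul rs \<le> cvl rs" using okl_range[OF ok(1)] okl_range[OF ok(2)] by auto
    have F1: "cval bs x = cval ls x" if "x \<le> cvl ls" for x
      using cval_append1[of ls rs x] that K by simp
    have F2: "cval bs x = cval rs x" if "cvl ls \<le> x" for x
      using cval_append2[of ls rs x] that K ok(3) by simp
    have ends: "cul bs = cul ls" "cvl bs = cvl rs" using K by simp_all
    have yr: "yr L = cval ls (cvl ls)" "xr L = cvl ls" using hdrD(9,10)[OF rep_hdr[OF K(3)]] by auto
    have concL: "conc (cul ls) (cvl ls) (cval ls)"
      by (rule conc_cong[OF conc_mono[OF less.prems(2)]]) (use ends rng ok(3) F1 in auto)
    have concR: "conc (cul rs) (cvl rs) (cval rs)"
      by (rule conc_cong[OF conc_mono[OF less.prems(2)]]) (use ends rng ok(3) F2 in auto)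
    have sq: "20000 * (k + 2)\<^sup>2 + 8000 * (h + 3) + 5000 \<le> 20000 * (h + 2)\<^sup>2" if "k < h" for k
      using square_step[OF that, of 20000] by simp
    have hlr: "hl < h" "hr < h" using K(6) by auto
    show ?thesis
    proof (cases "yr L < ?l (xr L)")
      case True
      have "wp [enc L, RealV xa, RealV ya, RealV a] (prog ! 21) (\<lambda>v t. \<exists>T' h' bs'. v = enc T' \<and>
        rep 0 h' T' bs' \<and> h' \<le> Suc hl \<and> length bs' \<le> Suc (length ls) \<and> capped ls xa ya a bs' \<and>
        t \<le> 20000 * (hl + 2)\<^sup>2)"
        by (rule less.IH[OF hlr(1) K(3) concL]) (use True yr less.prems(3,4) ends F1[of "cul ls"] rng in auto)
      then obtain T' h' bs' t where 1: "eval prog [enc L, RealV xa, RealV ya, RealV a] (prog ! 21) (enc T') t"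
        "rep 0 h' T' bs'" "h' \<le> Suc hl" "length bs' \<le> Suc (length ls)" "capped ls xa ya a bs'"
        "t \<le> 20000 * (hl + 2)\<^sup>2"
        by (elim wpE) auto
      have ok': "okl bs'" using rep_hdr[OF 1(2)] by (auto simp: hdr_def)
      have c: "cul bs' = xa" "cvl bs' = cvl ls" "\<And>x. xa \<le> x \<Longrightarrow> x \<le> cvl ls \<Longrightarrow>
        cval bs' x = (if x < cul ls then ?l x else min (cval ls x) (?l x))"
        using 1(5) by (auto simp: capped_def)
      have m: "xa \<le> cvl ls" using less.prems(3) ends rng by simp
      have ok2: "okl (bs' @ rs)"
        by (rule okl_appendI[OF ok' ok(2)]) (use c(2) c(3)[OF m] ok(3,4) True yr rng in auto)
      from wp_join[OF 1(2) K(4) ok2] obtain T2 h2 t2 where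
        2: "eval prog [enc T', enc R] (prog ! 20) (enc T2) t2" "rep 0 h2 T2 (bs' @ rs)"
        "h2 \<le> Suc (max h' hr)" "t2 \<le> 8000 * (max h' hr + 2)"
        by (elim wpE) auto
      have max: "max h' hr \<le> h" using 1(3) hlr by auto
      \<comment> \<open>\<open>conc_below\<close> needs two distinct points: the line is at or below
        the chain at the first one and strictly above it at the second.\<close>
      have lt: "cul ls < cvl ls"
        using True yr rng less.prems(4) ends F1[of "cul ls"] by (cases "cul ls = cvl ls") auto
      have below: "cval bs x \<le> ?l x" if "cvl ls \<le> x" "x \<le> cvl rs" for x
        unfolding l by (rule conc_below[OF less.prems(2), of "cul ls" "cvl ls"])
          (use that ends lt less.prems(4) F1[of "cvl ls"] True yr l in auto)
      have "capped bs xa ya a (bs' @ rs)"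
      proof -
        have ne: "bs' \<noteq> []" using ok' by (auto simp: okl_def)
        have "cval (bs' @ rs) x = (if x < cul bs then ?l x else min (cval bs x) (?l x))"
          if x: "xa \<le> x" "x \<le> cvl rs" for x
        proof (cases "x \<le> cvl ls")
          case True
          then show ?thesis
            using cval_append1[OF ok2 ne, of x] c(2) c(3)[of x] x F1[of x] ends by simp
        next
          case False
          then show ?thesis
            using cval_append2[OF ok2 K(11), of x] ok(3) below[of x] F2[of x] x ends rng by simp
        qed
        with ne K(11) c ends show ?thesis by (simp add: capped_def)
      qed
      moreover have "length (bs' @ rs) \<le> Suc (length bs)" using 1(4) K(5) by simp
      moreover have "h2 \<le> Suc h" using 2(3) max by linarith
      moreover have "t2 \<le> 8000 * (h + 2)"
        using 2(4) max by (meson add_le_mono1 le_trans mult_le_mono2)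
      then have "t + t2 + 5000 \<le> 20000 * (h + 2)\<^sup>2"
        using sq[OF hlr(1)] 1(6) by simp
      ultimately show ?thesis
        unfolding prog_nth(22) caplB_def using True 2(2)
        by (simp add: Kk K(1,2)[THEN wp_det] 1(1)[THEN wp_det] 2(1)[THEN wp_det])
          (intro exI[of _ T2] conjI refl exI[of _ h2] exI[of _ "bs' @ rs"], auto)
    next
      case False
      have above: "?l x \<le> cval bs x" if "cul ls \<le> x" "x \<le> cvl ls" for x
        unfolding l by (rule conc_above[OF less.prems(2), of "cul ls" _ "cvl ls"])
          (use that ends rng less.prems(4) F1[of "cvl ls"] False yr l ok(3) in auto)
      have "wp [enc R, RealV xa, RealV ya, RealV a] (prog ! 21) (\<lambda>v t. \<exists>T' h' bs'. v = enc T' \<and>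
        rep 0 h' T' bs' \<and> h' \<le> Suc hr \<and> length bs' \<le> Suc (length rs) \<and> capped rs xa ya a bs' \<and>
        t \<le> 20000 * (hr + 2)\<^sup>2)"
        by (rule less.IH[OF hlr(2) K(4) concR])
          (use False yr less.prems(3,5) ends ok(3,4) F2[of "cvl rs"] rng in auto)
      then obtain T' h' bs' t where 1: "eval prog [enc R, RealV xa, RealV ya, RealV a] (prog ! 21) (enc T') t"
        "rep 0 h' T' bs'" "h' \<le> Suc hr" "length bs' \<le> Suc (length rs)" "capped rs xa ya a bs'"
        "t \<le> 20000 * (hr + 2)\<^sup>2"
        by (elim wpE) auto
      have c: "cul bs' = xa" "cvl bs' = cvl rs" "\<And>x. xa \<le> x \<Longrightarrow> x \<le> cvl rs \<Longrightarrow>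
        cval bs' x = (if x < cul rs then ?l x else min (cval rs x) (?l x))"
        using 1(5) by (auto simp: capped_def)
      have "capped bs xa ya a bs'"
      proof -
        have "cval bs' x = (if x < cul bs then ?l x else min (cval bs x) (?l x))"
          if x: "xa \<le> x" "x \<le> cvl rs" for x
        proof (cases "x < cvl ls")
          case True
          then show ?thesis using c(3)[OF x] ok(3) above[of x] ends by auto
        next
          case False
          then show ?thesis using c(3)[OF x] ok(3) F2[of x] ends rng by auto
        qed
        with c ends show ?thesis by (simp add: capped_def)
      qed
      moreover have "length bs' \<le> Suc (length bs)" using 1(4) K(5) by simp
      moreover have "h' \<le> Suc h" using 1(3) hlr by simp
      moreover have "t + 5000 \<le> 20000 * (h + 2)\<^sup>2"
        using sq[OF hlr(2)] 1(6) by simp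
      ultimately show ?thesis
        unfolding prog_nth(22) caplB_def using False 1(2)
        by (simp add: Kk K(1,2)[THEN wp_det] 1(1)[THEN wp_det])
          (intro exI[of _ T'] conjI refl exI[of _ h'] exI[of _ bs'], auto)
    qed
  qed
qed

text \<open>The additive constants leave room for the two caps, each of which adds at most one piece
  and one level to a tree of height at most \<open>2 * p\<close>.\<close>

definition mated :: "nat \<Rightarrow> nat \<Rightarrow> chain \<Rightarrow> tree \<Rightarrow> bool" where
  "mated n p c B \<longleftrightarrow> (\<exists>h bs. rep 0 h B bs \<and> sim (glue bs) c \<and> length bs \<le> n + 3 \<and> h \<le> 2 * p + 2)"

lemma rep_height:
  assumes "rep n h T cs" "length cs < 2 ^ p"
  shows "h \<le> 2 * p"
proof -
  have "(2::nat) ^ (h div 2) < 2 ^ p" using rep_length[OF assms(1)] assms(2) by linarith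
  then have "h div 2 < p" by (rule power_less_imp_less_exp[rotated]) simp
  then show ?thesis by simp
qed

lemma wp_mat_Leaf:
  assumes "rep n 0 T [c]" "kids T = Leaf"
  shows "wp [enc T] (prog ! 22) (\<lambda>v t. \<exists>B. v = enc B \<and> mated n p c B \<and> t \<le> 100)"
proof -
  have c: "c = linc (xl T) (yl T) (xr T) (mc T)"
    by (rule rep_LeafE[OF assms]) auto
  have ok: "okc c" using rep_hdr[OF assms(1)] by (simp add: hdr_def)
  have "ht T = 0" using rep_ht[OF assms(1)] by simp
  then have "rep 0 0 T [c]"
    using assms rep_hdr[OF assms(1)] c by (intro rep.Leaf) auto
  moreover have "sim (glue [c]) c"
    using ok by (simp add: sim_def cval_single del: cval.simps)
  ultimately have "mated n p c T"
    unfolding mated_def by (intro exI[of _ 0] exI[of _ "[c]"]) auto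
  then show ?thesis
    unfolding prog_nth(23) matB_def using assms by auto
qed

text \<open>The right cap is a left cap of the reflected chain. The two can be applied in turn
  because each keeps both ends, so the second starts at the right point.\<close>

lemma wp_mat_Inner:
  assumes T: "rep n 0 T [c]" and k: "kids T = Inner B" and p: "n < 2 ^ p"
  shows "wp [enc T] (prog ! 22) (\<lambda>v t. \<exists>B. v = enc B \<and> mated n p c B \<and> t \<le> 50000 * (2 * p + 3)\<^sup>2)"
proof -
  obtain c0 d h' bs where c0: "[c] = [capc (sa T) (sb T) c0]" and B: "rep 0 h' (baseT T B) bs"
    and len: "length bs \<le> n" and sim: "sim (glue bs) c0" and ok0: "okc c0"
    and sl: "- sb T \<le> sl c0" "sl c0 \<le> sa T"
    by (rule rep_InnerE[OF T k], rule that)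
  let ?u = "cu c" and ?v = "cv c"
  have c: "c = capc (sa T) (sb T) c0" "cu c0 = ?u" "cv c0 = ?v" using c0 by simp_all
  have bs: "cul bs = ?u" "cvl bs = ?v" "cval bs = cf c0" using sim c(2,3) by (simp_all add: sim_def)
  note cf = cf_capc[OF ok0 sl(2,1), folded c(1), unfolded c(2,3)]
  have okc: "okc c" using okc_capc[OF ok0 sl(2,1)] unfolding c(1) .
  have uv: "?u \<le> ?v" using okc by simp
  note hdr = hdrD[OF rep_hdr[OF T]]
  have y: "yl T = cf c0 ?u" "yr T = cf c0 ?v" "xl T = ?u" "xr T = ?v"
    using hdr(7-10) cf uv by auto
  have end0: "cf c0 ?v = cf c0 ?u + sl c0 * (?v - ?u)" using okc_end[OF ok0] unfolding c(2,3) .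
  \<comment> \<open>As the cap slopes bound the chord slope, each cap line arrives at the opposite
    end at or above the chain, as the search of \<open>wp_capl\<close> requires.\<close>
  have "sl c0 * (?v - ?u) \<le> sa T * (?v - ?u)" "- sb T * (?v - ?u) \<le> sl c0 * (?v - ?u)"
    using sl uv by (auto intro!: mult_right_mono simp del: mult_minus_left)
  with end0 have ends: "cf c0 ?v \<le> cf c0 ?u + sa T * (?v - ?u)" "cf c0 ?u \<le> cf c0 ?v + sb T * (?v - ?u)"
    by simp_all
  have conc0: "conc ?u ?v (cf c0)" using okc_conc[OF ok0] unfolding c(2,3) .
  have h': "h' \<le> 2 * p" using rep_height[OF B] len p by simp
  have "wp [enc (baseT T B), RealV (xl T), RealV (yl T), RealV (sa T)] (prog ! 21) (\<lambda>v t. \<exists>T' h1 bs'. v = enc T' \<and>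
    rep 0 h1 T' bs' \<and> h1 \<le> Suc h' \<and> length bs' \<le> Suc (length bs) \<and> capped bs (xl T) (yl T) (sa T) bs' \<and>
    t \<le> 20000 * (h' + 2)\<^sup>2)"
    by (rule wp_capl[OF B]) (use bs y conc0 ends in auto)
  then obtain T1 h1 bs1 t1 where 1: "eval prog [enc (baseT T B), RealV (xl T), RealV (yl T), RealV (sa T)] (prog ! 21) (enc T1) t1"
    "rep 0 h1 T1 bs1" "h1 \<le> Suc h'" "length bs1 \<le> Suc (length bs)" "capped bs (xl T) (yl T) (sa T) bs1"
    "t1 \<le> 20000 * (h' + 2)\<^sup>2"
    by (elim wpE) auto
  have bs1: "cul bs1 = ?u" "cvl bs1 = ?v" "\<And>x. ?u \<le> x \<Longrightarrow> x \<le> ?v \<Longrightarrow>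
    cval bs1 x = min (cf c0 x) (cf c0 ?u + sa T * (x - ?u))"
    using 1(5) y bs by (auto simp: capped_def)
  have ok1: "okl bs1" using rep_hdr[OF 1(2)] by (simp add: hdr_def)
  have ne1: "bs1 \<noteq> []" using ok1 by auto
  have conc1: "conc ?u ?v (cval bs1)"
  proof (rule conc_cong[OF conc_min[OF conc0 conc_affine[of _ _ "cf c0 ?u - sa T * ?u" "sa T"]]])
    fix x assume "?u \<le> x" "x \<le> ?v"
    moreover have "cf c0 ?u + sa T * (x - ?u) = cf c0 ?u - sa T * ?u + sa T * x"
      by (simp add: algebra_simps)
    ultimately show "cval bs1 x = min (cf c0 x) (cf c0 ?u - sa T * ?u + sa T * x)"
      using bs1(3) by simp
  qed
  let ?m = "map mirc (rev bs1)"
  have m: "cul ?m = - ?v" "cvl ?m = - ?u" "\<And>x. cval ?m x = cval bs1 (- x)"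
    using bs1 ne1 ok1 by (simp_all add: cval_mirc)
  have concm: "conc (cul ?m) (cvl ?m) (cval ?m)"
    unfolding m(1,2) by (rule conc_cong[OF conc_neg[OF conc1]]) (simp only: m(3))
  have "wp [enc (mirT T1), RealV (- xr T), RealV (yr T), RealV (sb T)] (prog ! 21) (\<lambda>v t. \<exists>T' h2 bs'. v = enc T' \<and>
    rep 0 h2 T' bs' \<and> h2 \<le> Suc h1 \<and> length bs' \<le> Suc (length ?m) \<and> capped ?m (- xr T) (yr T) (sb T) bs' \<and>
    t \<le> 20000 * (h1 + 2)\<^sup>2)"
    by (rule wp_capl[OF rep_mirT[OF 1(2)] concm]) (use m y bs1(3)[of ?u] bs1(3)[of ?v] uv ends in auto)
  then obtain T2 h2 bs2 t2 where 2: "eval prog [enc (mirT T1), RealV (- xr T), RealV (yr T), RealV (sb T)] (prog ! 21) (enc T2) t2"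
    "rep 0 h2 T2 bs2" "h2 \<le> Suc h1" "length bs2 \<le> Suc (length ?m)" "capped ?m (- xr T) (yr T) (sb T) bs2"
    "t2 \<le> 20000 * (h1 + 2)\<^sup>2"
    by (elim wpE) auto
  have bs2: "cul bs2 = - ?v" "cvl bs2 = - ?u" "\<And>x. - ?v \<le> x \<Longrightarrow> x \<le> - ?u \<Longrightarrow>
    cval bs2 x = min (cval bs1 (- x)) (cf c0 ?v + sb T * (x + ?v))"
    using 2(5) y unfolding capped_def m by (auto simp: m(3))
  have ok2: "okl bs2" using rep_hdr[OF 2(2)] by (simp add: hdr_def)
  then have ne2: "bs2 \<noteq> []" by auto
  let ?b = "map mirc (rev bs2)"
  have b: "cul ?b = ?u" "cvl ?b = ?v" using ne2 bs2 by simp_all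
  have "cval ?b x = cf c x" for x
  proof (cases "?u \<le> x \<and> x \<le> ?v")
    case True
    then show ?thesis
      using cval_mirc[OF ok2, of x] bs2(3)[of "- x"] bs1(3)[of x] arg_cong[OF c(1), of "\<lambda>c. cf c x"]
      unfolding capc_def cf_restc c(2,3) by (simp add: min.assoc)
  next
    case False
    then have "cval ?b x = 0" using b by (intro cval_out[OF okl_mirc[OF ok2]]) auto
    with False okc show ?thesis by (auto simp: okc_def)
  qed
  then have "sim (glue ?b) c" using b by (auto simp: sim_def)
  then have "mated n p c (mirT T2)"
    unfolding mated_def using rep_mirT[OF 2(2)] 1(3,4) 2(3,4) h' len
    by (intro exI[of _ h2] exI[of _ ?b]) auto
  moreover have "t1 + t2 + 5000 \<le> 50000 * (2 * p + 3)\<^sup>2"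
  proof -
    have "(h' + 2)\<^sup>2 \<le> (2 * p + 3)\<^sup>2" "(h1 + 2)\<^sup>2 \<le> (2 * p + 3)\<^sup>2" "1\<^sup>2 \<le> (2 * p + 3)\<^sup>2"
      using h' 1(3) by (intro power_mono; simp)+
    then show ?thesis using 1(6) 2(6) unfolding power_one by linarith
  qed
  ultimately show ?thesis
    unfolding prog_nth(23) matB_def
    by (simp add: k 1(1)[THEN wp_det] 2(1)[THEN wp_det]) auto
qed

lemma rep_single_kids:
  assumes "rep n 0 T [c]"
  shows "kids T = Leaf \<or> (\<exists>B. kids T = Inner B)"
  using assms by (cases rule: rep.cases) auto

lemma wp_mat:
  assumes T: "rep n 0 T [c]" and p: "n < 2 ^ p"
  shows "wp [enc T] (prog ! 22) (\<lambda>v t. \<exists>B. v = enc B \<and> mated n p c B \<and> t \<le> 50000 * (2 * p + 3)\<^sup>2)"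
proof (cases "kids T = Leaf")
  case True
  have "1\<^sup>2 \<le> (2 * p + 3)\<^sup>2" by (intro power_mono) auto
  then have le: "100 \<le> 50000 * (2 * p + 3)\<^sup>2" unfolding power_one by linarith
  obtain B t where 1: "eval prog [enc T] (prog ! 22) (enc B) t" "mated n p c B" "t \<le> 100"
    using wp_mat_Leaf[OF T True, of p] by (elim wpE) auto
  moreover have "t \<le> 50000 * (2 * p + 3)\<^sup>2" using le 1(3) by linarith
  ultimately show ?thesis unfolding 1(1)[THEN wp_det] by blast
next
  case False
  then show ?thesis using rep_single_kids[OF T] wp_mat_Inner[OF T _ p] by auto
qed

section \<open>Cutting a list of chains at a position\<close>

definition cuts :: "chain list \<Rightarrow> real \<Rightarrow> chain list \<Rightarrow> chain list \<Rightarrow> bool" where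
  "cuts cs m ps qs \<longleftrightarrow> (\<exists>A c B s s'. cs = A @ [c] @ B \<and> cu c \<le> m \<and> m \<le> cv c \<and>
    ps = A @ [restc (cu c) m (cf c) s] \<and> qs = restc m (cv c) (cf c) s' # B)"

lemma cuts_prefix: "cuts rs m ps qs \<Longrightarrow> cuts (ls @ rs) m (ls @ ps) qs"
  unfolding cuts_def by (metis append.assoc)

lemma cuts_suffix: "cuts ls m ps qs \<Longrightarrow> cuts (ls @ rs) m ps (qs @ rs)"
  unfolding cuts_def by (metis append.assoc append_Cons)

text \<open>A cut where two chains meet produces a chain on a single point rather than no chain;
  this keeps the count uniform and is one reason for admitting such chains.\<close>

lemma cuts_cval:
  assumes "cuts cs m ps qs" "okl cs" "okl ps" "okl qs"
  shows "cul ps = cul cs" "cvl ps = m" "cul qs = m" "cvl qs = cvl cs"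
    "x \<le> m \<Longrightarrow> cval ps x = cval cs x" "m \<le> x \<Longrightarrow> cval qs x = cval cs x"
    "cul cs \<le> m" "m \<le> cvl cs" "length ps + length qs = Suc (length cs)"
proof -
  obtain A c B s s' where c: "cs = A @ [c] @ B" "cu c \<le> m" "m \<le> cv c"
    "ps = A @ [restc (cu c) m (cf c) s]" "qs = restc m (cv c) (cf c) s' # B"
    using assms(1) unfolding cuts_def by blast
  show e: "cul ps = cul cs" "cvl ps = m" "cul qs = m" "cvl qs = cvl cs"
    using c by (auto simp: hd_append)
  show m: "cul cs \<le> m" "m \<le> cvl cs"
    using okl_bounds[OF assms(2), of c] c by auto
  show "length ps + length qs = Suc (length cs)"
    using c by simp
  have cs: "cval cs x = cf d x" if "d \<in> set cs" "cu d \<le> x" "x \<le> cv d" for d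
    using cval_in[OF assms(2) that] .
  show "cval ps x = cval cs x" if "x \<le> m"
    by (rule cval_eqI[OF assms(3)]) (use that c e m cs cval_out[OF assms(2)] in \<open>auto simp: cf_restc\<close>)
  show "cval qs x = cval cs x" if "m \<le> x"
    by (rule cval_eqI[OF assms(4)]) (use that c e m cs cval_out[OF assms(2)] in \<open>auto simp: cf_restc\<close>)
qed

definition split_post :: "nat \<Rightarrow> nat \<Rightarrow> chain list \<Rightarrow> real \<Rightarrow> nat \<Rightarrow> val \<Rightarrow> nat \<Rightarrow> bool" where
  "split_post n h cs m D v t \<longleftrightarrow> (\<exists>p q ps qs hp hq. v = PairV (enc p) (enc q) \<and> rep n hp p ps \<and>
    rep n hq q qs \<and> hp \<le> Suc h \<and> hq \<le> Suc h \<and> cuts cs m ps qs \<and> t \<le> D)"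

lemma wp_mono: "wp E e Q \<Longrightarrow> (\<And>v t. Q v t \<Longrightarrow> R v t) \<Longrightarrow> wp E e R"
  unfolding wp_def by blast

lemma split_postI:
  "rep n hp p ps \<Longrightarrow> rep n hq q qs \<Longrightarrow> hp \<le> Suc h \<Longrightarrow> hq \<le> Suc h \<Longrightarrow> cuts cs m ps qs \<Longrightarrow> t \<le> D \<Longrightarrow>
    split_post n h cs m D (PairV (enc p) (enc q)) t"
  unfolding split_post_def by blast

lemma split_postE:
  assumes "split_post n h cs m D v t"
  obtains p q ps qs hp hq where "v = PairV (enc p) (enc q)" "rep n hp p ps" "rep n hq q qs"
    "hp \<le> Suc h" "hq \<le> Suc h" "cuts cs m ps qs" "t \<le> D"
  using assms unfolding split_post_def by blast

lemma split_post_mono: "split_post n h cs m D v t \<Longrightarrow> D \<le> D' \<Longrightarrow> split_post n h cs m D' v t"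
  by (elim split_postE) (auto intro: split_postI)

lemma rep_okl: "rep n h T cs \<Longrightarrow> okl cs"
  using rep_hdr by (simp add: hdr_def)

lemma wp_split_Leaf:
  assumes T: "rep n 0 T cs" "kids T = Leaf" and m: "cul cs \<le> m" "m \<le> cvl cs"
  shows "wp [enc T, RealV m] (prog ! 23) (split_post n' 0 cs m 1000)"
proof -
  let ?c = "linc (xl T) (yl T) (xr T) (mc T)"
  obtain cs: "cs = [?c]" and le: "xl T \<le> xr T" and yr: "yr T = yl T + mc T * (xr T - xl T)"
    by (rule rep_LeafE[OF T], rule that)
  define y where "y = yl T + (yr T - yl T) * (m - xl T) / (xr T - xl T)"
  have m: "xl T \<le> m" "m \<le> xr T" using m cs by auto
  have y: "y = yl T + mc T * (m - xl T)"
    using yr m by (cases "xr T = xl T") (auto simp: y_def)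
  let ?s = "(y - yl T) / (m - xl T)" and ?s' = "(yr T - y) / (xr T - m)"
  have p: "rep n' 0 (linT (xl T) (yl T) m y) [linc (xl T) (yl T) m ?s]"
    using m y by (intro rep_linT) auto
  have q: "rep n' 0 (linT m y (xr T) (yr T)) [linc m y (xr T) ?s']"
    using m y yr by (intro rep_linT) auto
  have "linc (xl T) (yl T) m ?s = restc (xl T) m (cf ?c) ?s"
    by (rule chain_eqI) (use m y in \<open>auto simp: cf_linc cf_restc\<close>)
  moreover have "linc m y (xr T) ?s' = restc m (xr T) (cf ?c) ?s'"
  proof (rule chain_eqI)
    fix x
    show "cf (linc m y (xr T) ?s') x = cf (restc m (xr T) (cf ?c) ?s') x"
    proof (cases "m = xr T")
      case False
      have "yr T - y = mc T * (xr T - m)" using y yr by (simp add: algebra_simps)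
      with False have s: "?s' = mc T" by simp
      show ?thesis unfolding s using m y by (simp add: cf_linc cf_restc algebra_simps)
    qed (use m y in \<open>auto simp: cf_linc cf_restc\<close>)
  qed simp_all
  ultimately have "cuts cs m [linc (xl T) (yl T) m ?s] [linc m y (xr T) ?s']"
    unfolding cuts_def cs using m
    by (intro exI[of _ "[]"] exI[of _ ?c] exI[of _ ?s] exI[of _ ?s']) auto
  then show ?thesis
    unfolding prog_nth(24) splitB_def using p q
    by (simp add: T(2) y_def[symmetric]) (rule split_postI, assumption+, simp_all)
qed

text \<open>Cutting a single chain is left as a parameter of cost \<open>D\<close>. Inner trees
  satisfy it vacuously, which yields \<open>wp_split0\<close>; that result in turn supplies the
  parameter for outer trees. A search path ends in one chain, so \<open>D\<close> is paid
  once.\<close>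

lemma wp_split_ind:
  assumes inner: "\<And>T c B m. rep n 0 T [c] \<Longrightarrow> kids T = Inner B \<Longrightarrow> cu c \<le> m \<Longrightarrow> m \<le> cv c \<Longrightarrow>
    wp [enc T, RealV m] (prog ! 23) (split_post n' 0 [c] m D)" and n: "n \<le> n'"
  assumes "rep n h T cs" "cul cs \<le> m" "m \<le> cvl cs"
  shows "wp [enc T, RealV m] (prog ! 23) (split_post n' h cs m (20000 * (h + 2)\<^sup>2 + D))"
  using assms(3-)
proof (induction h arbitrary: T cs rule: less_induct)
  case (less h)
  show ?case
  proof (cases "h = 0")
    case True
    obtain c where c: "cs = [c]"
      using less.prems(1) True by (cases rule: rep.cases) auto
    from True c less.prems(1) rep_single_kids[of n T c] consider "kids T = Leaf" | B where "kids T = Inner B"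
      by auto
    then have "wp [enc T, RealV m] (prog ! 23) (split_post n' 0 cs m (1000 + D))"
    proof cases
      case 1
      have "wp [enc T, RealV m] (prog ! 23) (split_post n' 0 cs m 1000)"
        using less.prems True by (intro wp_split_Leaf[OF _ 1]) auto
      then show ?thesis by (elim wp_mono split_post_mono) simp
    next
      case 2
      have "wp [enc T, RealV m] (prog ! 23) (split_post n' 0 cs m D)"
        unfolding c using less.prems True c by (intro inner[OF _ 2]) auto
      then show ?thesis by (elim wp_mono split_post_mono) simp
    qed
    moreover have "1000 + D \<le> 20000 * (h + 2)\<^sup>2 + D" using True by (simp add: power2_eq_square)
    ultimately show ?thesis
      unfolding True by (elim wp_mono split_post_mono) simp
  next
    case False
    then have "0 < h" by simp
    obtain L R hl hr ls rs k k' where Kk: "kids T = Branch k k'" and K: "eval prog [enc T] (prog ! 14) (enc L) 844"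
      "eval prog [enc T] (prog ! 15) (enc R) 844" "rep n hl L ls" "rep n hr R rs" "cs = ls @ rs"
      "h = Suc (max hl hr)" "hl \<le> Suc hr" "hr \<le> Suc hl" "okl cs" "ls \<noteq> []" "rs \<noteq> []"
      by (rule rep_splitE[OF less.prems(1) \<open>0 < h\<close>], rule that)
    note ok = okl_appendD[OF K(9)[unfolded K(5)] K(10,11)]
    have xr: "xr L = cvl ls" using hdrD(9)[OF rep_hdr[OF K(3)]] by auto
    have L: "rep n' hl L ls" and R: "rep n' hr R rs" using rep_mono K(3,4) n by auto
    have hlr: "hl < h" "hr < h" using K(6) by auto
    have sq: "20000 * (k + 2)\<^sup>2 + 8000 * (h + 3) + 5000 \<le> 20000 * (h + 2)\<^sup>2" if "k < h" for k
      using square_step[OF that, of 20000] by simp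
    show ?thesis
    proof (cases "xr L < m")
      case True
      have "wp [enc R, RealV m] (prog ! 23) (split_post n' hr rs m (20000 * (hr + 2)\<^sup>2 + D))"
        by (rule less.IH[OF hlr(2) K(4)]) (use True xr ok less.prems(3) K(5,10,11) in auto)
      then obtain p q ps qs hp hq t where 1: "eval prog [enc R, RealV m] (prog ! 23) (PairV (enc p) (enc q)) t"
        "rep n' hp p ps" "rep n' hq q qs" "hp \<le> Suc hr" "hq \<le> Suc hr" "cuts rs m ps qs"
        "t \<le> 20000 * (hr + 2)\<^sup>2 + D"
        by (elim wpE split_postE) blast
      note c = cuts_cval[OF 1(6) ok(2) rep_okl[OF 1(2)] rep_okl[OF 1(3)]]
      have ok2: "okl (ls @ ps)"
        by (rule okl_appendI[OF ok(1) rep_okl[OF 1(2)]]) (use c ok in auto)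
      from wp_join[OF L 1(2) ok2] obtain p' hp' t' where
        2: "eval prog [enc L, enc p] (prog ! 20) (enc p') t'" "rep n' hp' p' (ls @ ps)"
        "hp' \<le> Suc (max hl hp)" "t' \<le> 8000 * (max hl hp + 2)"
        by (elim wpE) auto
      have max: "max hl hp \<le> h" using 1(4) hlr by auto
      have t': "t' \<le> 8000 * (h + 2)"
        using 2(4) max by (meson add_le_mono1 le_trans mult_le_mono2)
      have "t + t' + 5000 \<le> 20000 * (h + 2)\<^sup>2 + D"
        using sq[OF hlr(2)] 1(7) t' by simp
      moreover have "cuts cs m (ls @ ps) qs" using cuts_prefix[OF 1(6)] K(5) by simp
      moreover have "hp' \<le> Suc h" "hq \<le> Suc h" using 2(3) max 1(5) hlr by linarith+
      ultimately show ?thesis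
        unfolding prog_nth(24) splitB_def using True
        by (simp add: Kk K(1,2)[THEN wp_det] 1(1)[THEN wp_det] 2(1)[THEN wp_det])
          (rule split_postI[OF 2(2) 1(3)], simp_all)
    next
      case False
      have "wp [enc L, RealV m] (prog ! 23) (split_post n' hl ls m (20000 * (hl + 2)\<^sup>2 + D))"
        by (rule less.IH[OF hlr(1) K(3)]) (use False xr ok less.prems(2) K(5,10,11) in auto)
      then obtain p q ps qs hp hq t where 1: "eval prog [enc L, RealV m] (prog ! 23) (PairV (enc p) (enc q)) t"
        "rep n' hp p ps" "rep n' hq q qs" "hp \<le> Suc hl" "hq \<le> Suc hl" "cuts ls m ps qs"
        "t \<le> 20000 * (hl + 2)\<^sup>2 + D"
        by (elim wpE split_postE) blast
      note c = cuts_cval[OF 1(6) ok(1) rep_okl[OF 1(2)] rep_okl[OF 1(3)]]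
      have ok2: "okl (qs @ rs)"
        by (rule okl_appendI[OF rep_okl[OF 1(3)] ok(2)]) (use c ok in auto)
      from wp_join[OF 1(3) R ok2] obtain q' hq' t' where
        2: "eval prog [enc q, enc R] (prog ! 20) (enc q') t'" "rep n' hq' q' (qs @ rs)"
        "hq' \<le> Suc (max hq hr)" "t' \<le> 8000 * (max hq hr + 2)"
        by (elim wpE) auto
      have max: "max hq hr \<le> h" using 1(5) hlr by auto
      have t': "t' \<le> 8000 * (h + 2)"
        using 2(4) max by (meson add_le_mono1 le_trans mult_le_mono2)
      have "t + t' + 5000 \<le> 20000 * (h + 2)\<^sup>2 + D"
        using sq[OF hlr(1)] 1(7) t' by simp
      moreover have "cuts cs m ps (qs @ rs)" using cuts_suffix[OF 1(6)] K(5) by simp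
      moreover have "hq' \<le> Suc h" "hp \<le> Suc h" using 2(3) max 1(4) hlr by linarith+
      ultimately show ?thesis
        unfolding prog_nth(24) splitB_def using False
        by (simp add: Kk K(1,2)[THEN wp_det] 1(1)[THEN wp_det] 2(1)[THEN wp_det])
          (rule split_postI[OF 1(2) 2(2)], simp_all)
    qed
  qed
qed

lemma rep0_Inner: "rep 0 h T cs \<Longrightarrow> kids T \<noteq> Inner B"
  by (auto elim: rep.cases dest: rep_okl)

lemma wp_split0:
  assumes "rep 0 h T cs" "cul cs \<le> m" "m \<le> cvl cs"
  shows "wp [enc T, RealV m] (prog ! 23) (split_post 0 h cs m (20000 * (h + 2)\<^sup>2))"
proof -
  have "wp [enc T, RealV m] (prog ! 23) (split_post 0 h cs m (20000 * (h + 2)\<^sup>2 + 0))"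
    by (rule wp_split_ind[OF _ _ assms]) (auto dest: rep0_Inner)
  then show ?thesis by (elim wp_mono split_post_mono) simp
qed

lemma rep_glued:
  assumes P: "rep 0 h P ps" and "length ps \<le> n" "okc c" "cul ps = u" "cvl ps = v" "cu c \<le> u" "v \<le> cv c"
    and cf: "\<And>x. u \<le> x \<Longrightarrow> x \<le> v \<Longrightarrow> cval ps x = cf c x"
  shows "\<exists>s. rep n 0 (chainT P) [restc u v (cf c) s]"
proof -
  have "conc (cul ps) (cvl ps) (cval ps)"
    unfolding assms(4,5) by (rule conc_cong[OF conc_mono[OF okc_conc[OF assms(3)]]]) (use assms in auto)
  then have "rep n 0 (chainT P) [glue ps]"
    by (rule rep_chainT[OF P assms(2)])
  moreover have "glue ps = restc u v (cf c) (sl (glue ps))"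
    by (rule chain_eqI) (use assms cval_out[OF rep_okl[OF P]] in \<open>auto simp: cf_restc\<close>)
  ultimately have "rep n 0 (chainT P) [restc u v (cf c) (sl (glue ps))]" by simp
  then show ?thesis ..
qed

text \<open>Caps refer to the ends of their chain, so they have to be materialised before a cut
  moves one of these ends. That adds pieces, hence \<open>n + 4\<close>.\<close>

lemma wp_split:
  assumes p: "n < 2 ^ p" and "rep n h T cs" "cul cs \<le> m" "m \<le> cvl cs"
  shows "wp [enc T, RealV m] (prog ! 23)
    (split_post (n + 4) h cs m (20000 * (h + 2)\<^sup>2 + 100000 * (2 * p + 4)\<^sup>2))"
proof (rule wp_split_ind[OF _ _ assms(2-)])
  fix T c B m
  assume T: "rep n 0 T [c]" and k: "kids T = Inner B" and m: "cu c \<le> m" "m \<le> cv c"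
  have okc: "okc c" using rep_okl[OF T] by simp
  obtain B' t where 1: "eval prog [enc T] (prog ! 22) (enc B') t" "mated n p c B'" "t \<le> 50000 * (2 * p + 3)\<^sup>2"
    using wp_mat[OF T p] by (elim wpE) auto
  then obtain hb bs where B: "rep 0 hb B' bs" and sim: "sim (glue bs) c" and len: "length bs \<le> n + 3"
    and hb: "hb \<le> 2 * p + 2"
    unfolding mated_def by auto
  have bs: "cul bs = cu c" "cvl bs = cv c" "cval bs = cf c" using sim by (simp_all add: sim_def)
  have "wp [enc B', RealV m] (prog ! 23) (split_post 0 hb bs m (20000 * (hb + 2)\<^sup>2))"
    using m bs by (intro wp_split0[OF B]) auto
  then obtain P Q ps qs hp hq t' where 2: "eval prog [enc B', RealV m] (prog ! 23) (PairV (enc P) (enc Q)) t'"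
    "rep 0 hp P ps" "rep 0 hq Q qs" "cuts bs m ps qs" "t' \<le> 20000 * (hb + 2)\<^sup>2"
    by (elim wpE split_postE) blast
  note c = cuts_cval[OF 2(4) rep_okl[OF B] rep_okl[OF 2(2)] rep_okl[OF 2(3)]]
  have "\<exists>s. rep (n + 4) 0 (chainT P) [restc (cu c) m (cf c) s]"
    by (rule rep_glued[OF 2(2) _ okc]) (use c bs len m in auto)
  moreover have "\<exists>s. rep (n + 4) 0 (chainT Q) [restc m (cv c) (cf c) s]"
    by (rule rep_glued[OF 2(3) _ okc]) (use c bs len m in auto)
  ultimately obtain s s' where 3: "rep (n + 4) 0 (chainT P) [restc (cu c) m (cf c) s]"
    "rep (n + 4) 0 (chainT Q) [restc m (cv c) (cf c) s']" by auto
  have "cuts [c] m [restc (cu c) m (cf c) s] [restc m (cv c) (cf c) s']"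
    unfolding cuts_def using m by (intro exI[of _ "[]"] exI[of _ c] exI[of _ s] exI[of _ s']) auto
  moreover have "t + t' + 5000 \<le> 100000 * (2 * p + 4)\<^sup>2"
  proof -
    have "(hb + 2)\<^sup>2 \<le> (2 * p + 4)\<^sup>2" "(2 * p + 3)\<^sup>2 \<le> (2 * p + 4)\<^sup>2" "1\<^sup>2 \<le> (2 * p + 4)\<^sup>2"
      using hb by (intro power_mono; simp)+
    then show ?thesis using 1(3) 2(5) unfolding power_one by linarith
  qed
  ultimately show "wp [enc T, RealV m] (prog ! 23) (split_post (n + 4) 0 [c] m (100000 * (2 * p + 4)\<^sup>2))"
    unfolding prog_nth(24) splitB_def
    by (simp add: k 1(1)[THEN wp_det] 2(1)[THEN wp_det])
      (rule split_postI[OF 3], simp_all)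
qed simp

section \<open>Waves\<close>

text \<open>
  \<open>dom a l r F G\<close>: on \<open>[l, r]\<close> the left wave of slope \<open>a\<close> of \<open>F\<close> starting at \<open>l\<close> is below \<open>G\<close>. Two functions that
  dominate each other have the same wave.
\<close>

definition dom :: "real \<Rightarrow> real \<Rightarrow> real \<Rightarrow> (real \<Rightarrow> real) \<Rightarrow> (real \<Rightarrow> real) \<Rightarrow> bool" where
  "dom a l r F G \<longleftrightarrow> (\<forall>x. l \<le> x \<longrightarrow> x \<le> r \<longrightarrow> (\<exists>t. l \<le> t \<and> t \<le> x \<and> F t + a * (x - t) \<le> G x))"

text \<open>These are the functions that a left wave of slope \<open>a\<close> leaves
  unchanged.\<close>

definition slope :: "real \<Rightarrow> real \<Rightarrow> real \<Rightarrow> (real \<Rightarrow> real) \<Rightarrow> bool" where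
  "slope a l r F \<longleftrightarrow> (\<forall>x y. l \<le> x \<longrightarrow> x \<le> y \<longrightarrow> y \<le> r \<longrightarrow> F y \<le> F x + a * (y - x))"

lemma dom_trans:
  assumes "dom a l r F G" "dom a l r G H"
  shows "dom a l r F H"
  unfolding dom_def
proof (intro allI impI)
  fix x assume x: "l \<le> x" "x \<le> r"
  with assms(2) obtain t where t: "l \<le> t" "t \<le> x" "G t + a * (x - t) \<le> H x" unfolding dom_def by blast
  with x assms(1) obtain s where s: "l \<le> s" "s \<le> t" "F s + a * (t - s) \<le> G t" unfolding dom_def by (meson order_trans)
  have "F s + a * (x - s) = F s + a * (t - s) + a * (x - t)" by (simp add: algebra_simps)
  with s t show "\<exists>t\<ge>l. t \<le> x \<and> F t + a * (x - t) \<le> H x" by (intro exI[of _ s]) linarith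
qed

lemma slope_append:
  assumes "l \<le> m" "m \<le> r" "slope a l m F" "slope a m r F"
  shows "slope a l r F"
  unfolding slope_def
proof (intro allI impI)
  fix x y assume xy: "l \<le> x" "x \<le> y" "y \<le> r"
  consider "y \<le> m" | "m \<le> x" | "x \<le> m" "m \<le> y" by linarith
  then show "F y \<le> F x + a * (y - x)"
  proof cases
    case 3
    then have "F m \<le> F x + a * (m - x)" "F y \<le> F m + a * (y - m)"
      using assms xy unfolding slope_def by auto
    then show ?thesis by (simp add: algebra_simps)
  qed (use assms xy in \<open>auto simp: slope_def\<close>)
qed

lemma slope_cong:
  assumes "slope a l r F" "\<And>x. l \<le> x \<Longrightarrow> x \<le> r \<Longrightarrow> G x = F x"
  shows "slope a l r G"
  using assms unfolding slope_def by auto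

lemma slope_affine: "slope a l r (\<lambda>x. p + a * (x - q))"
  by (auto simp: slope_def algebra_simps)

lemma cf_capc_left:
  assumes "cpd a' b c" "cu c \<le> x" "x \<le> cv c"
  shows "cf (capc a b c) x = min (cf c x) (cf c (cu c) + a * (x - cu c))"
proof -
  have "cf c x \<le> cf c (cv c) + b * (cv c - x)"
    using assms unfolding cpd_def by blast
  then show ?thesis
    using assms(2,3) by (simp add: capc_def cf_restc min_def)
qed

text \<open>If the cap is active at \<open>x\<close>, the cap line also bounds the value at
  \<open>y\<close>. Otherwise the chain is strictly below the line at \<open>x\<close> but on it at
  its left end, so its supporting slope at \<open>x\<close> is at most \<open>a\<close>.\<close>

lemma slope_capc:
  assumes c: "okc c" "cpd a' b c" "sl c \<le> a"
  shows "slope a (cu c) (cv c) (cf (capc a b c))"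
  unfolding slope_def
proof (intro allI impI)
  let ?u = "cu c" and ?v = "cv c" and ?f = "cf c"
  let ?l = "\<lambda>x. ?f ?u + a * (x - ?u)"
  have f: "cf (capc a b c) x = min (?f x) (?l x)" if "?u \<le> x" "x \<le> ?v" for x
    using cf_capc_left[OF c(2) that] .
  fix x y assume xy: "?u \<le> x" "x \<le> y" "y \<le> ?v"
  have l: "?l y = ?l x + a * (y - x)" by (simp add: algebra_simps)
  show "cf (capc a b c) y \<le> cf (capc a b c) x + a * (y - x)"
  proof (cases "?l x \<le> ?f x")
    case True
    then show ?thesis using f[of x] f[of y] xy l by (simp add: min_def)
  next
    case False
    obtain k where k: "\<And>z. ?u \<le> z \<Longrightarrow> z \<le> ?v \<Longrightarrow> ?f z \<le> ?f x + k * (z - x)"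
      using okc_conc[OF c(1)] xy by (elim concE[of ?u ?v ?f x]) auto
    have "?f ?u \<le> ?f x + k * (?u - x)" using k[of ?u] xy by simp
    with False have "0 < (a - k) * (x - ?u)" by (simp add: algebra_simps)
    with xy have "k \<le> a" by (simp add: zero_less_mult_iff)
    with xy have "k * (y - x) \<le> a * (y - x)" by (intro mult_right_mono) auto
    with k[of y] xy f[of x] f[of y] False show ?thesis by (simp add: min_def split: if_splits)
  qed
qed

lemma slope_capl:
  assumes "okl cs" "\<forall>c\<in>set cs. cpd a' b c \<and> sl c \<le> a"
  shows "slope a (cul cs) (cvl cs) (cval (map (capc a b) cs))"
  using assms
proof (induction cs)
  case (Cons c cs)
  have ok: "okl (map (capc a b) (c # cs))"
    using Cons.prems by (intro okl_capc) (auto simp: cpd_def)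
  have c: "slope a (cu c) (cv c) (cf (capc a b c))"
    using Cons.prems okl_okc[of "c # cs" c] by (intro slope_capc) auto
  have 1: "slope a (cu c) (cv c) (cval (map (capc a b) (c # cs)))"
    by (rule slope_cong[OF c]) simp
  show ?case
  proof (cases "cs = []")
    case True
    with 1 show ?thesis by (simp del: cval.simps)
  next
    case False
    have ok': "okl cs" "cv c = cul cs" using Cons.prems(1) False by (cases cs; auto simp: adj_def)+
    have 2: "slope a (cul cs) (cvl cs) (cval (map (capc a b) (c # cs)))"
    proof (rule slope_cong[OF Cons.IH])
      fix x assume "cul cs \<le> x" "x \<le> cvl cs"
      then show "cval (map (capc a b) (c # cs)) x = cval (map (capc a b) cs) x"
        using cval_append2[of "[capc a b c]" "map (capc a b) cs" x] ok False by simp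
    qed (use Cons.prems ok' in auto)
    have "cu c \<le> cv c" "cul cs \<le> cvl cs"
      using okc_le[of c] okl_okc[OF Cons.prems(1), of c] okl_range[OF ok'(1)] by auto
    with 1 2 ok' False show ?thesis
      using slope_append[of "cu c" "cul cs" "cvl cs" a] by (simp del: cval.simps)
  qed
qed simp

text \<open>Characterises the wave without an infimum: mutual domination says that both functions
  have the same wave, and \<open>slope\<close> that the second is its own wave. Domination being
  transitive, a list may be replaced by an equivalent one before the wave is taken.\<close>

definition wave :: "real \<Rightarrow> chain list \<Rightarrow> chain list \<Rightarrow> bool" where
  "wave a cs ds \<longleftrightarrow> cul ds = cul cs \<and> cvl ds = cvl cs \<and> dom a (cul cs) (cvl cs) (cval cs) (cval ds) \<and>
    dom a (cul cs) (cvl cs) (cval ds) (cval cs) \<and> slope a (cul cs) (cvl cs) (cval ds)"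

lemma dom_listI:
  assumes "okl cs" "okl ds" "cul ds = cul cs" "cvl ds = cvl cs"
    and "\<And>d x. d \<in> set ds \<Longrightarrow> cu d \<le> x \<Longrightarrow> x \<le> cv d \<Longrightarrow> \<exists>t. cul cs \<le> t \<and> t \<le> x \<and> cval cs t + a * (x - t) \<le> cf d x"
  shows "dom a (cul cs) (cvl cs) (cval cs) (cval ds)"
  unfolding dom_def
proof (intro allI impI)
  fix x assume "cul cs \<le> x" "x \<le> cvl cs"
  with assms(2-4) obtain d where "d \<in> set ds" "cu d \<le> x" "x \<le> cv d" by (auto elim: cval_ex[of ds x])
  with assms(5)[of d x] cval_in[OF assms(2), of d x] show "\<exists>t\<ge>cul cs. t \<le> x \<and> cval cs t + a * (x - t) \<le> cval ds x"
    by simp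
qed

text \<open>Over \<open>c\<close> the wave only notices the line from the left end of
  \<open>c\<close>, so anything above that line will do there; over \<open>d\<close> the two may
  differ only where both are above the line. This covers both outcomes of a merge, the straight
  chord and the capped neighbour.\<close>

definition merged :: "real \<Rightarrow> chain \<Rightarrow> chain \<Rightarrow> chain \<Rightarrow> bool" where
  "merged a c d e \<longleftrightarrow> cu e = cu c \<and> cv e = cv d \<and> cf e (cu c) = cf c (cu c) \<and> cf e (cv d) = cf d (cv d) \<and>
    (\<forall>x. cu c \<le> x \<longrightarrow> x \<le> cv c \<longrightarrow> cf c (cu c) + a * (x - cu c) \<le> cf e x) \<and>
    (\<forall>x. cu d \<le> x \<longrightarrow> x \<le> cv d \<longrightarrow> cf e x = cf d x \<or>
      cf c (cu c) + a * (x - cu c) \<le> cf e x \<and> cf c (cu c) + a * (x - cu c) \<le> cf d x)"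

text \<open>A concave chain lies above its chord, and the chord above the line of slope
  \<open>a\<close> through the left end.\<close>

lemma chain_above:
  assumes "okc c" "a \<le> sl c" "cu c \<le> x" "x \<le> cv c"
  shows "cf c (cu c) + a * (x - cu c) \<le> cf c x"
proof -
  have "a * (cv c - cu c) \<le> sl c * (cv c - cu c)" using assms by (intro mult_right_mono) auto
  then have "(cf c (cu c) - a * cu c) + a * x \<le> cf c x"
    using assms okc_end[OF assms(1)]
    by (intro conc_above[OF okc_conc[OF assms(1)], of "cu c" x "cv c"]) (auto simp: algebra_simps)
  then show ?thesis by (simp add: algebra_simps)
qed

lemma merged_okl:
  assumes "okl (A @ c # d # B)" "okc e" "merged a c d e"
  shows "okl (A @ e # B)"
proof -
  have e: "cu e = cu c" "cv e = cv d" "cf e (cu c) = cf c (cu c)" "cf e (cv d) = cf d (cv d)"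
    using assms(3) by (auto simp: merged_def)
  have "okl (e # B)"
  proof (cases B)
    case (Cons b B')
    then show ?thesis using assms(1,2) e okl_append[of A "c # d # B"] by (cases "A = []") (auto simp: adj_def)
  qed (use assms(2) in simp)
  then show ?thesis
    using assms(1) e okl_append[of A "c # d # B"] okl_append[of A "e # B"] by (cases "A = []") (auto simp: adj_def)
qed

text \<open>Wherever the two functions may differ, both lie above the line from the left end of
  \<open>c\<close>. That end is a point of both graphs and serves as the witness.\<close>

lemma merged_dom:
  assumes ok: "okl (A @ c # d # B)" and e: "okc e" "merged a c d e" and a: "a \<le> sl c"
  shows "dom a (cul (A @ c # d # B)) (cvl (A @ c # d # B)) (cval (A @ c # d # B)) (cval (A @ e # B))"
    and "dom a (cul (A @ c # d # B)) (cvl (A @ c # d # B)) (cval (A @ e # B)) (cval (A @ c # d # B))"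
    and "cul (A @ e # B) = cul (A @ c # d # B)" "cvl (A @ e # B) = cvl (A @ c # d # B)"
proof -
  let ?cs = "A @ c # d # B" and ?ds = "A @ e # B"
  let ?l = "\<lambda>x. cf c (cu c) + a * (x - cu c)"
  have ok': "okl ?ds" using merged_okl[OF ok e] .
  have E: "cu e = cu c" "cv e = cv d" "cf e (cu c) = cf c (cu c)" "cf e (cv d) = cf d (cv d)"
    "\<And>x. cu c \<le> x \<Longrightarrow> x \<le> cv c \<Longrightarrow> ?l x \<le> cf e x"
    "\<And>x. cu d \<le> x \<Longrightarrow> x \<le> cv d \<Longrightarrow> cf e x = cf d x \<or> ?l x \<le> cf e x \<and> ?l x \<le> cf d x"
    using e(2) by (auto simp: merged_def)
  have cd: "cv c = cu d" "okc c" "okc d" "cu c \<le> cv c" "cu d \<le> cv d"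
  proof -
    have "okl (c # d # B)" using ok okl_append[of A "c # d # B"] by (cases "A = []") auto
    then show "cv c = cu d" "okc c" "okc d" "cu c \<le> cv c" "cu d \<le> cv d"
      using okl_okc[OF ok, of c] okl_okc[OF ok, of d] okc_le[of c] okc_le[of d] by (auto simp: adj_def)
  qed
  show ends: "cul ?ds = cul ?cs" "cvl ?ds = cvl ?cs"
    using E(1,2) by (auto simp: hd_append)
  have lo: "cul ?cs \<le> cu c" "cul ?cs \<le> cu x" if "x \<in> set ?cs" for x
    using okl_bounds[OF ok, of c] okl_bounds[OF ok that] by auto
  have v1: "cval ?cs x = cf y x" if "y \<in> set ?cs" "cu y \<le> x" "x \<le> cv y" for x y
    using cval_in[OF ok that] .
  have v2: "cval ?ds x = cf y x" if "y \<in> set ?ds" "cu y \<le> x" "x \<le> cv y" for x y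
    using cval_in[OF ok' that] .
  have p1: "cval ?cs (cu c) = cf c (cu c)" using v1[of c] cd by simp
  have "cu c \<le> cv d" using cd by linarith
  then have p2: "cval ?ds (cu c) = cf c (cu c)" using v2[of e "cu c"] E(1-3) by simp
  show "dom a (cul ?cs) (cvl ?cs) (cval ?cs) (cval ?ds)"
  proof (rule dom_listI[OF ok ok' ends])
    fix y x assume y: "y \<in> set ?ds" "cu y \<le> x" "x \<le> cv y"
    consider "y \<in> set ?cs" | "y = e" "x \<le> cv c" | "y = e" "cu d \<le> x" using y cd by fastforce
    then show "\<exists>t\<ge>cul ?cs. t \<le> x \<and> cval ?cs t + a * (x - t) \<le> cf y x"
    proof cases
      case 1
      then show ?thesis using v1[of y x] y lo(2)[of y] by (intro exI[of _ x]) auto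
    next
      case 2
      then show ?thesis using E(1) E(5)[of x] p1 y lo(1)[of c] by (intro exI[of _ "cu c"]) auto
    next
      case 3
      then consider "cf e x = cf d x" | "?l x \<le> cf e x" using E(2) E(6)[of x] y by auto
      then show ?thesis
      proof cases
        case 1
        then show ?thesis using v1[of d x] 3 y E lo(2)[of d] by (intro exI[of _ x]) auto
      next
        case 2
        then show ?thesis using 3 y E p1 lo(1)[of c] cd by (intro exI[of _ "cu c"]) auto
      qed
    qed
  qed
  have "dom a (cul ?ds) (cvl ?ds) (cval ?ds) (cval ?cs)"
  proof (rule dom_listI[OF ok' ok ends[symmetric]])
    fix y x assume y: "y \<in> set ?cs" "cu y \<le> x" "x \<le> cv y"
    consider "y \<in> set ?ds" | "y = c" | "y = d" using y by fastforce
    then show "\<exists>t\<ge>cul ?ds. t \<le> x \<and> cval ?ds t + a * (x - t) \<le> cf y x"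
    proof cases
      case 1
      then show ?thesis using v2[of y x] y lo(2)[of y] ends by (intro exI[of _ x]) auto
    next
      case 2
      then show ?thesis using chain_above[OF cd(2) a, of x] p2 y lo(1)[of c] ends
        by (intro exI[of _ "cu c"]) auto
    next
      case 3
      then consider "cf e x = cf d x" | "?l x \<le> cf d x" using E(6)[of x] y by auto
      then show ?thesis
      proof cases
        case 1
        then show ?thesis using v2[of e x] 3 y E lo(2)[of d] ends cd by (intro exI[of _ x]) auto
      next
        case 2
        then show ?thesis using 3 y E p2 lo(1)[of c] cd ends by (intro exI[of _ "cu c"]) auto
      qed
    qed
  qed
  then show "dom a (cul ?cs) (cvl ?cs) (cval ?ds) (cval ?cs)" unfolding ends .
qed

lemma merged_wave:
  assumes ok: "okl (A @ c # d # B)" and e: "okc e" "merged a c d e" and a: "a \<le> sl c"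
    and w: "wave a (A @ e # B) ds"
  shows "wave a (A @ c # d # B) ds"
  using merged_dom[OF ok e a] w unfolding wave_def by (metis dom_trans)

text \<open>A capped value is an old value or lies on the line from the left end of its chain, whose
  value is unchanged. As all ends are kept, nothing propagates from one chain to the next.\<close>

lemma wave_capl:
  assumes ok: "okl cs" and cs: "\<forall>c\<in>set cs. cpd a' b c \<and> sl c \<le> a"
  shows "wave a cs (map (capc a b) cs)"
proof -
  have ne: "cs \<noteq> []" using ok by auto
  have ok': "okl (map (capc a b) cs)" using assms by (intro okl_capc) (auto simp: cpd_def)
  have sl: "slope a (cul cs) (cvl cs) (cval (map (capc a b) cs))" using slope_capl[OF assms] .
  have f: "cf (capc a b c) x = min (cf c x) (cf c (cu c) + a * (x - cu c))"
    if "c \<in> set cs" "cu c \<le> x" "x \<le> cv c" for c x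
    using cf_capc_left[OF _ that(2,3)] cs that(1) by blast
  have lo: "cul cs \<le> cu c" "okc c" if "c \<in> set cs" for c
    using okl_bounds[OF ok that] okl_okc[OF ok that] by auto
  have "dom a (cul cs) (cvl cs) (cval cs) (cval (map (capc a b) cs))"
  proof (rule dom_listI[OF ok ok'])
    fix d x assume "d \<in> set (map (capc a b) cs)" "cu d \<le> x" "x \<le> cv d"
    then obtain c where c: "d = capc a b c" "c \<in> set cs" "cu c \<le> x" "x \<le> cv c" by auto
    show "\<exists>t\<ge>cul cs. t \<le> x \<and> cval cs t + a * (x - t) \<le> cf d x"
    proof (cases "cf c x \<le> cf c (cu c) + a * (x - cu c)")
      case True
      then show ?thesis using c f[of c x] lo[of c] cval_in[OF ok, of c x] by (intro exI[of _ x]) auto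
    next
      case False
      then show ?thesis using c f[of c x] lo[of c] cval_in[OF ok, of c "cu c"] by (intro exI[of _ "cu c"]) auto
    qed
  qed (use ne in auto)
  moreover have "dom a (cul cs) (cvl cs) (cval (map (capc a b) cs)) (cval cs)"
    unfolding dom_def
  proof (intro allI impI)
    fix x assume x: "cul cs \<le> x" "x \<le> cvl cs"
    obtain c where c: "c \<in> set cs" "cu c \<le> x" "x \<le> cv c" using cval_ex[OF ok x] by blast
    then show "\<exists>t\<ge>cul cs. t \<le> x \<and> cval (map (capc a b) cs) t + a * (x - t) \<le> cval cs x"
      using x f[of c x] cval_in[OF ok, of c x] cval_in[OF ok', of "capc a b c" x] by (intro exI[of _ x]) auto
  qed
  ultimately show ?thesis using sl ne by (simp add: wave_def)
qed

text \<open>A too steep last chain is replaced by a line; its right end is a free boundary.\<close>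

lemma wave_last:
  assumes ok: "okl (A @ [c])" and A: "\<forall>c\<in>set A. cpd a' b c \<and> sl c \<le> a" and a: "a \<le> sl c"
    and e: "cu e = cu c" "cv e = cv c" "\<And>x. cu c \<le> x \<Longrightarrow> x \<le> cv c \<Longrightarrow> cf e x = cf c (cu c) + a * (x - cu c)" "okc e"
  shows "okl (map (capc a b) A @ [e])" "wave a (A @ [c]) (map (capc a b) A @ [e])"
proof -
  let ?A = "map (capc a b) A" let ?ds = "?A @ [e]" and ?cs = "A @ [c]"
  have c: "okc c" "cu c \<le> cv c" using okl_okc[OF ok, of c] by auto
  have ok': "okl ?A" "adj (last A) c" "okl A" if "A \<noteq> []"
    using ok okl_append[of A "[c]"] that okl_capc[of A a b] A by (auto simp: cpd_def)
  show okd: "okl ?ds"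
  proof (cases "A = []")
    case False
    have l: "last A \<in> set A" using False by simp
    have "cf (capc a b (last A)) (cv (last A)) = cf (last A) (cv (last A))"
      using A l okl_okc[OF ok'(3)[OF False] l] by (intro cf_capc) (auto simp: cpd_def)
    then show ?thesis
      using ok'[OF False] False e(1,4) e(3)[of "cu c"] c okl_append[of ?A "[e]"]
      by (auto simp: adj_def last_map)
  qed (use e in simp)
  have ends: "cul ?ds = cul ?cs" "cvl ?ds = cvl ?cs" using e by (cases A; simp)+
  have bnd: "cul ?cs \<le> cu c" using okl_bounds[OF ok, of c] by simp
  have pc: "cval ?cs (cu c) = cf c (cu c)" "cval ?ds (cu c) = cf c (cu c)"
    using cval_in[OF ok, of c "cu c"] cval_in[OF okd, of e "cu c"] e(1,2) e(3)[of "cu c"] c by auto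
  \<comment> \<open>Up to \<open>cu c\<close> the witnesses come from the wave of \<open>A\<close>;
    beyond it the point at \<open>cu c\<close>, common to both graphs, serves.\<close>
  have last: "dom a (cul ?cs) (cvl ?cs) (cval ?cs) (cval ?ds) \<and> dom a (cul ?cs) (cvl ?cs) (cval ?ds) (cval ?cs)
    \<and> slope a (cul ?cs) (cvl ?cs) (cval ?ds)"
  proof (cases "A = []")
    case True
    have "dom a (cu c) (cv c) (cval [c]) (cval [e])" "dom a (cu c) (cv c) (cval [e]) (cval [c])"
      unfolding dom_def using e(1-3) c chain_above[OF c(1) a] by (force intro: exI[of _ "cu c"])+
    moreover have "slope a (cu c) (cv c) (cval [e])"
      by (rule slope_cong[OF slope_affine]) (use e(2,3) in auto)
    ultimately show ?thesis using True by simp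
  next
    case False
    have w: "wave a A ?A" using wave_capl[OF ok'(3)[OF False] A] .
    have m: "cvl A = cu c" "cul A \<le> cvl A" using ok'[OF False] okl_range[of A] by (auto simp: adj_def)
    have hd: "cul ?cs = cul A" "cvl ?cs = cv c" "cul ?A = cul A" "cvl ?A = cvl A" using False by simp_all
    have FA: "cval ?cs x = cval A x" "cval ?ds x = cval ?A x" if "x \<le> cu c" for x
      using cval_append1[OF ok False, of x] cval_append1[OF okd _, of x] that m hd False by auto
    have Fc: "cval ?cs x = cf c x" "cval ?ds x = cf c (cu c) + a * (x - cu c)" if "cu c \<le> x" "x \<le> cv c" for x
      using cval_in[OF ok, of c x] cval_in[OF okd, of e x] that e by auto
    have 1: "dom a (cul ?cs) (cvl ?cs) (cval ?cs) (cval ?ds)"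
      unfolding dom_def hd
    proof (intro allI impI)
      fix x assume x: "cul A \<le> x" "x \<le> cv c"
      show "\<exists>t\<ge>cul A. t \<le> x \<and> cval ?cs t + a * (x - t) \<le> cval ?ds x"
      proof (cases "x \<le> cu c")
        case True
        with w x m obtain t where "cul A \<le> t" "t \<le> x" "cval A t + a * (x - t) \<le> cval ?A x"
          unfolding wave_def dom_def by metis
        with FA[of t] FA[of x] True show ?thesis by (intro exI[of _ t]) auto
      next
        case False
        with x Fc[of x] pc m show ?thesis by (intro exI[of _ "cu c"]) auto
      qed
    qed
    have 2: "dom a (cul ?cs) (cvl ?cs) (cval ?ds) (cval ?cs)"
      unfolding dom_def hd
    proof (intro allI impI)
      fix x assume x: "cul A \<le> x" "x \<le> cv c"
      show "\<exists>t\<ge>cul A. t \<le> x \<and> cval ?ds t + a * (x - t) \<le> cval ?cs x"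
      proof (cases "x \<le> cu c")
        case True
        with w x m obtain t where "cul A \<le> t" "t \<le> x" "cval ?A t + a * (x - t) \<le> cval A x"
          unfolding wave_def dom_def by metis
        with FA[of t] FA[of x] True show ?thesis by (intro exI[of _ t]) auto
      next
        case False
        with x Fc[of x] pc m chain_above[OF c(1) a, of x] show ?thesis by (intro exI[of _ "cu c"]) auto
      qed
    qed
    have "slope a (cul A) (cu c) (cval ?ds)"
      by (rule slope_cong[of _ _ _ "cval ?A"]) (use w m FA in \<open>auto simp: wave_def\<close>)
    moreover have "slope a (cu c) (cv c) (cval ?ds)"
      by (rule slope_cong[OF slope_affine]) (use Fc in auto)
    ultimately have "slope a (cul ?cs) (cvl ?cs) (cval ?ds)"
      unfolding hd using m c by (auto intro: slope_append[of _ "cu c"])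
    with 1 2 show ?thesis by simp
  qed
  with ends show "wave a ?cs ?ds" unfolding wave_def by blast
qed

section \<open>Detaching the first steep chain and merging it into its neighbour\<close>

definition bad_post :: "nat \<Rightarrow> nat \<Rightarrow> chain list \<Rightarrow> real \<Rightarrow> val \<Rightarrow> nat \<Rightarrow> bool" where
  "bad_post n h cs a v t \<longleftrightarrow> (\<exists>Ao C Bo A c B. v = PairV (enco Ao) (PairV (enc C) (enco Bo)) \<and>
    repo n (Suc h) Ao A \<and> rep n 0 C [c] \<and> repo n (Suc h) Bo B \<and> cs = A @ c # B \<and> a < sl c \<and>
    (\<forall>d\<in>set A. sl d \<le> a) \<and> t \<le> 20000 * (h + 2)\<^sup>2)"

lemma bad_postI:
  "repo n (Suc h) Ao A \<Longrightarrow> rep n 0 C [c] \<Longrightarrow> repo n (Suc h) Bo B \<Longrightarrow> cs = A @ c # B \<Longrightarrow> a < sl c \<Longrightarrow>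
    (\<forall>d\<in>set A. sl d \<le> a) \<Longrightarrow> t \<le> 20000 * (h + 2)\<^sup>2 \<Longrightarrow>
    bad_post n h cs a (PairV (enco Ao) (PairV (enc C) (enco Bo))) t"
  unfolding bad_post_def by blast

lemma bad_postE:
  assumes "bad_post n h cs a v t"
  obtains Ao C Bo A c B where "v = PairV (enco Ao) (PairV (enc C) (enco Bo))" "repo n (Suc h) Ao A"
    "rep n 0 C [c]" "repo n (Suc h) Bo B" "cs = A @ c # B" "a < sl c" "\<forall>d\<in>set A. sl d \<le> a"
    "t \<le> 20000 * (h + 2)\<^sup>2"
  using assms unfolding bad_post_def by blast

lemma repo_mono: "repo n H To cs \<Longrightarrow> n \<le> n' \<Longrightarrow> H \<le> H' \<Longrightarrow> repo n' H' To cs"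
  unfolding repo_def by (auto split: option.splits dest: rep_mono order_trans)

lemma okl_sub:
  assumes "okl (A @ c # B)"
  shows "okc c" "A \<noteq> [] \<Longrightarrow> okl A" "B \<noteq> [] \<Longrightarrow> okl B" "okl (A @ [c])" "okl (c # B)"
  using assms okl_append[of A "c # B"] okl_append[of A "[c]"]
  by (cases B; cases "A = []"; simp)+

text \<open>The descent prefers the left child whenever its steepest chord exceeds \<open>a\<close>,
  so no chain before the one found is steep; the joins on the way back rebuild the two
  remainders.\<close>

lemma wp_bad:
  assumes "rep n h T cs" "a < mc T"
  shows "wp [enc T, RealV a] (prog ! 24) (bad_post n h cs a)"
  using assms
proof (induction h arbitrary: T cs rule: less_induct)
  case (less h)
  obtain c0 where c0: "c0 \<in> set cs" "sl c0 = mc T"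
    using rep_hdr[OF less.prems(1)] by (auto simp: hdr_def)
  show ?case
  proof (cases "h = 0")
    case True
    obtain c where c: "cs = [c]"
      using less.prems(1) True by (cases rule: rep.cases) auto
    have "bad_post n h cs a (PairV (enco None) (PairV (enc T) (enco None))) t" if "t \<le> 1000" for t
      by (rule bad_postI[where A = "[]" and B = "[]" and c = c])
        (use c less.prems True c0 that in \<open>auto simp: power2_eq_square\<close>)
    moreover have "kids T = Leaf \<or> (\<exists>B. kids T = Inner B)"
      using less.prems(1) True c rep_single_kids[of n T c] by simp
    ultimately show ?thesis
      unfolding prog_nth(25) badB_def by auto
  next
    case False
    then have "0 < h" by simp
    obtain L R hl hr ls rs k k' where Kk: "kids T = Branch k k'" and K: "eval prog [enc T] (prog ! 14) (enc L) 844"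
      "eval prog [enc T] (prog ! 15) (enc R) 844" "rep n hl L ls" "rep n hr R rs" "cs = ls @ rs"
      "h = Suc (max hl hr)" "hl \<le> Suc hr" "hr \<le> Suc hl" "okl cs" "ls \<noteq> []" "rs \<noteq> []"
      by (rule rep_splitE[OF less.prems(1) \<open>0 < h\<close>], rule that)
    have hlr: "hl < h" "hr < h" using K(6) by auto
    have sq: "20000 * (k + 2)\<^sup>2 + 8000 * (h + 3) + 5000 \<le> 20000 * (h + 2)\<^sup>2" if "k < h" for k
      using square_step[OF that, of 20000] by simp
    show ?thesis
    proof (cases "a < mc L")
      case True
      obtain Ao C Bo A c B t where 1: "eval prog [enc L, RealV a] (prog ! 24) (PairV (enco Ao) (PairV (enc C) (enco Bo))) t"
        "repo n (Suc hl) Ao A" "rep n 0 C [c]" "repo n (Suc hl) Bo B" "ls = A @ c # B" "a < sl c"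
        "\<forall>d\<in>set A. sl d \<le> a" "t \<le> 20000 * (hl + 2)\<^sup>2"
        using less.IH[OF hlr(1) K(3) True] by (elim wpE bad_postE) blast
      have ok: "okl (B @ rs)"
        using K(9) K(5,11) 1(5) okl_sub(3)[of A c "B @ rs"] by simp
      have "repo n h Bo B" "repo n h (Some R) rs"
        using repo_mono[OF 1(4)] hlr K(4) by (auto intro!: exI[of _ hr])
      from wp_joino[OF this ok] obtain Jo t' where 2: "eval prog [enco Bo, enc R] (prog ! 20) (enco Jo) t'"
        "repo n (Suc h) Jo (B @ rs)" "t' \<le> 8000 * (h + 2)"
        by (elim wpE) auto
      have "bad_post n h cs a (PairV (enco Ao) (PairV (enc C) (enco Jo))) s" if "s \<le> t + t' + 5000" for s
        by (rule bad_postI[where A = A and c = c, OF repo_mono[OF 1(2)] 1(3) 2(2)])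
          (use hlr 1 K(5) sq[OF hlr(1)] 2(3) that in auto)
      then show ?thesis
        unfolding prog_nth(25) badB_def using True
        by (simp add: Kk K(1,2)[THEN wp_det] 1(1)[THEN wp_det] 2(1)[THEN wp_det])
    next
      case False
      have ls: "sl d \<le> a" if "d \<in> set ls" for d
        using hdrD(6)[OF rep_hdr[OF K(3)] that] False by simp
      have "a < mc R"
        using c0 less.prems(2) K(5) ls[of c0] hdrD(6)[OF rep_hdr[OF K(4)], of c0] by fastforce
      from less.IH[OF hlr(2) K(4) this]
      obtain Ao C Bo A c B t where 1: "eval prog [enc R, RealV a] (prog ! 24) (PairV (enco Ao) (PairV (enc C) (enco Bo))) t"
        "repo n (Suc hr) Ao A" "rep n 0 C [c]" "repo n (Suc hr) Bo B" "rs = A @ c # B" "a < sl c"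
        "\<forall>d\<in>set A. sl d \<le> a" "t \<le> 20000 * (hr + 2)\<^sup>2"
        by (elim wpE bad_postE) blast
      have ok: "okl (ls @ A)"
        using K(9) K(5,10) 1(5) okl_sub(2)[of "ls @ A" c B] by simp
      have "repo n h (Some L) ls" "repo n h Ao A"
        using repo_mono[OF 1(2)] hlr K(3) by (auto intro!: exI[of _ hl])
      from wp_joino[OF this ok] obtain Jo t' where 2: "eval prog [enc L, enco Ao] (prog ! 20) (enco Jo) t'"
        "repo n (Suc h) Jo (ls @ A)" "t' \<le> 8000 * (h + 2)"
        by (elim wpE) auto
      have "bad_post n h cs a (PairV (enco Jo) (PairV (enc C) (enco Bo))) s" if "s \<le> t + t' + 5000" for s
        by (rule bad_postI[where B = B and c = c, OF 2(2) 1(3) repo_mono[OF 1(4)]])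
          (use hlr 1 K(5) sq[OF hlr(2)] 2(3) that ls in auto)
      then show ?thesis
        unfolding prog_nth(25) badB_def using False
        by (simp add: Kk K(1,2)[THEN wp_det] 1(1)[THEN wp_det] 2(1)[THEN wp_det])
    qed
  qed
qed

text \<open>If the line from the left end of \<open>c\<close> is still below the right end of
  \<open>d\<close>, both chains lie above it and a single chord can replace them; it is steep again
  and left to a later round. Otherwise the line crosses \<open>d\<close>, which is capped by it. The
  pieces of \<open>c\<close> are dropped in either case, so the bound grows only by materialising
  \<open>d\<close> and capping it.\<close>

lemma wp_merge:
  assumes C: "rep n 0 C [c]" and D: "rep n 0 D [d]" and ok: "okl [c, d]" and a: "a \<le> sl c" and p: "n < 2 ^ p"
  shows "wp [enc C, enc D, RealV a] (prog ! 25) (\<lambda>v t. \<exists>T e. v = enc T \<and> rep (n + 4) 0 T [e] \<and>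
    merged a c d e \<and> t \<le> 100000 * (2 * p + 4)\<^sup>2)"
proof -
  have c: "okc c" "okc d" "cv c = cu d" "cf c (cv c) = cf d (cu d)" using ok by (auto simp: adj_def)
  have le: "cu c \<le> cv c" "cu d \<le> cv d" using c okc_le by blast+
  note hc = hdrD(7-10)[OF rep_hdr[OF C]] and hd = hdrD(7-10)[OF rep_hdr[OF D]]
  have C': "xl C = cu c" "yl C = cf c (cu c)" using hc le by auto
  have D': "xr D = cv d" "yr D = cf d (cv d)" "xl D = cu d" "yl D = cf d (cu d)" using hd le by auto
  let ?l = "\<lambda>x. cf c (cu c) + a * (x - cu c)"
  have l: "?l x = (cf c (cu c) - a * cu c) + a * x" for x by (simp add: algebra_simps)
  \<comment> \<open>The chains meet, so the line enters \<open>d\<close> at or below its left end;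
    both cases need this.\<close>
  have ld: "?l (cu d) \<le> cf d (cu d)" using chain_above[OF c(1) a, of "cv c"] le c by simp
  have one: "1\<^sup>2 \<le> (2 * p + 4)\<^sup>2" by (intro power_mono) auto
  show ?thesis
  proof (cases "?l (cv d) < cf d (cv d)")
    case True
    have "cu c \<noteq> cv d"
    proof
      assume "cu c = cv d"
      with le c(3) have "cu d = cv d" "cu c = cv c" by linarith+
      with True c \<open>cu c = cv d\<close> show False by simp
    qed
    with le c(3) have lt: "cu c < cv d" by linarith
    let ?s = "(yr D - yl C) / (xr D - xl C)"
    let ?e = "linc (cu c) (cf c (cu c)) (cv d) ?s"
    have rep: "rep (n + 4) 0 (linT (xl C) (yl C) (xr D) (yr D)) [?e]"
      using rep_linT[of "xl C" "xr D" "yl C" "yr D"] lt C' D' by simp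
    have "a \<le> ?s" using True lt C' D' by (simp add: pos_le_divide_eq)
    then have e: "?l x \<le> cf ?e x" if "cu c \<le> x" "x \<le> cv d" for x
    proof -
      have "a * (x - cu c) \<le> ?s * (x - cu c)" using \<open>a \<le> ?s\<close> that(1) by (intro mult_right_mono) auto
      then show ?thesis using that by (simp add: cf_linc del: times_divide_eq_left)
    qed
    have d: "?l x \<le> cf d x" if "cu d \<le> x" "x \<le> cv d" for x
      unfolding l by (rule conc_above[OF okc_conc[OF c(2)], of "cu d" _ "cv d"]) (use that le ld True l in auto)
    have "cf ?e (cv d) = cf d (cv d)" using lt C' D' by (simp add: cf_linc)
    moreover have "cf ?e (cu c) = cf c (cu c)" using lt by (simp add: cf_linc)
    moreover have "?l x \<le> cf ?e x" if "cu c \<le> x" "x \<le> cv c" for x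
      using e[OF that(1)] that(2) le c(3) by linarith
    moreover have "?l x \<le> cf ?e x" if "cu d \<le> x" "x \<le> cv d" for x
      using e[OF _ that(2)] that(1) le c(3) by linarith
    ultimately have "merged a c d ?e"
      unfolding merged_def using d by simp
    moreover have "s \<le> 100000 * (2 * p + 4)\<^sup>2" if "s \<le> 1000" for s
      using one that unfolding power_one by linarith
    ultimately show ?thesis
      unfolding prog_nth(26) mergeB_def using True C' D' rep by (simp, blast)
  next
    case False
    obtain M t where 1: "eval prog [enc D] (prog ! 22) (enc M) t" "mated n p d M" "t \<le> 50000 * (2 * p + 3)\<^sup>2"
      using wp_mat[OF D p] by (elim wpE) auto
    then obtain h bs where B: "rep 0 h M bs" and sim: "sim (glue bs) d" and len: "length bs \<le> n + 3"
      and h: "h \<le> 2 * p + 2"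
      unfolding mated_def by auto
    have bs: "cul bs = cu d" "cvl bs = cv d" "cval bs = cf d" using sim by (simp_all add: sim_def)
    have "wp [enc M, RealV (xl C), RealV (yl C), RealV a] (prog ! 21) (\<lambda>v t. \<exists>T' h' bs'. v = enc T' \<and>
      rep 0 h' T' bs' \<and> h' \<le> Suc h \<and> length bs' \<le> Suc (length bs) \<and> capped bs (xl C) (yl C) a bs' \<and>
      t \<le> 20000 * (h + 2)\<^sup>2)"
      by (rule wp_capl[OF B]) (use bs C' c ld le False okc_conc[OF c(2)] in auto)
    then obtain T' h' bs' t' where 2: "eval prog [enc M, RealV (xl C), RealV (yl C), RealV a] (prog ! 21) (enc T') t'"
      "rep 0 h' T' bs'" "length bs' \<le> Suc (length bs)" "capped bs (xl C) (yl C) a bs'" "t' \<le> 20000 * (h + 2)\<^sup>2"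
      by (elim wpE) auto
    have b: "cul bs' = cu c" "cvl bs' = cv d" "\<And>x. cu c \<le> x \<Longrightarrow> x \<le> cv d \<Longrightarrow>
      cval bs' x = (if x < cu d then ?l x else min (cf d x) (?l x))"
      using 2(4) C' bs by (auto simp: capped_def)
    have "conc (cu c) (cv d) (\<lambda>x. if x < cu d then (cf c (cu c) - a * cu c) + a * x else
      min (cf d x) ((cf c (cu c) - a * cu c) + a * x))"
      using ld l le c by (intro conc_extend okc_conc) auto
    then have conc: "conc (cul bs') (cvl bs') (cval bs')"
      unfolding b(1,2) by (rule conc_cong) (simp only: b(3) l)
    have rep: "rep (n + 4) 0 (chainT T') [glue bs']"
      by (rule rep_chainT[OF 2(2) _ conc]) (use 2(3) len in simp)
    have cd: "cu c \<le> cv d" using le c(3) by linarith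
    have "cval bs' (cu c) = cf c (cu c)"
      using b(3)[OF order_refl cd] ld le(1) c(3) by (cases "cu c < cu d") auto
    moreover have "cval bs' (cv d) = cf d (cv d)"
      using b(3)[OF cd order_refl] False le(2) by (simp add: min_def)
    moreover have "?l x \<le> cval bs' x" if "cu c \<le> x" "x \<le> cv c" for x
    proof -
      have "x \<le> cv d" using that(2) le(2) c(3) by linarith
      then show ?thesis using b(3)[OF that(1)] ld that(2) c(3) by (cases "x = cu d") auto
    qed
    moreover have "cval bs' x = cf d x \<or> ?l x \<le> cval bs' x \<and> ?l x \<le> cf d x" if "cu d \<le> x" "x \<le> cv d" for x
      using b(3)[OF _ that(2)] that(1) le(1) c(3) by (auto simp: min_def)
    ultimately have "merged a c d (glue bs')"
      unfolding merged_def using b(1,2) by simp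
    moreover have "t + t' + 2000 \<le> 100000 * (2 * p + 4)\<^sup>2"
    proof -
      have "(h + 2)\<^sup>2 \<le> (2 * p + 4)\<^sup>2" "(2 * p + 3)\<^sup>2 \<le> (2 * p + 4)\<^sup>2"
        using h by (intro power_mono; simp)+
      then show ?thesis using 1(3) 2(5) one unfolding power_one by linarith
    qed
    ultimately show ?thesis
      unfolding prog_nth(26) mergeB_def using False C' D' rep
      by (simp add: 1(1)[THEN wp_det] 2(1)[THEN wp_det, unfolded C'])
        (intro exI[of _ "chainT T'"] conjI refl exI[of _ "glue bs'"], simp_all)
  qed
qed

text \<open>The right cap is the one already satisfied, so only the left cap has an effect.\<close>

lemma wp_capo:
  assumes "repo n H Ao A" "\<forall>c\<in>set A. sl c \<le> a"
  shows "\<exists>A' b b' t. eval prog [enco Ao, RealV a] (prog ! 27) (enco A') t \<and> repo n H A' (map (capc a b) A) \<and>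
    (\<forall>c\<in>set A. cpd b' b c \<and> sl c \<le> a) \<and> t \<le> 1000"
proof (cases Ao)
  case None
  have "wp [NilV, RealV a] (prog ! 27) (\<lambda>v t. v = NilV \<and> t \<le> 1000)"
    unfolding prog_nth(28) capoB_def by simp
  then show ?thesis
    using None assms by (elim wpE) (auto intro!: exI[of _ None])
next
  case (Some T)
  with assms(1) obtain h where T: "h \<le> H" "rep n h T A" by auto
  note hdr = hdrD[OF rep_hdr[OF T(2)]]
  have "mc T \<le> a" using rep_hdr[OF T(2)] assms(2) by (auto simp: hdr_def)
  then have "rep n h (capT a (sb T) T) (map (capc a (sb T)) A)"
    using hdr(12) by (intro rep_capT[OF T(2)])
  moreover have "wp [enc T, RealV a] (prog ! 27) (\<lambda>v t. v = enc (capT a (sb T) T) \<and> t \<le> 1000)"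
    unfolding prog_nth(28) capoB_def by simp
  ultimately show ?thesis
    using Some T(1) hdr(3) assms(2)
    by (elim wpE) (intro exI[of _ "Some (capT a (sb T) T)"] exI[of _ "sb T"] exI[of _ "sa T"], auto)
qed

section \<open>Chains with integer ends and the complete wave\<close>

definition intl :: "chain list \<Rightarrow> bool" where
  "intl cs \<longleftrightarrow> (\<forall>c\<in>set cs. cu c \<in> \<int> \<and> cv c \<in> \<int>)"

lemma rep_cpd: "rep n h T cs \<Longrightarrow> c \<in> set cs \<Longrightarrow> cpd (sa T) (sb T) c"
  using rep_hdr hdrD(3) by blast

lemma step_bound: "k \<le> 2 * p + 4 \<Longrightarrow> k\<^sup>2 \<le> (2 * p + 4)\<^sup>2" for k p :: nat
  by (intro power_mono) auto

text \<open>\<open>k\<close> counts the merges: each one removes a chain, raises the bound on the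
  pieces by 4, and costs at most one further unit of time.\<close>

definition wave_post :: "nat \<Rightarrow> real \<Rightarrow> chain list \<Rightarrow> nat \<Rightarrow> val \<Rightarrow> nat \<Rightarrow> bool" where
  "wave_post n a cs p v t \<longleftrightarrow> (\<exists>T h ds k. v = enc T \<and> rep (n + 4 * k) h T ds \<and> intl ds \<and>
    length ds + k = length cs \<and> wave a cs ds \<and> t \<le> (k + 1) * (1000000 * (2 * p + 4)\<^sup>2))"

lemma wave_postI:
  "rep (n + 4 * k) h T ds \<Longrightarrow> intl ds \<Longrightarrow> length ds + k = length cs \<Longrightarrow> wave a cs ds \<Longrightarrow>
    t \<le> (k + 1) * (1000000 * (2 * p + 4)\<^sup>2) \<Longrightarrow> wave_post n a cs p (enc T) t"
  unfolding wave_post_def by blast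

lemma wave_postE:
  assumes "wave_post n a cs p v t"
  obtains T h ds k where "v = enc T" "rep (n + 4 * k) h T ds" "intl ds" "length ds + k = length cs"
    "wave a cs ds" "t \<le> (k + 1) * (1000000 * (2 * p + 4)\<^sup>2)"
  using assms unfolding wave_post_def by blast

text \<open>A merge raises \<open>n\<close> by 4 and lowers the number of chains by one, so
  \<open>n + 4 * length cs\<close> is invariant and the same \<open>p\<close> bounds all heights
  throughout the recursion.\<close>

lemma wp_wave:
  assumes "rep n h T cs" "intl cs" "n + 4 * length cs < 2 ^ p"
  shows "wp [enc T, RealV a] (prog ! 26) (wave_post n a cs p)"
  using assms
proof (induction "length cs" arbitrary: n h T cs rule: less_induct)
  case less
  let ?W = "1000000 * (2 * p + 4)\<^sup>2"
  note rep = less.prems(1)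
  note ok = rep_okl[OF rep]
  have lp: "length cs < 2 ^ p" using less.prems(3) by simp
  have h: "h \<le> 2 * p" using rep_height[OF rep lp] .
  have one: "1 \<le> (2 * p + 4)\<^sup>2" "2 * p + 4 \<le> (2 * p + 4)\<^sup>2"
    by (simp_all add: power2_eq_square algebra_simps)
  show ?case
  proof (cases "a < mc T")
    case False
    then have sl: "sl c \<le> a" if "c \<in> set cs" for c using hdrD(6)[OF rep_hdr[OF rep] that] by simp
    have "rep n h (capT a (sb T) T) (map (capc a (sb T)) cs)"
      using False hdrD(12)[OF rep_hdr[OF rep]] by (intro rep_capT[OF rep]) auto
    moreover have "wave a cs (map (capc a (sb T)) cs)"
      using sl rep_cpd[OF rep] by (intro wave_capl[OF ok]) auto
    moreover have "intl (map (capc a (sb T)) cs)" using less.prems(2) by (simp add: intl_def)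
    moreover have "t \<le> (0 + 1) * ?W" if "t \<le> 1000" for t using that one by simp
    ultimately show ?thesis
      unfolding prog_nth(27) waveB_def using False
      by simp (rule wave_postI[where k = 0 and h = h and ds = "map (capc a (sb T)) cs"], simp_all)
  next
    case True
    obtain Ao C Bo A c B t where 1: "eval prog [enc T, RealV a] (prog ! 24) (PairV (enco Ao) (PairV (enc C) (enco Bo))) t"
      "repo n (Suc h) Ao A" "rep n 0 C [c]" "repo n (Suc h) Bo B" "cs = A @ c # B" "a < sl c"
      "\<forall>d\<in>set A. sl d \<le> a" "t \<le> 20000 * (h + 2)\<^sup>2"
      using wp_bad[OF rep True] by (elim wpE bad_postE) blast
    note okA = okl_sub[OF ok[unfolded 1(5)]]
    have C: "xl C = cu c" "xr C = cv c" "yl C = cf c (cu c)"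
      using hdrD(7-9)[OF rep_hdr[OF 1(3)]] okc_le[OF okA(1)] by auto
    have t: "t \<le> 20000 * (2 * p + 4)\<^sup>2"
    proof -
      have "(h + 2)\<^sup>2 \<le> (2 * p + 4)\<^sup>2" by (rule step_bound) (use h in simp)
      then show ?thesis using 1(8) by linarith
    qed
    show ?thesis
    proof (cases Bo)
      case None
      then have B: "B = []" using 1(4) by simp
      obtain A' b b' t' where 2: "eval prog [enco Ao, RealV a] (prog ! 27) (enco A') t'"
        "repo n (Suc h) A' (map (capc a b) A)" "\<forall>c\<in>set A. cpd b' b c \<and> sl c \<le> a" "t' \<le> 1000"
        using wp_capo[OF 1(2,7)] by blast
      let ?y = "cf c (cu c) + a * (cv c - cu c)"
      let ?s = "(?y - cf c (cu c)) / (cv c - cu c)"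
      let ?e = "linc (cu c) (cf c (cu c)) (cv c) ?s"
      let ?E = "linT (cu c) (cf c (cu c)) (cv c) ?y"
      have E: "rep n 0 ?E [?e]"
        using okc_le[OF okA(1)] by (intro rep_linT) auto
      have e: "cf ?e x = cf c (cu c) + a * (x - cu c)" if "cu c \<le> x" "x \<le> cv c" for x
        using that by (cases "cu c = cv c") (auto simp: cf_linc)
      have w: "okl (map (capc a b) A @ [?e])" "wave a (A @ [c]) (map (capc a b) A @ [?e])"
        using wave_last[OF okA(4) 2(3) less_imp_le[OF 1(6)], of ?e] e rep_okl[OF E] by auto
      have "repo n (Suc h) (Some ?E) [?e]" using E by auto
      from wp_joino[OF 2(2) this w(1)] obtain J t'' where
        3: "eval prog [enco A', enc ?E] (prog ! 20) (enco J) t''" "repo n (Suc (Suc h)) J (map (capc a b) A @ [?e])"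
        "t'' \<le> 8000 * (Suc h + 2)"
        unfolding enco.simps by (elim wpE) blast
      then obtain T' h' where J: "J = Some T'" "rep n h' T' (map (capc a b) A @ [?e])"
        by (cases J) auto
      have "intl (map (capc a b) A @ [?e])" using less.prems(2) 1(5) B by (auto simp: intl_def)
      moreover have "t + t' + t'' + 5000 \<le> (0 + 1) * ?W"
        using t 2(4) 3(3) one h by simp
      moreover have "length (map (capc a b) A @ [?e]) + 0 = length cs" using 1(5) B by simp
      ultimately show ?thesis
        unfolding prog_nth(27) waveB_def using True None J(2) w(2) 1(5) B
        by (simp add: 1(1)[THEN wp_det] C 2(1)[THEN wp_det] 3(1)[THEN wp_det, unfolded J(1)])
          (rule wave_postI[where k = 0 and h = h' and ds = "map (capc a b) A @ [?e]"], simp_all)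
    next
      case (Some B0)
      then obtain hB where B0: "rep n hB B0 B" "hB \<le> Suc h" using 1(4) by auto
      have "nc B0 - 1 < mc B0"
        using rep_hdr[OF B0(1)] by (auto simp: hdr_def)
      from wp_bad[OF B0(1) this]
      obtain Xo D Bo' X d B' t2 where 2: "eval prog [enc B0, RealV (nc B0 - 1)] (prog ! 24) (PairV (enco Xo) (PairV (enc D) (enco Bo'))) t2"
        "repo n (Suc hB) Xo X" "rep n 0 D [d]" "repo n (Suc hB) Bo' B'" "B = X @ d # B'"
        "\<forall>d\<in>set X. sl d \<le> nc B0 - 1" "t2 \<le> 20000 * (hB + 2)\<^sup>2"
        by (elim wpE bad_postE) blast
      have "X = []"
        using 2(5,6) hdrD(5)[OF rep_hdr[OF B0(1)]] by (cases X) fastforce+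
      then have B: "B = d # B'" using 2(5) by simp
      have okcd: "okl (A @ c # d # B')" using ok 1(5) B by simp
      have cd: "okl [c, d]" using okA(5) unfolding B by (cases B') auto
      have np: "n < 2 ^ p" using less.prems(3) by simp
      obtain E e t3 where 3: "eval prog [enc C, enc D, RealV a] (prog ! 25) (enc E) t3" "rep (n + 4) 0 E [e]"
        "merged a c d e" "t3 \<le> 100000 * (2 * p + 4)\<^sup>2"
        using wp_merge[OF 1(3) 2(3) cd less_imp_le[OF 1(6)] np] by (elim wpE) auto
      have oke: "okc e" using rep_okl[OF 3(2)] by simp
      have ok': "okl (A @ e # B')" using merged_okl[OF okcd oke 3(3)] .
      have H: "repo (n + 4) (h + 2) (Some E) [e]" "repo (n + 4) (h + 2) Bo' B'" "repo (n + 4) (h + 3) Ao A"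
        using 3(2) repo_mono[OF 2(4)] B0(2) repo_mono[OF 1(2)] by auto
      have "okl ([e] @ B')" using okl_sub(5)[OF ok'] by simp
      from wp_joino[OF H(1,2) this] obtain J t4 where
        4: "eval prog [enc E, enco Bo'] (prog ! 20) (enco J) t4" "repo (n + 4) (Suc (h + 2)) J ([e] @ B')"
        "t4 \<le> 8000 * ((h + 2) + 2)"
        unfolding enco.simps by (elim wpE) blast
      have "Suc (h + 2) = h + 3" by simp
      note J4 = 4(2)[unfolded this]
      have "okl (A @ [e] @ B')" using ok' by simp
      from wp_joino[OF H(3) J4 this] obtain J' t5 where
        5: "eval prog [enco Ao, enco J] (prog ! 20) (enco J') t5" "repo (n + 4) (Suc (h + 3)) J' (A @ [e] @ B')"
        "t5 \<le> 8000 * ((h + 3) + 2)"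
        by (elim wpE) blast
      then obtain T' h' where J: "J' = Some T'" "rep (n + 4) h' T' (A @ e # B')"
        by (cases J') auto
      have len: "length cs = Suc (length (A @ e # B'))" using 1(5) B by simp
      have int: "intl (A @ e # B')"
        using less.prems(2) 1(5) B 3(3) by (auto simp: intl_def merged_def)
      have "wp [enc T', RealV a] (prog ! 26) (wave_post (n + 4) a (A @ e # B') p)"
        by (rule less.hyps[OF _ J(2) int]) (use len less.prems(3) in auto)
      then obtain T2 h2 ds k t6 where 6: "eval prog [enc T', RealV a] (prog ! 26) (enc T2) t6"
        "rep (n + 4 + 4 * k) h2 T2 ds" "intl ds" "length ds + k = length (A @ e # B')"
        "wave a (A @ e # B') ds" "t6 \<le> (k + 1) * ?W"
        by (elim wpE wave_postE) blast
      have "rep (n + 4 * Suc k) h2 T2 ds" using 6(2) by (simp add: add_ac)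
      moreover have "wave a cs ds"
        using merged_wave[OF okcd oke 3(3) less_imp_le[OF 1(6)] 6(5)] 1(5) B by simp
      moreover have "length ds + Suc k = length cs" using 6(4) len by simp
      moreover have "t + t2 + t3 + t4 + t5 + t6 + 5000 \<le> (Suc k + 1) * ?W"
      proof -
        have "(hB + 2)\<^sup>2 \<le> (2 * p + 4)\<^sup>2" by (rule step_bound) (use h B0(2) in simp)
        then have "t2 \<le> 20000 * (2 * p + 4)\<^sup>2" using 2(7) by linarith
        then have "t + t2 + t3 + t4 + t5 + 5000 \<le> ?W"
          using t 3(4) 4(3) 5(3) one h by simp
        then show ?thesis using 6(6) by simp
      qed
      ultimately show ?thesis
        unfolding prog_nth(27) waveB_def using True Some 6(3)
        by (simp add: 1(1)[THEN wp_det] 2(1)[THEN wp_det] 3(1)[THEN wp_det] 4(1)[THEN wp_det]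
          5(1)[THEN wp_det, unfolded J(1)] 6(1)[THEN wp_det])
          (rule wave_postI[where k = "Suc k" and h = h2 and ds = ds], simp_all)
    qed
  qed
qed

section \<open>From minima over real intervals to minima over array positions\<close>

lemma Min_eq:
  fixes S :: "nat set"
  assumes "finite S" "t \<in> S" "f t \<le> (m::real)" "\<And>s. s \<in> S \<Longrightarrow> m \<le> f s"
  shows "(MIN s\<in>S. f s) = m"
proof (rule antisym)
  have "(MIN s\<in>S. f s) \<le> f t" using assms by (intro Min_le) auto
  then show "(MIN s\<in>S. f s) \<le> m" using assms(3) by simp
  show "m \<le> (MIN s\<in>S. f s)" using assms by (subst Min_ge_iff) auto
qed

text \<open>Take the chain that contains a real witness \<open>t\<close>. Its supporting line at
  \<open>t\<close> shows that moving \<open>t\<close> to the left end of the chain, or to the right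
  as far as its right end or \<open>x\<close>, depending on how the slope compares with
  \<open>a\<close>, does not increase the candidate value. Both targets are integers.\<close>

lemma wave_int:
  assumes ok: "okl cs" and int: "intl cs" and w: "wave a cs ds" and x: "x \<in> \<int>" "cul cs \<le> x" "x \<le> cvl cs"
  shows "\<exists>t\<in>\<int>. cul cs \<le> t \<and> t \<le> x \<and> cval cs t + a * (x - t) \<le> cval ds x"
    and "\<And>t. cul cs \<le> t \<Longrightarrow> t \<le> x \<Longrightarrow> cval ds x \<le> cval cs t + a * (x - t)"
proof -
  from w x obtain t where t: "cul cs \<le> t" "t \<le> x" "cval cs t + a * (x - t) \<le> cval ds x"
    unfolding wave_def dom_def by blast
  have "cul cs \<le> t" "t \<le> cvl cs" using t x by auto
  then obtain c where c: "c \<in> set cs" "cu c \<le> t" "t \<le> cv c" by (rule cval_ex[OF ok])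
  \<comment> \<open>The move to the right has to stop at \<open>x\<close>, which is why
    \<open>x\<close> itself must be an integer.\<close>
  let ?v = "min (cv c) x"
  have v: "t \<le> ?v" "?v \<le> cv c" "?v \<in> \<int>" "cu c \<in> \<int>" "cul cs \<le> cu c"
    using c t x int okl_bounds[OF ok c(1)] by (auto simp: min_def intl_def)
  have val: "cval cs y = cf c y" if "cu c \<le> y" "y \<le> cv c" for y using cval_in[OF ok c(1) that] .
  obtain k where k: "\<And>y. cu c \<le> y \<Longrightarrow> y \<le> cv c \<Longrightarrow> cf c y \<le> cf c t + k * (y - t)"
    using okc_conc[OF okl_okc[OF ok c(1)]] c by (elim concE[of _ _ _ t]) auto
  show "\<exists>t\<in>\<int>. cul cs \<le> t \<and> t \<le> x \<and> cval cs t + a * (x - t) \<le> cval ds x"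
  proof (cases "a \<le> k")
    case True
    have "(k - a) * (cu c - t) \<le> 0" using True c by (simp add: mult_nonneg_nonpos)
    then have "cval cs (cu c) + a * (x - cu c) \<le> cval cs t + a * (x - t)"
      using k[of "cu c"] val[of "cu c"] val[of t] c by (simp add: algebra_simps)
    with t(3) have "cval cs (cu c) + a * (x - cu c) \<le> cval ds x" by linarith
    with v c t show ?thesis by (intro bexI[of _ "cu c"]) auto
  next
    case False
    have "(k - a) * (?v - t) \<le> 0" using False v by (simp add: mult_nonpos_nonneg)
    moreover have "cval cs ?v \<le> cval cs t + k * (?v - t)"
      using k[of ?v] val[of ?v] val[of t] c v by simp
    ultimately have "cval cs ?v + a * (x - ?v) \<le> cval cs t + a * (x - t)"
      unfolding left_diff_distrib right_diff_distrib by linarith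
    with t(3) have "cval cs ?v + a * (x - ?v) \<le> cval ds x" by linarith
    with v c t show ?thesis by (intro bexI[of _ ?v]) auto
  qed
  fix t assume t: "cul cs \<le> t" "t \<le> x"
  with w x have "cval ds x \<le> cval ds t + a * (x - t)"
    unfolding wave_def slope_def by auto
  moreover obtain s where s: "cul cs \<le> s" "s \<le> t" "cval ds s + a * (t - s) \<le> cval cs t"
    using w t x unfolding wave_def dom_def by (meson order_trans)
  moreover have "cval ds x \<le> cval ds s + a * (x - s)"
    using w x s t unfolding wave_def slope_def by auto
  moreover have "a * (x - s) = a * (t - s) + a * (x - t)" by (simp add: algebra_simps)
  ultimately show "cval ds x \<le> cval cs t + a * (x - t)" by linarith
qed

lemma Ints_nat:
  assumes "t \<in> \<int>" "real i \<le> t"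
  obtains m where "t = real m" "i \<le> m"
proof -
  from assms(1) obtain z where z: "t = of_int z" by (auto elim: Ints_cases)
  then have "0 \<le> z" using assms(2) by (metis of_int_0_le_iff of_nat_0_le_iff order_trans)
  then have "t = real (nat z)" using z by simp
  with assms(2) that show ?thesis by simp
qed

lemma left_wave_Min:
  assumes "okl cs" "intl cs" "wave a cs ds" "cul cs = real i" "cvl cs = real j" "i \<le> k" "k \<le> j"
  shows "(MIN t\<in>{i..k}. cval cs (real t) + (real k - real t) * a) = cval ds (real k)"
proof -
  have k: "real k \<in> \<int>" "cul cs \<le> real k" "real k \<le> cvl cs" using assms by auto
  note w = wave_int[OF assms(1-3) k]
  from w(1) obtain t where t: "t \<in> \<int>" "real i \<le> t" "t \<le> real k" "cval cs t + a * (real k - t) \<le> cval ds (real k)"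
    using assms by auto
  obtain m where m: "t = real m" "i \<le> m" by (rule Ints_nat[OF t(1,2)])
  show ?thesis
    by (rule Min_eq[of _ m]) (use m t w(2) assms in \<open>auto simp: mult.commute\<close>)
qed

lemma intl_mirc: "intl cs \<Longrightarrow> intl (map mirc (rev cs))"
  by (auto simp: intl_def)

lemma right_wave_Min:
  assumes ok: "okl cs" and int: "intl cs" and w: "wave a (map mirc (rev cs)) ds"
    and ij: "cul cs = real i" "cvl cs = real j" "i \<le> k" "k \<le> j"
  shows "(MIN t\<in>{k..j}. cval cs (real t) + (real t - real k) * a) = cval ds (- real k)"
proof -
  have ne: "cs \<noteq> []" using ok by auto
  let ?m = "map mirc (rev cs)"
  have k: "- real k \<in> \<int>" "cul ?m \<le> - real k" "- real k \<le> cvl ?m" using ij ne by auto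
  note w = wave_int[OF okl_mirc[OF ok] intl_mirc[OF int] w k, unfolded cval_mirc[OF ok]]
  from w(1) obtain t where t: "t \<in> \<int>" "- real j \<le> t" "t \<le> - real k" "cval cs (- t) + a * (- real k - t) \<le> cval ds (- real k)"
    using ij ne by auto
  have "- t \<in> \<int>" "real k \<le> - t" using t by auto
  then obtain m where m: "- t = real m" "k \<le> m" by (rule Ints_nat)
  show ?thesis
  proof (rule Min_eq[of _ m])
    show "m \<in> {k..j}" using m t by auto
    show "cval cs (real m) + (real m - real k) * a \<le> cval ds (- real k)"
    proof -
      have "t = - real m" using m(1) by simp
      with t(4) show ?thesis by (simp add: algebra_simps)
    qed
    fix s assume "s \<in> {k..j}"
    then show "cval ds (- real k) \<le> cval cs (real s) + (real s - real k) * a"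
      using w(2)[of "- real s"] ij ne by (simp add: algebra_simps)
  qed simp
qed

lemma intl_append [simp]: "intl (A @ B) \<longleftrightarrow> intl A \<and> intl B"
  by (auto simp: intl_def)

lemma intl_Cons [simp]: "intl (c # B) \<longleftrightarrow> cu c \<in> \<int> \<and> cv c \<in> \<int> \<and> intl B"
  by (auto simp: intl_def)

lemma intl_Nil [simp]: "intl []"
  by (simp add: intl_def)

lemma cuts_intl: "cuts cs m ps qs \<Longrightarrow> intl cs \<Longrightarrow> m \<in> \<int> \<Longrightarrow> intl ps \<and> intl qs"
  by (auto simp: cuts_def)

section \<open>The range operations\<close>

definition isarr :: "nat \<Rightarrow> tree \<Rightarrow> chain list \<Rightarrow> real \<Rightarrow> real \<Rightarrow> bool" where
  "isarr n T cs l r \<longleftrightarrow> (\<exists>h. rep n h T cs) \<and> intl cs \<and> cul cs = l \<and> cvl cs = r"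

lemma isarrI: "rep n h T cs \<Longrightarrow> intl cs \<Longrightarrow> cul cs = l \<Longrightarrow> cvl cs = r \<Longrightarrow> isarr n T cs l r"
  unfolding isarr_def by blast

lemma isarr_sel:
  assumes "isarr n T cs l r"
  shows "okl cs" "xl T = l" "yl T = cval cs l" "xr T = r" "yr T = cval cs r" "l \<le> r" "intl cs" "cul cs = l" "cvl cs = r"
    "l \<in> \<int>" "r \<in> \<int>"
proof -
  obtain h where r: "rep n h T cs" and e: "intl cs" "cul cs = l" "cvl cs = r" using assms unfolding isarr_def by blast
  note hdr = hdrD[OF rep_hdr[OF r]]
  show "okl cs" "xl T = l" "yl T = cval cs l" "xr T = r" "yr T = cval cs r" "intl cs" "cul cs = l" "cvl cs = r" "l \<le> r"
    using hdr e okl_range[OF hdr(1)] by auto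
  have "hd cs \<in> set cs" "last cs \<in> set cs" using hdr(2) by auto
  then show "l \<in> \<int>" "r \<in> \<int>" using e unfolding intl_def by auto
qed

lemma isarr_mono: "isarr n T cs l r \<Longrightarrow> n \<le> m \<Longrightarrow> isarr m T cs l r"
  unfolding isarr_def using rep_mono by blast

text \<open>Bounds one split, one join or one round of a wave when fewer than \<open>2 ^ p\<close>
  chains and pieces occur: heights are then at most about \<open>2 * p\<close>, and each level may
  cost a join.\<close>

definition cost :: "nat \<Rightarrow> nat" where
  "cost p = 1000000 * (2 * p + 4)\<^sup>2"

lemma cost_ge: "1000000 \<le> cost p"
  by (simp add: cost_def power2_eq_square algebra_simps)

lemma split_isarr:
  assumes T: "isarr n T cs l r" and m: "m \<in> \<int>" "l \<le> m" "m \<le> r" and p: "n + 4 * length cs < 2 ^ p"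
  obtains P Q ps qs t where "eval prog [enc T, RealV m] (prog ! 23) (PairV (enc P) (enc Q)) t"
    "isarr (n + 4) P ps l m" "isarr (n + 4) Q qs m r" "length ps + length qs = Suc (length cs)"
    "\<forall>x\<le>m. cval ps x = cval cs x" "\<forall>x\<ge>m. cval qs x = cval cs x" "t \<le> cost p"
    "length ps \<le> length cs" "length qs \<le> length cs"
proof -
  obtain h where rep: "rep n h T cs" and e: "intl cs" "cul cs = l" "cvl cs = r" using T unfolding isarr_def by blast
  have p': "n < 2 ^ p" "length cs < 2 ^ p" using p by auto
  have "wp [enc T, RealV m] (prog ! 23) (split_post (n + 4) h cs m (20000 * (h + 2)\<^sup>2 + 100000 * (2 * p + 4)\<^sup>2))"
    using m e by (intro wp_split[OF p'(1) rep]) auto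
  then obtain P Q ps qs hp hq t where 1: "eval prog [enc T, RealV m] (prog ! 23) (PairV (enc P) (enc Q)) t"
    "rep (n + 4) hp P ps" "rep (n + 4) hq Q qs" "cuts cs m ps qs" "t \<le> 20000 * (h + 2)\<^sup>2 + 100000 * (2 * p + 4)\<^sup>2"
    by (elim wpE split_postE) blast
  note c = cuts_cval[OF 1(4) rep_okl[OF rep] rep_okl[OF 1(2)] rep_okl[OF 1(3)]]
  note i = cuts_intl[OF 1(4) e(1) m(1)]
  have "(h + 2)\<^sup>2 \<le> (2 * p + 4)\<^sup>2" by (rule step_bound) (use rep_height[OF rep p'(2)] in simp)
  then have "t \<le> cost p" unfolding cost_def using 1(5) by linarith
  moreover have "ps \<noteq> []" "qs \<noteq> []" using rep_okl[OF 1(2)] rep_okl[OF 1(3)] by auto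
  then have "0 < length ps" "0 < length qs" by simp_all
  with c(9) have "length ps \<le> length cs" "length qs \<le> length cs" by linarith+
  ultimately show ?thesis
    using that[OF 1(1)] isarrI[OF 1(2), of l m] isarrI[OF 1(3), of m r] c i e by auto
qed

lemma join_isarr:
  assumes P: "isarr n P ps l m" and Q: "isarr n Q qs m r" and v: "cval ps m = cval qs m"
    and p: "length ps < 2 ^ p" "length qs < 2 ^ p"
  obtains T t where "eval prog [enc P, enc Q] (prog ! 20) (enc T) t" "isarr n T (ps @ qs) l r"
    "\<And>x. x \<le> m \<Longrightarrow> cval (ps @ qs) x = cval ps x" "\<And>x. m \<le> x \<Longrightarrow> cval (ps @ qs) x = cval qs x" "t \<le> cost p"
proof -
  obtain h k where rep: "rep n h P ps" "rep n k Q qs" using P Q unfolding isarr_def by blast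
  note p1 = isarr_sel[OF P] and q1 = isarr_sel[OF Q]
  have ne: "ps \<noteq> []" "qs \<noteq> []" using p1(1) q1(1) by auto
  have ok: "okl (ps @ qs)" using p1 q1 v by (intro okl_appendI) auto
  obtain T j t where 1: "eval prog [enc P, enc Q] (prog ! 20) (enc T) t" "rep n j T (ps @ qs)"
    "t \<le> 8000 * (max h k + 2)"
    using wp_join[OF rep ok] by (elim wpE) blast
  have "max h k \<le> 2 * p" using rep_height[OF rep(1) p(1)] rep_height[OF rep(2) p(2)] by simp
  then have "8000 * (max h k + 2) \<le> 8000 * (2 * p + 4)" by (intro mult_le_mono2) simp
  with 1(3) have "t \<le> 8000 * (2 * p + 4)" by (rule order_trans)
  also have "8000 * (2 * p + 4) \<le> 1000000 * (2 * p + 4)\<^sup>2"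
    by (intro mult_le_mono) (simp_all add: power2_eq_square)
  finally have "t \<le> cost p" unfolding cost_def .
  moreover have "isarr n T (ps @ qs) l r"
    using 1(2) p1 q1 ne by (intro isarrI) auto
  ultimately show ?thesis
    using that[OF 1(1)] cval_append1[OF ok ne(1)] cval_append2[OF ok ne(2)] p1 q1 by auto
qed

lemma lin_isarr:
  assumes "l \<in> \<int>" "r \<in> \<int>" "l < r"
  shows "\<exists>c. isarr n (linT l y r z) [c] l r \<and> cval [c] l = y \<and> cval [c] r = z"
proof -
  have "isarr n (linT l y r z) [linc l y r ((z - y) / (r - l))] l r"
    using assms by (intro isarrI[OF rep_linT]) auto
  moreover have "cval [linc l y r ((z - y) / (r - l))] l = y" "cval [linc l y r ((z - y) / (r - l))] r = z"
    using assms by (auto simp: cf_linc)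
  ultimately show ?thesis by blast
qed

text \<open>Each of the four cuts adds one chain and 4 to the bound on the pieces, hence the 4 and
  the 16.\<close>

lemma wp_open:
  assumes T: "isarr n T cs 0 (real L + 1)" and ij: "1 \<le> i" "i \<le> j" "j \<le> L" and p: "n + 4 * length cs + 100 < 2 ^ p"
  obtains A M B as ms bs t where
    "eval prog [enc T, RealV (real i), RealV (real j)] (prog ! 28) (PairV (enc A) (PairV (enc M) (enc B))) t"
    "isarr (n + 16) A as 0 (real i - 1)" "isarr (n + 16) M ms (real i) (real j)"
    "isarr (n + 16) B bs (real j + 1) (real L + 1)" "length as + length ms + length bs \<le> length cs + 4"
    "\<forall>x\<le>real i - 1. cval as x = cval cs x" "\<forall>x. real i \<le> x \<longrightarrow> x \<le> real j \<longrightarrow> cval ms x = cval cs x"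
    "\<forall>x\<ge>real j + 1. cval bs x = cval cs x" "t \<le> 4 * cost p + 1000"
proof -
  have m1: "real i - 1 \<in> \<int>" "0 \<le> real i - 1" "real i - 1 \<le> (real L + 1)" "n + 4 * length cs < 2 ^ p"
    using ij p by auto
  obtain A R1 as r1 t1 where 1: "eval prog [enc T, RealV (real i - 1)] (prog ! 23) (PairV (enc A) (enc R1)) t1"
    "isarr (n + 4) A as 0 (real i - 1)" "isarr (n + 4) R1 r1 (real i - 1) (real L + 1)"
    "length as + length r1 = Suc (length cs)" "\<forall>x\<le>real i - 1. cval as x = cval cs x"
    "\<forall>x\<ge>real i - 1. cval r1 x = cval cs x" "t1 \<le> cost p" "length as \<le> length cs" "length r1 \<le> length cs"
    by (rule split_isarr[OF T m1])
  have m2: "real i \<in> \<int>" "(real i - 1) \<le> real i" "real i \<le> (real L + 1)" "n + 4 + 4 * length r1 < 2 ^ p"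
    using ij p 1(9) by auto
  obtain G1 R2 g1 r2 t2 where 2: "eval prog [enc R1, RealV (real i)] (prog ! 23) (PairV (enc G1) (enc R2)) t2"
    "isarr (n + 4 + 4) G1 g1 (real i - 1) (real i)" "isarr (n + 4 + 4) R2 r2 (real i) (real L + 1)"
    "length g1 + length r2 = Suc (length r1)" "\<forall>x\<le>real i. cval g1 x = cval r1 x"
    "\<forall>x\<ge>real i. cval r2 x = cval r1 x" "t2 \<le> cost p" "length g1 \<le> length r1" "length r2 \<le> length r1"
    by (rule split_isarr[OF 1(3) m2])
  have m3: "real j \<in> \<int>" "(real i) \<le> real j" "real j \<le> (real L + 1)" "n + 4 + 4 + 4 * length r2 < 2 ^ p"
    using ij p 1(9) 2(9) by auto
  obtain M R3 ms r3 t3 where 3: "eval prog [enc R2, RealV (real j)] (prog ! 23) (PairV (enc M) (enc R3)) t3"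
    "isarr (n + 4 + 4 + 4) M ms (real i) (real j)" "isarr (n + 4 + 4 + 4) R3 r3 (real j) (real L + 1)"
    "length ms + length r3 = Suc (length r2)" "\<forall>x\<le>real j. cval ms x = cval r2 x"
    "\<forall>x\<ge>real j. cval r3 x = cval r2 x" "t3 \<le> cost p" "length ms \<le> length r2" "length r3 \<le> length r2"
    by (rule split_isarr[OF 2(3) m3])
  have m4: "real j + 1 \<in> \<int>" "(real j) \<le> real j + 1" "real j + 1 \<le> (real L + 1)" "n + 4 + 4 + 4 + 4 * length r3 < 2 ^ p"
    using ij p 1(9) 2(9) 3(9) by auto
  obtain G2 B g2 bs t4 where 4: "eval prog [enc R3, RealV (real j + 1)] (prog ! 23) (PairV (enc G2) (enc B)) t4"
    "isarr (n + 4 + 4 + 4 + 4) G2 g2 (real j) (real j + 1)" "isarr (n + 4 + 4 + 4 + 4) B bs (real j + 1) (real L + 1)"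
    "length g2 + length bs = Suc (length r3)" "\<forall>x\<le>real j + 1. cval g2 x = cval r3 x"
    "\<forall>x\<ge>real j + 1. cval bs x = cval r3 x" "t4 \<le> cost p" "length g2 \<le> length r3" "length bs \<le> length r3"
    by (rule split_isarr[OF 3(3) m4])
  have "wp [enc T, RealV (real i), RealV (real j)] (prog ! 28) (\<lambda>v t. v = PairV (enc A) (PairV (enc M) (enc B)) \<and>
    t \<le> t1 + t2 + t3 + t4 + 1000)"
    unfolding prog_nth(29) openB_def
    by (simp add: 1(1)[THEN wp_det] 2(1)[THEN wp_det] 3(1)[THEN wp_det] 4(1)[THEN wp_det])
  then obtain t where t: "eval prog [enc T, RealV (real i), RealV (real j)] (prog ! 28) (PairV (enc A) (PairV (enc M) (enc B))) t"
    "t \<le> t1 + t2 + t3 + t4 + 1000"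
    by (elim wpE) auto
  show ?thesis
  proof (rule that[OF t(1)])
    show "isarr (n + 16) A as 0 (real i - 1)" "isarr (n + 16) M ms (real i) (real j)"
      "isarr (n + 16) B bs (real j + 1) (real L + 1)"
      using isarr_mono[OF 1(2)] isarr_mono[OF 3(2)] isarr_mono[OF 4(3)] by auto
    show "length as + length ms + length bs \<le> length cs + 4"
      using 1(4) 2(4) 3(4) 4(4) by linarith
    show "t \<le> 4 * cost p + 1000" using t(2) 1(7) 2(7) 3(7) 4(7) by linarith
    show "\<forall>x. real i \<le> x \<longrightarrow> x \<le> real j \<longrightarrow> cval ms x = cval cs x"
      using 1(6) 2(6) 3(5) by simp
    show "\<forall>x\<ge>real j + 1. cval bs x = cval cs x"
      using 1(6) 2(6) 3(6) 4(6) ij by simp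
  qed (use 1(5) in auto)
qed

lemma wp_close:
  assumes A: "isarr n A as 0 (real i - 1)" and M: "isarr n M ms (real i) (real j)"
    and B: "isarr n B bs (real j + 1) (real L + 1)" and p: "length as + length ms + length bs + 4 < 2 ^ p"
  obtains T cs t where "eval prog [enc A, enc M, enc B] (prog ! 29) (enc T) t" "isarr n T cs 0 (real L + 1)"
    "length cs = length as + length ms + length bs + 2" "\<forall>x\<le>real i - 1. cval cs x = cval as x"
    "\<forall>x. real i \<le> x \<longrightarrow> x \<le> real j \<longrightarrow> cval cs x = cval ms x" "\<forall>x\<ge>real j + 1. cval cs x = cval bs x"
    "t \<le> 4 * cost p + 1000"
proof -
  note a = isarr_sel[OF A] and m = isarr_sel[OF M] and b = isarr_sel[OF B]
  let ?G = "linT (xr A) (yr A) (xl M) (yl M)" and ?H = "linT (xr M) (yr M) (xl B) (yl B)"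
  obtain g where g: "isarr n ?G [g] (real i - 1) (real i)" "cval [g] (real i - 1) = cval as (real i - 1)"
    "cval [g] (real i) = cval ms (real i)"
    using lin_isarr[of "real i - 1" "real i" n "yr A" "yl M"] a m by auto
  obtain h where h: "isarr n ?H [h] (real j) (real j + 1)" "cval [h] (real j) = cval ms (real j)"
    "cval [h] (real j + 1) = cval bs (real j + 1)"
    using lin_isarr[of "real j" "real j + 1" n "yr M" "yl B"] b m by auto
  obtain T1 t1 where 1: "eval prog [enc ?H, enc B] (prog ! 20) (enc T1) t1" "isarr n T1 ([h] @ bs) (real j) (real L + 1)"
    "\<And>x. x \<le> real j + 1 \<Longrightarrow> cval ([h] @ bs) x = cval [h] x" "\<And>x. real j + 1 \<le> x \<Longrightarrow> cval ([h] @ bs) x = cval bs x" "t1 \<le> cost p"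
    by (rule join_isarr[OF h(1) B h(3), of p]) (use p in auto)
  obtain T2 t2 where 2: "eval prog [enc M, enc T1] (prog ! 20) (enc T2) t2" "isarr n T2 (ms @ [h] @ bs) (real i) (real L + 1)"
    "\<And>x. x \<le> real j \<Longrightarrow> cval (ms @ [h] @ bs) x = cval ms x" "\<And>x. real j \<le> x \<Longrightarrow> cval (ms @ [h] @ bs) x = cval ([h] @ bs) x" "t2 \<le> cost p"
    by (rule join_isarr[OF M 1(2), of p]) (use p 1(3)[of "real j"] h(2) in auto)
  obtain T3 t3 where 3: "eval prog [enc ?G, enc T2] (prog ! 20) (enc T3) t3" "isarr n T3 ([g] @ ms @ [h] @ bs) (real i - 1) (real L + 1)"
    "\<And>x. x \<le> real i \<Longrightarrow> cval ([g] @ ms @ [h] @ bs) x = cval [g] x"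
    "\<And>x. real i \<le> x \<Longrightarrow> cval ([g] @ ms @ [h] @ bs) x = cval (ms @ [h] @ bs) x" "t3 \<le> cost p"
    by (rule join_isarr[OF g(1) 2(2), of p]) (use p 2(3)[of "real i"] g(3) m(6) in auto)
  obtain T t4 where 4: "eval prog [enc A, enc T3] (prog ! 20) (enc T) t4" "isarr n T (as @ [g] @ ms @ [h] @ bs) 0 (real L + 1)"
    "\<And>x. x \<le> real i - 1 \<Longrightarrow> cval (as @ [g] @ ms @ [h] @ bs) x = cval as x"
    "\<And>x. real i - 1 \<le> x \<Longrightarrow> cval (as @ [g] @ ms @ [h] @ bs) x = cval ([g] @ ms @ [h] @ bs) x" "t4 \<le> cost p"
    by (rule join_isarr[OF A 3(2), of p]) (use p 3(3)[of "real i - 1"] g(2) in auto)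
  have "wp [enc A, enc M, enc B] (prog ! 29) (\<lambda>v t. v = enc T \<and> t \<le> t1 + t2 + t3 + t4 + 1000)"
    unfolding prog_nth(30) closeB_def
    by (simp add: 1(1)[THEN wp_det] 2(1)[THEN wp_det] 3(1)[THEN wp_det] 4(1)[THEN wp_det])
  then obtain t where t: "eval prog [enc A, enc M, enc B] (prog ! 29) (enc T) t" "t \<le> t1 + t2 + t3 + t4 + 1000"
    by (elim wpE) auto
  show ?thesis
  proof (rule that[OF t(1) 4(2)])
    show "t \<le> 4 * cost p + 1000" using t(2) 1(5) 2(5) 3(5) 4(5) by linarith
    show "\<forall>x. real i \<le> x \<longrightarrow> x \<le> real j \<longrightarrow> cval (as @ [g] @ ms @ [h] @ bs) x = cval ms x"
      using 4(4) 3(4) 2(3) by simp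
    show "\<forall>x\<ge>real j + 1. cval (as @ [g] @ ms @ [h] @ bs) x = cval bs x"
      using 4(4) 3(4) 2(4) 1(4) m(6) by simp
  qed (use 4(3) in auto)
qed

definition mid_post :: "nat \<Rightarrow> chain list \<Rightarrow> nat \<Rightarrow> nat \<Rightarrow> (nat \<Rightarrow> real) \<Rightarrow> nat \<Rightarrow> val \<Rightarrow> nat \<Rightarrow> bool" where
  "mid_post n ms i j G p v t \<longleftrightarrow> (\<exists>M ds k. v = enc M \<and> isarr (n + 4 * k) M ds (real i) (real j) \<and>
    length ds + k = length ms \<and> (\<forall>m\<in>{i..j}. cval ds (real m) = G m) \<and> t \<le> (k + 1) * cost p + 1000)"

lemma mid_postI:
  "isarr (n + 4 * k) M ds (real i) (real j) \<Longrightarrow> length ds + k = length ms \<Longrightarrow>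
    (\<And>m. i \<le> m \<Longrightarrow> m \<le> j \<Longrightarrow> cval ds (real m) = G m) \<Longrightarrow> t \<le> (k + 1) * cost p + 1000 \<Longrightarrow>
    mid_post n ms i j G p (enc M) t"
  unfolding mid_post_def
  by (intro exI[of _ M] exI[of _ ds] exI[of _ k] conjI refl ballI) auto

text \<open>Two quantities are controlled. The number of chains is the potential that pays for the
  \<open>k\<close> merges. The sum \<open>m + 4 * length ds\<close> bounds the sizes of all trees;
  merges leave it unchanged, so it grows by a constant per operation.\<close>

definition op_post :: "nat \<Rightarrow> chain list \<Rightarrow> nat \<Rightarrow> (nat \<Rightarrow> real) \<Rightarrow> nat \<Rightarrow> val \<Rightarrow> nat \<Rightarrow> bool" where
  "op_post n cs L G p v t \<longleftrightarrow> (\<exists>T ds m k. v = enc T \<and> isarr m T ds 0 (real L + 1) \<and>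
    m + 4 * length ds \<le> n + 4 * length cs + 60 \<and> length ds + k \<le> length cs + 6 \<and>
    (\<forall>x\<in>{1..L}. cval ds (real x) = G x) \<and> t \<le> (k + 20) * cost p)"

lemma wp_range:
  assumes T: "isarr n T cs 0 (real L + 1)" and ij: "1 \<le> i" "i \<le> j" "j \<le> L" and p: "n + 4 * length cs + 100 < 2 ^ p"
    and mid: "\<And>A M B ms. isarr (n + 16) M ms (real i) (real j) \<Longrightarrow>
      (\<And>x. real i \<le> x \<Longrightarrow> x \<le> real j \<Longrightarrow> cval ms x = cval cs x) \<Longrightarrow> length ms \<le> length cs + 4 \<Longrightarrow>
      wp [PairV (enc A) (PairV (enc M) (enc B)), enc T, RealV (real i), RealV (real j), RealV c]
        (f (fstE (sndE (V 0)))) (mid_post (n + 16) ms i j G p)"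
    and H: "\<And>x. x \<in> {1..L} \<Longrightarrow> H x = (if x \<in> {i..j} then G x else cval cs (real x))"
  shows "wp [enc T, RealV (real i), RealV (real j), RealV c] (rangeB f) (op_post n cs L H p)"
proof -
  obtain A M B as ms bs t1 where 1:
    "eval prog [enc T, RealV (real i), RealV (real j)] (prog ! 28) (PairV (enc A) (PairV (enc M) (enc B))) t1"
    "isarr (n + 16) A as 0 (real i - 1)" "isarr (n + 16) M ms (real i) (real j)"
    "isarr (n + 16) B bs (real j + 1) (real L + 1)" "length as + length ms + length bs \<le> length cs + 4"
    "\<forall>x\<le>real i - 1. cval as x = cval cs x" "\<forall>x. real i \<le> x \<longrightarrow> x \<le> real j \<longrightarrow> cval ms x = cval cs x"
    "\<forall>x\<ge>real j + 1. cval bs x = cval cs x" "t1 \<le> 4 * cost p + 1000"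
    by (rule wp_open[OF T ij p], rule that)
  have "length ms \<le> length cs + 4" using 1(5) by simp
  moreover have "\<And>x. real i \<le> x \<Longrightarrow> x \<le> real j \<Longrightarrow> cval ms x = cval cs x" using 1(7) by blast
  ultimately have "wp [PairV (enc A) (PairV (enc M) (enc B)), enc T, RealV (real i), RealV (real j), RealV c]
    (f (fstE (sndE (V 0)))) (mid_post (n + 16) ms i j G p)" by (intro mid 1(3)) auto
  then obtain M' ds k t2 where 2:
    "eval prog [PairV (enc A) (PairV (enc M) (enc B)), enc T, RealV (real i), RealV (real j), RealV c]
        (f (fstE (sndE (V 0)))) (enc M') t2"
    "isarr (n + 16 + 4 * k) M' ds (real i) (real j)" "length ds + k = length ms"
    "\<forall>m\<in>{i..j}. cval ds (real m) = G m" "t2 \<le> (k + 1) * cost p + 1000"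
    unfolding mid_post_def by (elim wpE) blast
  have A: "isarr (n + 16 + 4 * k) A as 0 (real i - 1)" and B: "isarr (n + 16 + 4 * k) B bs (real j + 1) (real L + 1)"
    using isarr_mono[OF 1(2)] isarr_mono[OF 1(4)] by auto
  have len: "length as + length ds + length bs + 4 < 2 ^ p" using 1(5) 2(3) p by linarith
  obtain T' cs' t3 where 3: "eval prog [enc A, enc M', enc B] (prog ! 29) (enc T') t3"
    "isarr (n + 16 + 4 * k) T' cs' 0 (real L + 1)"
    "length cs' = length as + length ds + length bs + 2" "\<forall>x\<le>real i - 1. cval cs' x = cval as x"
    "\<forall>x. real i \<le> x \<longrightarrow> x \<le> real j \<longrightarrow> cval cs' x = cval ds x" "\<forall>x\<ge>real j + 1. cval cs' x = cval bs x"
    "t3 \<le> 4 * cost p + 1000"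
    by (rule wp_close[OF A 2(2) B len], rule that)
  have val: "cval cs' (real x) = H x" if "x \<in> {1..L}" for x
  proof -
    consider "x < i" | "i \<le> x \<and> x \<le> j" | "j < x" by linarith
    then show ?thesis
    proof cases
      case 1
      then have "real x \<le> real i - 1" by linarith
      then show ?thesis using 3(4) \<open>\<forall>x\<le>real i - 1. cval as x = cval cs x\<close> H[OF that] 1 by simp
    next
      case 2
      then show ?thesis using 3(5) \<open>\<forall>m\<in>{i..j}. cval ds (real m) = G m\<close> H[OF that] by simp
    next
      case 3
      then have "real j + 1 \<le> real x" by linarith
      then show ?thesis using \<open>\<forall>x\<ge>real j + 1. cval cs' x = cval bs x\<close> 1(8) H[OF that] 3 by simp
    qed
  qed
  have "op_post n cs L H p (enc T') t" if t: "t \<le> t1 + t2 + t3 + 1000" for t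
    unfolding op_post_def
  proof (intro exI conjI)
    show "isarr (n + 16 + 4 * k) T' cs' 0 (real L + 1)" by fact
    show "n + 16 + 4 * k + 4 * length cs' \<le> n + 4 * length cs + 60" "length cs' + k \<le> length cs + 6"
      using 1(5) 2(3) 3(3) by linarith+
    \<comment> \<open>Opening and closing cost four splits or joins each and the middle part
      \<open>k + 1\<close> rounds; the rest absorbs the additive constants.\<close>
    show "t \<le> (k + 20) * cost p"
      using t 1(9) 2(5) 3(7) cost_ge[of p] by (simp add: add_mult_distrib)
  qed (use val in auto)
  then show ?thesis
    unfolding rangeB_def
    by (simp add: 1(1)[THEN wp_det] 2(1)[THEN wp_det] 3(1)[THEN wp_det])
qed

lemma wp_mid_add:
  assumes M: "isarr n M ms (real i) (real j)" and t: "t \<le> 1000"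
  shows "mid_post n ms i j (\<lambda>m. cval ms (real m) + g * real m + c) p (enc (addT g c M)) t"
proof -
  obtain h where rep: "rep n h M ms" using M unfolding isarr_def by blast
  note m = isarr_sel[OF M]
  have "ms \<noteq> []" using m(1) by auto
  then have "isarr n (addT g c M) (map (addc g c) ms) (real i) (real j)"
    using m by (intro isarrI[OF rep_addT[OF rep]]) (auto simp: intl_def)
  then show ?thesis
    using t m by (intro mid_postI[where k = 0 and ds = "map (addc g c) ms"]) (auto simp: cval_addc)
qed

text \<open>The slack of 1000 steps covers the evaluation around the call, so the caller need not
  count it exactly.\<close>

lemma wp_mid_wave:
  assumes M: "isarr n M ms (real i) (real j)" and p: "n + 4 * length ms < 2 ^ p"
  shows "wp [enc M, RealV a] (prog ! 26) (\<lambda>v t. \<forall>s\<le>t + 1000.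
    mid_post n ms i j (\<lambda>k. MIN t\<in>{i..k}. cval ms (real t) + (real k - real t) * a) p v s)"
proof -
  obtain h where rep: "rep n h M ms" using M unfolding isarr_def by blast
  note m = isarr_sel[OF M]
  from wp_wave[OF rep m(7) p] show ?thesis
  proof (rule wp_mono)
    fix v t assume "wave_post n a ms p v t"
    then obtain T h ds k where 1: "v = enc T" "rep (n + 4 * k) h T ds" "intl ds" "length ds + k = length ms"
      "wave a ms ds" "t \<le> (k + 1) * (1000000 * (2 * p + 4)\<^sup>2)"
      by (elim wave_postE)
    have "isarr (n + 4 * k) T ds (real i) (real j)"
      using 1(5) m by (intro isarrI[OF 1(2,3)]) (auto simp: wave_def)
    then show "\<forall>s\<le>t + 1000. mid_post n ms i j (\<lambda>k. MIN t\<in>{i..k}. cval ms (real t) + (real k - real t) * a) p v s"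
      unfolding 1(1) using 1(4,6) left_wave_Min[OF m(1,7) 1(5) m(8,9)] unfolding cost_def[symmetric]
      by (intro allI impI mid_postI) auto
  qed
qed

lemma wp_mid_rwave:
  assumes M: "isarr n M ms (real i) (real j)" and p: "n + 4 * length ms < 2 ^ p"
  shows "wp [enc (mirT M), RealV a] (prog ! 26) (\<lambda>v t. \<exists>T. v = enc T \<and> (\<forall>s\<le>t + 1000.
    mid_post n ms i j (\<lambda>k. MIN t\<in>{k..j}. cval ms (real t) + (real t - real k) * a) p (enc (mirT T)) s))"
proof -
  obtain h where rep: "rep n h M ms" using M unfolding isarr_def by blast
  note m = isarr_sel[OF M]
  have ne: "ms \<noteq> []" using m(1) by auto
  have p': "n + 4 * length (map mirc (rev ms)) < 2 ^ p" using p by simp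
  from wp_wave[OF rep_mirT[OF rep] intl_mirc[OF m(7)] p'] show ?thesis
  proof (rule wp_mono)
    fix v t assume "wave_post n a (map mirc (rev ms)) p v t"
    then obtain T h ds k where 1: "v = enc T" "rep (n + 4 * k) h T ds" "intl ds" "length ds + k = length (map mirc (rev ms))"
      "wave a (map mirc (rev ms)) ds" "t \<le> (k + 1) * (1000000 * (2 * p + 4)\<^sup>2)"
      by (elim wave_postE)
    have okd: "okl ds" using rep_okl[OF 1(2)] .
    then have ned: "ds \<noteq> []" by auto
    have "isarr (n + 4 * k) (mirT T) (map mirc (rev ds)) (real i) (real j)"
      using 1(5) m ne ned by (intro isarrI[OF rep_mirT[OF 1(2)] intl_mirc[OF 1(3)]]) (auto simp: wave_def)
    then have "\<forall>s\<le>t + 1000. mid_post n ms i j (\<lambda>k. MIN t\<in>{k..j}. cval ms (real t) + (real t - real k) * a) p (enc (mirT T)) s"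
      using 1(4,6) right_wave_Min[OF m(1,7) 1(5) m(8,9)] unfolding cost_def[symmetric]
      by (intro allI impI mid_postI[where k = k and ds = "map mirc (rev ds)"]) (auto simp: cval_mirc[OF okd])
    with 1(1) show "\<exists>T. v = enc T \<and> (\<forall>s\<le>t + 1000.
      mid_post n ms i j (\<lambda>k. MIN t\<in>{k..j}. cval ms (real t) + (real t - real k) * a) p (enc (mirT T)) s)" by blast
  qed
qed

lemma mid_post_cong:
  assumes "mid_post n ms i j G p v t" "\<And>m. i \<le> m \<Longrightarrow> m \<le> j \<Longrightarrow> G m = G' m"
  shows "mid_post n ms i j G' p v t"
  using assms unfolding mid_post_def by (metis atLeastAtMost_iff)

lemma op_step:
  assumes T: "isarr n T cs 0 (real L + 1)" and A: "\<And>k. k \<in> {1..L} \<Longrightarrow> cval cs (real k) = A k"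
    and valid: "valid_op L op" and p: "n + 4 * length cs + 100 < 2 ^ p"
  obtains T' ds m k v t where "eval prog (enc T # parameters op) (prog ! entry op) v t"
    "result op v (returned op A) (enc T')" "isarr m T' ds 0 (real L + 1)"
    "m + 4 * length ds \<le> n + 4 * length cs + 60" "length ds + k \<le> length cs + 6"
    "\<forall>x\<in>{1..L}. cval ds (real x) = apply_op op A x" "t \<le> (k + 20) * cost p"
proof -
  note cont = that
  have range: thesis if "wp (enc T # parameters op) (prog ! entry op) (op_post n cs L (apply_op op A) p)"
    "\<And>v. result op v (returned op A) v"
    using that(1)
  proof (rule wpE)
    fix v t assume e: "eval prog (enc T # parameters op) (prog ! entry op) v t" and "op_post n cs L (apply_op op A) p v t"
    then obtain T' ds m k where "v = enc T'" "isarr m T' ds 0 (real L + 1)" "m + 4 * length ds \<le> n + 4 * length cs + 60"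
      "length ds + k \<le> length cs + 6" "\<forall>x\<in>{1..L}. cval ds (real x) = apply_op op A x" "t \<le> (k + 20) * cost p"
      unfolding op_post_def by blast
    with e that(2)[of v] show thesis by (intro cont[of v t T' m ds k]) auto
  qed
  show thesis
  proof (cases op)
    case (Lookup i)
    with valid have i: "1 \<le> i" "i \<le> L" by auto
    have m: "real i \<in> \<int>" "0 \<le> real i" "real i \<le> real L + 1" "n + 4 * length cs < 2 ^ p" using i p by auto
    obtain P Q ps qs t where 1: "eval prog [enc T, RealV (real i)] (prog ! 23) (PairV (enc P) (enc Q)) t"
      "isarr (n + 4) P ps 0 (real i)" "\<forall>x\<le>real i. cval ps x = cval cs x" "t \<le> cost p"
      by (rule split_isarr[OF T m]) blast
    have yr: "yr P = A i" using isarr_sel(5)[OF 1(2)] 1(3) A[of i] i by simp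
    have "wp [enc T, RealV (real i)] (prog ! 1) (\<lambda>v s. v = PairV (RealV (A i)) (enc T) \<and> s \<le> t + 1000)"
      unfolding One_nat_def prog_nth(2) lookupB_def by (simp add: 1(1)[THEN wp_det] yr)
    then obtain s where s: "eval prog [enc T, RealV (real i)] (prog ! 1) (PairV (RealV (A i)) (enc T)) s" "s \<le> t + 1000"
      by (elim wpE) auto
    have "s \<le> (0 + 20) * cost p" using s(2) 1(4) cost_ge[of p] by simp
    then show thesis
      using Lookup s(1) T A by (intro cont[of "PairV (RealV (A i)) (enc T)" s T n cs 0]) auto
  next
    case (AddConst i j c)
    with valid have ij: "1 \<le> i" "i \<le> j" "j \<le> L" by auto
    show thesis
    proof (rule range)
      have "wp [enc T, RealV (real i), RealV (real j), RealV c] (rangeB (\<lambda>m. ADD m (Const 0) (V 4)))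
        (op_post n cs L (apply_op op A) p)"
      proof (rule wp_range[OF T ij p, where G = "\<lambda>m. cval cs (real m) + c"])
        fix A' M B ms assume M: "isarr (n + 16) M ms (real i) (real j)" and v: "\<And>x. real i \<le> x \<Longrightarrow> x \<le> real j \<Longrightarrow> cval ms x = cval cs x"
        have "mid_post (n + 16) ms i j (\<lambda>m. cval cs (real m) + c) p (enc (addT 0 c M)) t" if "t \<le> 1000" for t
          by (rule mid_post_cong[OF wp_mid_add[OF M that]]) (simp add: v)
        then show "wp [PairV (enc A') (PairV (enc M) (enc B)), enc T, RealV (real i), RealV (real j), RealV c]
          (ADD (fstE (sndE (V 0))) (Const 0) (V 4)) (mid_post (n + 16) ms i j (\<lambda>m. cval cs (real m) + c) p)" by simp
      qed (use AddConst A in auto)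
      then show "wp (enc T # parameters op) (prog ! entry op) (op_post n cs L (apply_op op A) p)"
        unfolding AddConst entry.simps parameters.simps prog_nth(3) .
    qed (simp add: AddConst)
  next
    case (AddGradient i j g)
    with valid have ij: "1 \<le> i" "i \<le> j" "j \<le> L" by auto
    show thesis
    proof (rule range)
      have "wp [enc T, RealV (real i), RealV (real j), RealV g] (rangeB (\<lambda>m. ADD m (V 4) (Const 0)))
        (op_post n cs L (apply_op op A) p)"
      proof (rule wp_range[OF T ij p, where G = "\<lambda>m. cval cs (real m) + real m * g"])
        fix A' M B ms assume M: "isarr (n + 16) M ms (real i) (real j)" and v: "\<And>x. real i \<le> x \<Longrightarrow> x \<le> real j \<Longrightarrow> cval ms x = cval cs x"
        have "mid_post (n + 16) ms i j (\<lambda>m. cval cs (real m) + real m * g) p (enc (addT g 0 M)) t" if "t \<le> 1000" for t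
          by (rule mid_post_cong[OF wp_mid_add[OF M that]]) (simp add: v)
        then show "wp [PairV (enc A') (PairV (enc M) (enc B)), enc T, RealV (real i), RealV (real j), RealV g]
          (ADD (fstE (sndE (V 0))) (V 4) (Const 0)) (mid_post (n + 16) ms i j (\<lambda>m. cval cs (real m) + real m * g) p)" by simp
      qed (use AddGradient A in auto)
      then show "wp (enc T # parameters op) (prog ! entry op) (op_post n cs L (apply_op op A) p)"
        unfolding AddGradient entry.simps parameters.simps prog_nth(4) .
    qed (simp add: AddGradient)
  next
    case (LeftLinearWave i j a)
    with valid have ij: "1 \<le> i" "i \<le> j" "j \<le> L" by auto
    let ?G = "\<lambda>k. MIN t\<in>{i..k}. cval cs (real t) + (real k - real t) * a"
    show thesis
    proof (rule range)
      have "wp [enc T, RealV (real i), RealV (real j), RealV a] (rangeB (\<lambda>m. WAVE m (V 4)))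
        (op_post n cs L (apply_op op A) p)"
      proof (rule wp_range[OF T ij p, where G = ?G])
        fix A' M B ms assume M: "isarr (n + 16) M ms (real i) (real j)" and v: "\<And>x. real i \<le> x \<Longrightarrow> x \<le> real j \<Longrightarrow> cval ms x = cval cs x"
          and len: "length ms \<le> length cs + 4"
        have "n + 16 + 4 * length ms < 2 ^ p" using len p by linarith
        from wp_mid_wave[OF M this, of a] obtain u t where 1: "eval prog [enc M, RealV a] (prog ! 26) u t"
          "\<forall>s\<le>t + 1000. mid_post (n + 16) ms i j (\<lambda>k. MIN t\<in>{i..k}. cval ms (real t) + (real k - real t) * a) p u s"
          by (elim wpE)
        have "mid_post (n + 16) ms i j ?G p u s" if "s \<le> t + 1000" for s
          by (rule mid_post_cong[OF 1(2)[rule_format, OF that]]) (simp add: v cong: image_cong_simp)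
        then show "wp [PairV (enc A') (PairV (enc M) (enc B)), enc T, RealV (real i), RealV (real j), RealV a]
          (WAVE (fstE (sndE (V 0))) (V 4)) (mid_post (n + 16) ms i j ?G p)" by (simp add: 1(1)[THEN wp_det])
      qed (use LeftLinearWave A ij in \<open>auto cong: image_cong_simp\<close>)
      then show "wp (enc T # parameters op) (prog ! entry op) (op_post n cs L (apply_op op A) p)"
        unfolding LeftLinearWave entry.simps parameters.simps prog_nth(5) .
    qed (simp add: LeftLinearWave)
  next
    case (RightLinearWave i j a)
    with valid have ij: "1 \<le> i" "i \<le> j" "j \<le> L" by auto
    let ?G = "\<lambda>k. MIN t\<in>{k..j}. cval cs (real t) + (real t - real k) * a"
    show thesis
    proof (rule range)
      have "wp [enc T, RealV (real i), RealV (real j), RealV a] (rangeB (\<lambda>m. MIR (WAVE (MIR m) (V 4))))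
        (op_post n cs L (apply_op op A) p)"
      proof (rule wp_range[OF T ij p, where G = ?G])
        fix A' M B ms assume M: "isarr (n + 16) M ms (real i) (real j)" and v: "\<And>x. real i \<le> x \<Longrightarrow> x \<le> real j \<Longrightarrow> cval ms x = cval cs x"
          and len: "length ms \<le> length cs + 4"
        have "n + 16 + 4 * length ms < 2 ^ p" using len p by linarith
        from wp_mid_rwave[OF M this, of a] obtain T2 t where 1: "eval prog [enc (mirT M), RealV a] (prog ! 26) (enc T2) t"
          "\<forall>s\<le>t + 1000. mid_post (n + 16) ms i j (\<lambda>k. MIN t\<in>{k..j}. cval ms (real t) + (real t - real k) * a) p (enc (mirT T2)) s"
          by (elim wpE) blast
        have "mid_post (n + 16) ms i j ?G p (enc (mirT T2)) s" if "s \<le> t + 1000" for s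
          by (rule mid_post_cong[OF 1(2)[rule_format, OF that]]) (simp add: v cong: image_cong_simp)
        then show "wp [PairV (enc A') (PairV (enc M) (enc B)), enc T, RealV (real i), RealV (real j), RealV a]
          (MIR (WAVE (MIR (fstE (sndE (V 0)))) (V 4))) (mid_post (n + 16) ms i j ?G p)" by (simp add: 1(1)[THEN wp_det])
      qed (use RightLinearWave A ij in \<open>auto cong: image_cong_simp\<close>)
      then show "wp (enc T # parameters op) (prog ! entry op) (op_post n cs L (apply_op op A) p)"
        unfolding RightLinearWave entry.simps parameters.simps prog_nth(6) .
    qed (simp add: RightLinearWave)
  qed
qed

section \<open>Amortisation over the whole sequence\<close>

lemma run_bound:
  assumes "isarr n T cs 0 (real L + 1)" "\<And>k. k \<in> {1..L} \<Longrightarrow> cval cs (real k) = A k"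
    and "\<forall>op\<in>set ops. valid_op L op" and "n + 4 * length cs + 60 * length ops + 100 < 2 ^ p"
  shows "\<exists>t. run_ops prog (enc T) ops (answers A ops) t \<and> t \<le> (26 * length ops + length cs) * cost p"
  using assms
proof (induction ops arbitrary: n T cs A)
  case Nil
  show ?case by (auto intro: run_ops.Done)
next
  case (Cons op ops)
  have v: "valid_op L op" using Cons.prems(3) by simp
  have p: "n + 4 * length cs + 100 < 2 ^ p" using Cons.prems(4) by simp
  obtain T' ds m k v t where 1: "eval prog (enc T # parameters op) (prog ! entry op) v t"
    "result op v (returned op A) (enc T')" "isarr m T' ds 0 (real L + 1)"
    "m + 4 * length ds \<le> n + 4 * length cs + 60" "length ds + k \<le> length cs + 6"
    "\<forall>x\<in>{1..L}. cval ds (real x) = apply_op op A x" "t \<le> (k + 20) * cost p"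
    by (rule op_step[OF Cons.prems(1,2) v p], assumption, rule that)
  \<comment> \<open>The exponent \<open>p\<close> is fixed for the whole run and belongs to the
    analysis, not to the program; each operation may use up 60 of the reserve.\<close>
  have "m + 4 * length ds + 60 * length ops + 100 < 2 ^ p" using 1(4) Cons.prems(4) by simp
  then obtain t' where 2: "run_ops prog (enc T') ops (answers (apply_op op A) ops) t'"
    "t' \<le> (26 * length ops + length ds) * cost p"
    using Cons.IH[OF 1(3) 1(6)[rule_format]] Cons.prems(3) by auto
  have "entry op < length prog" by (cases op) auto
  then have "run_ops prog (enc T) (op # ops) (answers A (op # ops)) (t + t')"
    using run_ops.Step[OF _ 1(1,2) 2(1)] by simp
  moreover have "t + t' \<le> (k + 20 + (26 * length ops + length ds)) * cost p"
    using 1(7) 2(2) by (simp add: add_mult_distrib)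
  \<comment> \<open>By \<open>length ds + k \<le> length cs + 6\<close> the merges are paid by the
    chains they remove, and 26 = 20 + 6.\<close>
  moreover have "(k + 20 + (26 * length ops + length ds)) * cost p \<le> (26 * length (op # ops) + length cs) * cost p"
    using 1(5) by (intro mult_le_mono1) simp
  ultimately show ?case by (meson order_trans)
qed

text \<open>164 = 4 + 60 + 100 accounts for the initial chain, the growth per operation and the
  fixed reserve, with at least one operation present. 28 = 26 + 2 adds the potential of the initial
  chain and the creation of the structure.\<close>

lemma executes_bound:
  assumes L: "1 \<le> L" and ops: "ops \<noteq> []" "\<forall>op\<in>set ops. valid_op L op" and p: "164 * length ops < 2 ^ p"
  shows "\<exists>t. executes prog L ops (answers (\<lambda>_. 0) ops) t \<and> t \<le> length ops * (28 * cost p)"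
proof -
  let ?T = "linT 0 0 (real L + 1) 0"
  have len: "1 \<le> length ops" using ops(1) by (cases ops) auto
  let ?c = "linc 0 0 (real L + 1) ((0 - 0) / (real L + 1 - 0))"
  have arr: "isarr 0 ?T [?c] 0 (real L + 1)"
    by (intro isarrI[OF rep_linT]) auto
  have val: "cval [?c] (real k) = 0" for k
    by (simp add: cf_linc)
  have one: "length [?c] = 1"
    by (simp add: One_nat_def)
  have len': "0 + 4 * length [?c] + 60 * length ops + 100 < 2 ^ p"
    using p len by (simp add: One_nat_def)
  obtain t where t: "run_ops prog (enc ?T) ops (answers (\<lambda>_. 0) ops) t" "t \<le> (26 * length ops + 1) * cost p"
    using run_bound[OF arr val ops(2) len'] unfolding one by blast
  have "wp [RealV (real L)] (prog ! 0) (\<lambda>v s. v = enc ?T \<and> s \<le> 100)"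
    unfolding prog_nth(1) initB_def by simp
  then obtain s where s: "eval prog [RealV (real L)] (prog ! 0) (enc ?T) s" "s \<le> 100"
    by (elim wpE) auto
  have "executes prog L ops (answers (\<lambda>_. 0) ops) (s + t)"
    unfolding executes_def using s(1) t(1) by (intro exI[of _ "enc ?T"] exI[of _ s] exI[of _ t]) simp
  moreover have "s + t \<le> length ops * (28 * cost p)"
  proof -
    have "s + t \<le> (26 * length ops + 2) * cost p" using s(2) t(2) cost_ge[of p] by (simp add: add_mult_distrib)
    also have "\<dots> \<le> (28 * length ops) * cost p" using len by (intro mult_le_mono1) simp
    finally show ?thesis by (simp add: mult_ac)
  qed
  ultimately show ?thesis by blast
qed

theorem mainTheorem1:
  "\<exists>(P :: program) (d :: nat) (a :: nat \<Rightarrow> real).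
     a \<in> O(\<lambda>s. ln (real s) ^ d) \<and>
     (\<forall>(L :: nat) (ops :: operation list).
        1 \<le> L \<longrightarrow> ops \<noteq> [] \<longrightarrow> (\<forall>op \<in> set ops. valid_op L op) \<longrightarrow>
        (\<exists>t. executes P L ops (answers (\<lambda>_. 0) ops) t \<and>
             real t \<le> real (length ops) * a (length ops)))"
proof -
  \<comment> \<open>This is \<open>28 * cost (q + 8)\<close> with \<open>q\<close> at most one above
    the binary logarithm, hence the 9. The additive constants keep the bound valid for a single
    operation, where \<open>ln\<close> vanishes.\<close>
  define a :: "nat \<Rightarrow> real" where "a s = 28000000 * (2 * (ln (real s) / ln 2 + 9) + 4) ^ 2" for s
  have a: "a \<in> O(\<lambda>s. ln (real s) ^ 2)"
    unfolding a_def by real_asymp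
  have "\<exists>t. executes prog L ops (answers (\<lambda>_. 0) ops) t \<and> real t \<le> real (length ops) * a (length ops)"
    if L: "1 \<le> L" and ops: "ops \<noteq> []" "\<forall>op\<in>set ops. valid_op L op" for L :: nat and ops :: "operation list"
  proof -
    let ?s = "length ops"
    have s: "1 \<le> ?s" using ops(1) by (cases ops) auto
    define q where "q = nat \<lceil>log 2 (real ?s)\<rceil>"
    have s': "1 \<le> real ?s" using s by linarith
    then have log: "0 \<le> log 2 (real ?s)" by (subst zero_le_log_cancel_iff) linarith+
    have q: "log 2 (real ?s) \<le> real q" "real q \<le> log 2 (real ?s) + 1"
      using log by (simp_all add: q_def)
    have "real ?s = 2 powr log 2 (real ?s)" by (rule powr_log_cancel[symmetric]) (use s' in linarith)+
    also have "\<dots> \<le> 2 powr real q" using q(1) by simp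
    also have "\<dots> = real (2 ^ q)" by (simp add: powr_realpow)
    finally have "?s \<le> 2 ^ q" by linarith
    \<comment> \<open>The 8 is chosen because 164 is below 2 ^ 8.\<close>
    then have "164 * ?s < 2 ^ (q + 8)" unfolding power_add using s by simp
    from executes_bound[OF L ops this] obtain t where t: "executes prog L ops (answers (\<lambda>_. 0) ops) t"
      "t \<le> ?s * (28 * cost (q + 8))" by blast
    have "real (28 * cost (q + 8)) = 28000000 * (2 * (real q + 8) + 4) ^ 2"
      by (simp add: cost_def)
    also have "\<dots> \<le> a ?s"
      unfolding a_def log_def[symmetric] using q(2) by (intro mult_left_mono power_mono) auto
    finally have "real ?s * real (28 * cost (q + 8)) \<le> real ?s * a ?s"
      by (intro mult_left_mono) auto
    moreover have "real t \<le> real ?s * real (28 * cost (q + 8))"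
      using t(2) by (metis of_nat_le_iff of_nat_mult)
    ultimately show "\<exists>t. executes prog L ops (answers (\<lambda>_. 0) ops) t \<and> real t \<le> real ?s * a ?s"
      using t(1) by (intro exI[of _ t]) linarith
  qed
  with a show ?thesis by (intro exI[of _ prog] exI[of _ 2] exI[of _ a]) blast
qed

end
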